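(* Let $d,m\ge 1$ be integers and let $p_{\mathbf x},p_{\mathbf y}$ be the laws of two zero-mean Gaussian stationary random fields $\mathbf x=\{\mathbf x_{\mathbf t},\ \mathbf t\in\mathbb Z^d\}$ and $\mathbf y=\{\mathbf y_{\mathbf t},\ \mathbf t\in\mathbb Z^d\}$ with values in $\mathbb R^m$, whose power spectral densities $\Phi_{\mathbf x},\Phi_{\mathbf y}$ belong to $\mathcal S_m^+(\mathbb T^d)$ (bounded and coercive). Let $$d(p_{\mathbf x},p_{\mathbf y})^2:=\inf_{p_{\mathbf x,\mathbf y}}\ \mathbb E\big[\|\mathbf x_{\mathbf t}-\mathbf y_{\mathbf t}\|^2\big],$$ where the infimum is over all jointly Gaussian, jointly stationary, zero-mean laws $p_{\mathbf x,\mathbf y}$ of the pair $(\mathbf x,\mathbf y)$ whose marginals are $p_{\mathbf x}$ and $p_{\mathbf y}$. Then $$d(p_{\mathbf x},p_{\mathbf y})^2=\operatorname{tr}\int_{\mathbb T^d}\Big(\Phi_{\mathbf x}+\Phi_{\mathbf y}-2\big(\Phi_{\mathbf y}^{1/2}\,\Phi_{\mathbf x}\,\Phi_{\mathbf y}^{1/2}\big)^{1/2}\Big)\,\mathrm d\mu,$$ that is, $d(p_{\mathbf x},p_{\mathbf y})$ is the Hellinger distance between $\Phi_{\mathbf x}$ and $\Phi_{\mathbf y}$.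
   Context: Notation: $\mathbb T^d=[0,2\pi]^d$; $\mathrm d\mu(\boldsymbol\vartheta)=\frac{1}{(2\pi)^d}\prod_{k=1}^d \mathrm d\vartheta_k$ is the normalized Lebesgue measure on $\mathbb T^d$; $j$ is the imaginary unit; $\|\cdot\|$ is the Euclidean norm; $A^{1/2}$ is the Hermitian positive semidefinite square root of a positive semidefinite Hermitian matrix $A$; all operations on spectral densities are pointwise in $\boldsymbol\vartheta$. A zero-mean stationary random field $\mathbf z=\{\mathbf z_{\mathbf t}\}_{\mathbf t\in\mathbb Z^d}$ with values in $\mathbb R^n$ has covariance field $R_{\mathbf t}=\mathbb E[\mathbf z_{\mathbf t+\mathbf s}\mathbf z_{\mathbf s}^T]$ (independent of $\mathbf s$), and its power spectral density is $\Phi(e^{j\boldsymbol\vartheta})=\sum_{\mathbf t\in\mathbb Z^d}R_{\mathbf t}e^{-j\langle\boldsymbol\vartheta,\mathbf t\rangle}$, i.e. the Hermitian positive semidefinite matrix function on $\mathbb T^d$ whose Fourier coefficients are the $R_{\mathbf t}$. $\mathcal S_m^+(\mathbb T^d)$ is the set of $m\times m$ power spectral densities $\Phi$ that are bounded and coercive, i.e. there are constants $0<c\le C<\infty$ with $cI\le\Phi(e^{j\boldsymbol\vartheta})\le CI$ for (almost) all $\boldsymbol\vartheta$. Since the fields are zero-mean Gaussian, a law is determined by its finite-dimensional distributions at pairs of indices, equivalently by its covariance field. The joint law $p_{\mathbf x,\mathbf y}$ is the law of the $\mathbb R^{2m}$-valued zero-mean stationary Gaussian field $[\mathbf x_{\mathbf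 t}^T\ \mathbf y_{\mathbf t}^T]^T$, and the marginal constraints say that the law of its $\mathbf x$-component is $p_{\mathbf x}$ and that of its $\mathbf y$-component is $p_{\mathbf y}$. By stationarity the cost does not depend on $\mathbf t$. *)

theory Defs
  imports "HOL-Probability.Probability"
begin

text \<open>Fields are represented by their laws: probability measures on the space of all
  configurations, with the product sigma-algebra.\<close>

definition field_space :: "(int ^ 'd \<Rightarrow> real ^ 'n) measure" where
  "field_space = (\<Pi>\<^sub>M t\<in>UNIV. borel)"

definition zero_mean_stationary :: "(int ^ 'd \<Rightarrow> real ^ 'n) measure \<Rightarrow> bool" where
  "zero_mean_stationary p \<longleftrightarrow>
     prob_space p \<and> sets p = sets field_space \<and>
     (\<forall>t. integrable p (\<lambda>z. (norm (z t))\<^sup>2)) \<and>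
     (\<forall>t. (\<integral>z. z t \<partial>p) = 0) \<and>
     (\<forall>s. distr p field_space (\<lambda>z t. z (t + s)) = p)"

text \<open>Dirac measures count as (degenerate) Gaussian laws.\<close>

definition gaussian_law :: "real measure \<Rightarrow> bool" where
  "gaussian_law N \<longleftrightarrow>
     (\<exists>\<mu>. N = return borel \<mu>) \<or>
     (\<exists>\<mu> \<sigma>. 0 < \<sigma> \<and> N = density lborel (normal_density \<mu> \<sigma>))"

definition gaussian_field :: "(int ^ 'd \<Rightarrow> real ^ 'n) measure \<Rightarrow> bool" where
  "gaussian_field p \<longleftrightarrow>
     (\<forall>T a. finite T \<longrightarrow> gaussian_law (distr p borel (\<lambda>z. \<Sum>t\<in>T. a t \<bullet> z t)))"

definition zero_mean_gaussian_stationary :: "(int ^ 'd \<Rightarrow> real ^ 'n) measure \<Rightarrow> bool" where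
  "zero_mean_gaussian_stationary p \<longleftrightarrow> zero_mean_stationary p \<and> gaussian_field p"

text \<open>\<open>R t = E[z (t + s) (z s)\<^sup>T]\<close>; by stationarity we may take \<open>s = 0\<close>.\<close>

definition covariance_field ::
    "(int ^ 'd \<Rightarrow> real ^ 'n) measure \<Rightarrow> int ^ 'd \<Rightarrow> real ^ 'n ^ 'n" where
  "covariance_field p t = (\<chi> i k. \<integral>z. z t $ i * z 0 $ k \<partial>p)"

text \<open>The inner product on \<^typ>\<open>complex ^ 'n\<close> is the real part of the Hermitian one, which for
  Hermitian \<open>A\<close> loses nothing in the quadratic form of \<open>A\<close>.\<close>

definition hermitian_psd :: "complex ^ 'n ^ 'n \<Rightarrow> bool" where
  "hermitian_psd A \<longleftrightarrow>
     (\<forall>i k. A $ i $ k = cnj (A $ k $ i)) \<and> (\<forall>v. 0 \<le> v \<bullet> (A *v v))"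

definition loewner_le :: "complex ^ 'n ^ 'n \<Rightarrow> complex ^ 'n ^ 'n \<Rightarrow> bool" where
  "loewner_le A B \<longleftrightarrow> hermitian_psd (B - A)"

text \<open>The Hermitian positive semidefinite square root; unspecified unless \<open>A\<close> is itself
  Hermitian positive semidefinite.\<close>

definition psd_sqrt :: "complex ^ 'n ^ 'n \<Rightarrow> complex ^ 'n ^ 'n" where
  "psd_sqrt A = (THE B. hermitian_psd B \<and> B ** B = A)"

definition torus_measure :: "(real ^ 'd) measure" where
  "torus_measure =
     scale_measure (ennreal (1 / (2 * pi) ^ CARD('d))) (lebesgue_on (cbox 0 (\<chi> k. 2 * pi)))"

definition freq_pairing :: "real ^ 'd \<Rightarrow> int ^ 'd \<Rightarrow> real" where
  "freq_pairing \<theta> t = (\<Sum>k\<in>UNIV. \<theta> $ k * real_of_int (t $ k))"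

text \<open>The density is the matrix function whose Fourier coefficients are the covariances; it is
  only determined almost everywhere.\<close>

definition spectral_density ::
    "(int ^ 'd \<Rightarrow> real ^ 'n) measure \<Rightarrow> (real ^ 'd \<Rightarrow> complex ^ 'n ^ 'n) \<Rightarrow> bool" where
  "spectral_density p \<Phi> \<longleftrightarrow>
     integrable torus_measure \<Phi> \<and>
     (AE \<theta> in torus_measure. hermitian_psd (\<Phi> \<theta>)) \<and>
     (\<forall>t i k. complex_of_real (covariance_field p t $ i $ k) =
                (\<integral>\<theta>. \<Phi> \<theta> $ i $ k * cis (freq_pairing \<theta> t) \<partial>torus_measure))"

definition bounded_coercive_densities :: "(real ^ 'd \<Rightarrow> complex ^ 'n ^ 'n) set" where
  "bounded_coercive_densities =
     {\<Phi>. (\<exists>p. zero_mean_stationary p \<and> spectral_density p \<Phi>) \<and>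
         (\<exists>c C. 0 < c \<and> c \<le> C \<and>
            (AE \<theta> in torus_measure.
               loewner_le (mat (complex_of_real c)) (\<Phi> \<theta>) \<and>
               loewner_le (\<Phi> \<theta>) (mat (complex_of_real C))))}"

definition x_part :: "real ^ ('m::finite + 'm) \<Rightarrow> real ^ 'm" where
  "x_part v = (\<chi> i. v $ Inl i)"

definition y_part :: "real ^ ('m::finite + 'm) \<Rightarrow> real ^ 'm" where
  "y_part v = (\<chi> i. v $ Inr i)"

definition gaussian_couplings ::
    "(int ^ 'd \<Rightarrow> real ^ 'm) measure \<Rightarrow> (int ^ 'd \<Rightarrow> real ^ 'm) measure \<Rightarrow>
     (int ^ 'd \<Rightarrow> real ^ ('m::finite + 'm)) measure set" where
  "gaussian_couplings px py =
     {q. zero_mean_gaussian_stationary q \<and>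
         distr q field_space (\<lambda>z t. x_part (z t)) = px \<and>
         distr q field_space (\<lambda>z t. y_part (z t)) = py}"

definition transport_cost ::
    "(int ^ 'd \<Rightarrow> real ^ ('m::finite + 'm)) measure \<Rightarrow> int ^ 'd \<Rightarrow> real" where
  "transport_cost q t = (\<integral>z. (norm (x_part (z t) - y_part (z t)))\<^sup>2 \<partial>q)"

text \<open>The site \<open>t\<close> at which the cost is evaluated is immaterial by stationarity.\<close>

definition transport_distance ::
    "int ^ 'd \<Rightarrow> (int ^ 'd \<Rightarrow> real ^ 'm) measure \<Rightarrow> (int ^ 'd \<Rightarrow> real ^ 'm) measure \<Rightarrow> real" where
  "transport_distance t px py = sqrt (INF q\<in>gaussian_couplings px py. transport_cost q t)"

definition hellinger_distance ::
    "(real ^ 'd \<Rightarrow> complex ^ 'm ^ 'm) \<Rightarrow> (real ^ 'd \<Rightarrow> complex ^ 'm ^ 'm) \<Rightarrow> real" where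
  "hellinger_distance \<Phi> \<Psi> =
     sqrt (Re (trace (\<integral>\<theta>. \<Phi> \<theta> + \<Psi> \<theta>
       - 2 *\<^sub>R psd_sqrt (psd_sqrt (\<Psi> \<theta>) ** \<Phi> \<theta> ** psd_sqrt (\<Psi> \<theta>)) \<partial>torus_measure)))"

end

theory Submission
  imports Defs
begin

text \<open>Write \<open>X\<close>, \<open>Y\<close> for the two densities, \<open>M = (Y\<^sup>1\<^sup>/\<^sup>2 X Y\<^sup>1\<^sup>/\<^sup>2)\<^sup>1\<^sup>/\<^sup>2\<close> and
  \<open>T = Y\<^sup>-\<^sup>1\<^sup>/\<^sup>2 M Y\<^sup>-\<^sup>1\<^sup>/\<^sup>2\<close>, so that \<open>T Y T = X\<close> and \<open>tr (T Y) = tr M\<close>. Filtering \<open>y\<close> with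
  the transfer function \<open>T\<close> gives a Gaussian field \<open>T y\<close> with density \<open>X\<close>; the pair \<open>(T y, y)\<close> is
  a coupling of cost \<open>tr \<integral> (X + Y - 2 M)\<close>. It is built inside \<open>p\<^sub>y\<close> as an almost sure limit of
  finite filters, so no extension theorem is needed.

  Conversely, put \<open>S = T\<^sup>1\<^sup>/\<^sup>2\<close>. In any coupling, stationarity gives
  \<open>E \<langle>x, y\<rangle> = E \<langle>S\<^sup>-\<^sup>1 x, S y\<rangle>\<close>, and this is at most
  \<open>(E \<parallel>S\<^sup>-\<^sup>1 x\<parallel>\<^sup>2 + E \<parallel>S y\<parallel>\<^sup>2) / 2 = tr \<integral> M\<close>. Only finite filters approximating \<open>S\<close> and
  \<open>S\<^sup>-\<^sup>1\<close> in mean square are used, hence no spectral density of the coupling is required.\<close>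

section \<open>Positive definite matrices\<close>

definition adj :: "complex ^ 'n ^ 'm \<Rightarrow> complex ^ 'm ^ 'n" where
  "adj A = (\<chi> i k. cnj (A $ k $ i))"

lemma adj_nth [simp]: "adj A $ i $ k = cnj (A $ k $ i)"
  by (simp add: adj_def)

lemma adj_mult: "adj (A ** B) = adj B ** adj A"
  by (simp add: vec_eq_iff matrix_matrix_mult_def mult.commute)

lemma adj_add [simp]: "adj (A + B) = adj A + adj B"
  and adj_diff [simp]: "adj (A - B) = adj A - adj B"
  and adj_scaleR [simp]: "adj (r *\<^sub>R A) = r *\<^sub>R adj A"
  by (simp_all add: vec_eq_iff)

lemma adj_mat_of_real [simp]: "adj (mat (complex_of_real c)) = mat (complex_of_real c)"
  by (auto simp: vec_eq_iff mat_def)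

lemma adj_mat_1 [simp]: "adj (mat 1) = mat 1"
  using adj_mat_of_real[of 1] by simp

lemma norm_adj: "norm (adj A) = norm A"
proof -
  have "adj A \<bullet> adj A = A \<bullet> A"
    unfolding inner_vec_def by (subst sum.swap) (simp add: inner_complex_def)
  then show ?thesis by (simp add: norm_eq_sqrt_inner)
qed

lemma inner_adj: "v \<bullet> (A *v w) = (adj A *v v) \<bullet> w"
proof -
  have "v \<bullet> (A *v w) = (\<Sum>i\<in>UNIV. \<Sum>k\<in>UNIV. v $ i \<bullet> (A $ i $ k * w $ k))"
    by (simp add: inner_vec_def matrix_vector_mult_def inner_sum_right)
  also have "\<dots> = (\<Sum>k\<in>UNIV. \<Sum>i\<in>UNIV. (cnj (A $ i $ k) * v $ i) \<bullet> w $ k)"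
    by (subst sum.swap, intro sum.cong refl) (simp add: inner_complex_def algebra_simps)
  also have "\<dots> = (adj A *v v) \<bullet> w"
    by (simp add: inner_vec_def matrix_vector_mult_def inner_sum_left)
  finally show ?thesis .
qed

lemma matrix_vector_scaleR_right:
  fixes A :: "complex ^ 'n ^ 'm"
  shows "A *v (r *\<^sub>R v) = r *\<^sub>R (A *v v)"
  by (simp add: vec_eq_iff matrix_vector_mult_def scaleR_right.sum)

lemma matrix_vector_scaleR_left:
  fixes A :: "complex ^ 'n ^ 'm"
  shows "(r *\<^sub>R A) *v v = r *\<^sub>R (A *v v)"
  by (simp add: vec_eq_iff matrix_vector_mult_def scaleR_right.sum)

lemma matrix_mult_scaleR_left:
  fixes A :: "complex ^ 'n ^ 'm"
  shows "(r *\<^sub>R A) ** B = r *\<^sub>R (A ** B)"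
  by (simp add: vec_eq_iff matrix_matrix_mult_def scaleR_right.sum)

lemma matrix_mult_scaleR_right:
  fixes A :: "complex ^ 'n ^ 'm"
  shows "A ** (r *\<^sub>R B) = r *\<^sub>R (A ** B)"
  by (simp add: vec_eq_iff matrix_matrix_mult_def scaleR_right.sum)

lemma matrix_diff_ldistrib: "A ** (B - C) = A ** B - A ** (C :: complex ^ 'n ^ 'm)"
  and matrix_diff_rdistrib: "(B' - C') ** A' = B' ** A' - C' ** (A' :: complex ^ 'n ^ 'm)"
  by (simp_all add: vec_eq_iff matrix_matrix_mult_def algebra_simps sum_subtractf)

lemma mat_of_real_mult_vec: "mat (complex_of_real c) *v v = c *\<^sub>R v"
proof -
  have "mat (complex_of_real c) = c *\<^sub>R (mat 1 :: complex ^ 'a ^ 'a)"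
    by (auto simp: vec_eq_iff mat_def of_real_def)
  then show ?thesis by (simp add: matrix_vector_scaleR_left)
qed

lemma hermitian_psd_iff: "hermitian_psd A \<longleftrightarrow> adj A = A \<and> (\<forall>v. 0 \<le> v \<bullet> (A *v v))"
  unfolding hermitian_psd_def by (metis (no_types, lifting) adj_nth vec_eq_iff)

definition pd_between :: "real \<Rightarrow> real \<Rightarrow> complex ^ 'n ^ 'n \<Rightarrow> bool" where
  "pd_between c C A \<longleftrightarrow>
     loewner_le (mat (complex_of_real c)) A \<and> loewner_le A (mat (complex_of_real C))"

lemma pd_between_iff:
  "pd_between c C A \<longleftrightarrow>
     adj A = A \<and> (\<forall>v. c * (norm v)\<^sup>2 \<le> v \<bullet> (A *v v) \<and> v \<bullet> (A *v v) \<le> C * (norm v)\<^sup>2)"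
proof -
  have "loewner_le (mat (complex_of_real c)) A \<longleftrightarrow> adj A = A \<and> (\<forall>v. c * (norm v)\<^sup>2 \<le> v \<bullet> (A *v v))"
    by (simp add: loewner_le_def hermitian_psd_iff matrix_vector_mult_diff_rdistrib
        mat_of_real_mult_vec inner_diff_right power2_norm_eq_inner)
  moreover have "loewner_le A (mat (complex_of_real C)) \<longleftrightarrow>
      adj A = A \<and> (\<forall>v. v \<bullet> (A *v v) \<le> C * (norm v)\<^sup>2)"
    by (simp add: loewner_le_def hermitian_psd_iff matrix_vector_mult_diff_rdistrib
        mat_of_real_mult_vec inner_diff_right power2_norm_eq_inner)
  ultimately show ?thesis unfolding pd_between_def by auto
qed

lemma pd_between_adj: "pd_between c C A \<Longrightarrow> adj A = A"
  and pd_between_lower: "pd_between c C A \<Longrightarrow> c * (norm v)\<^sup>2 \<le> v \<bullet> (A *v v)"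
  and pd_between_upper: "pd_between c C A \<Longrightarrow> v \<bullet> (A *v v) \<le> C * (norm v)\<^sup>2"
  by (simp_all add: pd_between_iff)

lemma pd_between_mono: "pd_between c C A \<Longrightarrow> c' \<le> c \<Longrightarrow> C \<le> C' \<Longrightarrow> pd_between c' C' A"
  unfolding pd_between_iff
  by (auto intro: order_trans[OF mult_right_mono] order_trans[OF _ mult_right_mono])

lemma pd_between_imp_psd: "pd_between c C A \<Longrightarrow> 0 \<le> c \<Longrightarrow> hermitian_psd A"
  unfolding pd_between_iff hermitian_psd_iff
  by (auto intro: order_trans[rotated])

lemma pd_between_le:
  fixes A :: "complex ^ 'n ^ 'n"
  assumes "pd_between c C A" shows "c \<le> C"
proof -
  have "norm (axis undefined 1 :: complex ^ 'n) = 1" by simp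
  then show ?thesis
    using order_trans[OF pd_between_lower[OF assms] pd_between_upper[OF assms]]
    by (metis mult.right_neutral one_power2)
qed

definition op_bound :: "real \<Rightarrow> complex ^ 'n ^ 'm \<Rightarrow> bool" where
  "op_bound r A \<longleftrightarrow> (\<forall>v :: complex ^ 'n. norm (A *v v) \<le> r * norm v)"

lemma op_boundD: "op_bound r A \<Longrightarrow> norm (A *v v) \<le> r * norm v"
  by (simp add: op_bound_def)

lemma matrix_vector_axis: "((A :: complex ^ 'n ^ 'm) *v axis k 1) $ i = A $ i $ k"
  by (simp add: matrix_vector_mult_def axis_def if_distrib cong: if_cong)

lemma norm_matrix_columns:
  fixes A :: "complex ^ 'n ^ 'm"
  shows "(norm A)\<^sup>2 = (\<Sum>k\<in>UNIV. (norm (A *v axis k 1))\<^sup>2)"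
  unfolding power2_norm_eq_inner inner_vec_def matrix_vector_axis
  by (subst sum.swap) (rule refl)

lemma op_bound_norm_mult:
  assumes "op_bound r A" "0 \<le> r" shows "norm (A ** B) \<le> r * norm B"
proof -
  have "(norm (A ** B))\<^sup>2 \<le> (\<Sum>k\<in>UNIV. (r * norm (B *v axis k 1))\<^sup>2)"
    unfolding norm_matrix_columns[of "A ** B"] matrix_vector_mul_assoc[symmetric]
    by (intro sum_mono power_mono op_boundD[OF assms(1)]) auto
  also have "\<dots> = (r * norm B)\<^sup>2"
    by (simp add: power_mult_distrib norm_matrix_columns[of B] sum_distrib_left)
  finally show ?thesis by (rule power2_le_imp_le) (use assms(2) in simp)
qed

lemma op_bound_norm_mult_right:
  assumes "op_bound r A" "0 \<le> r" "adj A = A" shows "norm (B ** A) \<le> r * norm B"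
  using op_bound_norm_mult[OF assms(1,2), of "adj B"] assms(3)
  by (metis adj_mult norm_adj)

lemma op_bound_mult:
  assumes "op_bound r A" "op_bound s B" "0 \<le> r" shows "op_bound (r * s) (A ** B)"
  unfolding op_bound_def
proof
  fix v
  have "norm (A *v (B *v v)) \<le> r * norm (B *v v)" using assms(1) by (rule op_boundD)
  also have "\<dots> \<le> r * (s * norm v)" by (intro mult_left_mono op_boundD assms)
  finally show "norm ((A ** B) *v v) \<le> r * s * norm v" by (simp add: matrix_vector_mul_assoc)
qed

lemma op_bound_norm: "op_bound (norm A) A"
  unfolding op_bound_def
proof
  fix v
  have "norm ((A *v v) $ i) \<le> norm (A $ i) * norm v" for i
  proof -
    have "norm ((A *v v) $ i) \<le> (\<Sum>k\<in>UNIV. norm (A $ i $ k) * norm (v $ k))"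
      unfolding matrix_vector_mult_def by (simp add: order_trans[OF norm_sum] norm_mult sum_mono)
    also have "\<dots> \<le> norm (A $ i) * norm v"
      unfolding norm_vec_def using L2_set_mult_ineq[of "\<lambda>k. norm (A $ i $ k)" "\<lambda>k. norm (v $ k)"] by simp
    finally show ?thesis .
  qed
  then have "norm (A *v v) \<le> L2_set (\<lambda>i. norm (A $ i) * norm v) UNIV"
    unfolding norm_vec_def[of "A *v v"] by (intro L2_set_mono) auto
  also have "\<dots> = norm A * norm v"
    by (simp add: norm_vec_def[of A] L2_set_left_distrib)
  finally show "norm (A *v v) \<le> norm A * norm v" .
qed

lemma hermitian_op_bound:
  fixes A :: "complex ^ 'n ^ 'n"
  assumes "adj A = A" and q: "\<And>v :: complex ^ 'n. \<bar>v \<bullet> (A *v v)\<bar> \<le> r * (norm v)\<^sup>2"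
  shows "op_bound r A"
  unfolding op_bound_def
proof
  fix v
  have polar: "2 * (u \<bullet> (A *v v)) \<le> r * ((norm u)\<^sup>2 + (norm v)\<^sup>2)" for u
  proof -
    have "u \<bullet> (A *v v) = v \<bullet> (A *v u)" using inner_adj[of u A v] assms(1) by (simp add: inner_commute)
    then have "4 * (u \<bullet> (A *v v)) = (u + v) \<bullet> (A *v (u + v)) - (u - v) \<bullet> (A *v (u - v))"
      by (simp add: matrix_vector_right_distrib matrix_vector_mult_diff_distrib inner_add_left
          inner_add_right inner_diff_left inner_diff_right)
    also have "\<dots> \<le> r * (norm (u + v))\<^sup>2 + r * (norm (u - v))\<^sup>2"
      using q[of "u + v"] q[of "u - v"] by linarith
    also have "\<dots> = 2 * (r * ((norm u)\<^sup>2 + (norm v)\<^sup>2))"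
      by (simp add: power2_norm_eq_inner inner_add_left inner_add_right inner_diff_left
          inner_diff_right algebra_simps)
    finally show ?thesis by linarith
  qed
  show "norm (A *v v) \<le> r * norm v"
  proof (cases "A *v v = 0 \<or> v = 0")
    case True
    then show ?thesis
    proof
      assume 0: "A *v v = 0"
      have "0 \<le> r * (norm v)\<^sup>2" using q[of v] by linarith
      then show ?thesis using 0 by (cases "v = 0") (auto simp: zero_le_mult_iff)
    qed auto
  next
    case False
    define k where "k = norm v / norm (A *v v)"
    have k: "0 \<le> k" by (simp add: k_def)
    have "2 * (k * (norm (A *v v))\<^sup>2) \<le> r * ((k * norm (A *v v))\<^sup>2 + (norm v)\<^sup>2)"
      using polar[of "k *\<^sub>R (A *v v)"] k by (simp add: power2_norm_eq_inner power_mult_distrib)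
    then have "2 * (k * norm (A *v v) * norm (A *v v)) \<le> r * ((k * norm (A *v v))\<^sup>2 + (norm v)\<^sup>2)"
      by (simp add: power2_eq_square mult.assoc)
    moreover have "k * norm (A *v v) = norm v" using False by (simp add: k_def)
    ultimately have "norm v * norm (A *v v) \<le> norm v * (r * norm v)"
      by (simp add: power2_eq_square algebra_simps)
    then show ?thesis using False by simp
  qed
qed

lemma pd_between_op_bound:
  fixes A :: "complex ^ 'n ^ 'n"
  assumes "pd_between c C A" "0 \<le> c" shows "op_bound C A"
proof (rule hermitian_op_bound)
  show "adj A = A" using assms by (simp add: pd_between_iff)
  fix v :: "complex ^ 'n"
  have "0 \<le> c * (norm v)\<^sup>2" using assms by simp
  then show "\<bar>v \<bullet> (A *v v)\<bar> \<le> C * (norm v)\<^sup>2"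
    using pd_between_lower[OF assms(1), of v] pd_between_upper[OF assms(1), of v] by linarith
qed

lemma Re_trace_adj_mult: "Re (trace (adj A ** B)) = A \<bullet> B"
  unfolding trace_def matrix_matrix_mult_def inner_vec_def
  by (simp add: Re_sum inner_complex_def) (rule sum.swap)

lemma Re_trace_congruence:
  "Re (trace (adj D ** A ** D)) = (\<Sum>k\<in>UNIV. (D *v axis k 1) \<bullet> (A *v (D *v axis k 1)))"
proof -
  have "Re (trace (adj D ** A ** D)) = D \<bullet> (A ** D)"
    by (simp add: Re_trace_adj_mult flip: matrix_mul_assoc)
  also have "\<dots> = (\<Sum>k\<in>UNIV. (D *v axis k 1) \<bullet> ((A ** D) *v axis k 1))"
    unfolding inner_vec_def matrix_vector_axis by (subst sum.swap) (rule refl)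
  finally show ?thesis by (simp add: matrix_vector_mul_assoc)
qed

lemma Re_trace_congruence_ge:
  assumes "\<And>v. c * (norm v)\<^sup>2 \<le> v \<bullet> (A *v v)"
  shows "c * (norm D)\<^sup>2 \<le> Re (trace (adj D ** A ** D))"
  unfolding Re_trace_congruence norm_matrix_columns sum_distrib_left by (intro sum_mono assms)

text \<open>With \<open>D = S - S'\<close>, the identity \<open>S D + D S' = S\<^sup>2 - S'\<^sup>2\<close> is paired with \<open>D\<close>.\<close>

lemma square_diff_ge:
  assumes S: "adj S = S" "\<And>v. c * (norm v)\<^sup>2 \<le> v \<bullet> (S *v v)"
    and S': "adj S' = S'" "\<And>v. c' * (norm v)\<^sup>2 \<le> v \<bullet> (S' *v v)"
  shows "(c + c') * norm (S - S') \<le> norm (S ** S - S' ** S')"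
proof -
  define D where "D = S - S'"
  have D: "adj D = D" using S S' by (simp add: D_def)
  have "(c + c') * (norm D)\<^sup>2 \<le> Re (trace (adj D ** S ** D)) + Re (trace (adj D ** S' ** D))"
    using Re_trace_congruence_ge[OF S(2), of D] Re_trace_congruence_ge[OF S'(2), of D]
    by (simp add: algebra_simps)
  also have "Re (trace (adj D ** S' ** D)) = Re (trace (adj D ** (D ** S')))"
    unfolding D using trace_mul_sym[of "D ** S'" D] by (simp add: matrix_mul_assoc)
  also have "Re (trace (adj D ** S ** D)) + \<dots> = Re (trace (adj D ** (S ** D + D ** S')))"
    by (simp add: matrix_add_ldistrib trace_add matrix_mul_assoc)
  also have "S ** D + D ** S' = S ** S - S' ** S'"
    by (simp add: D_def matrix_diff_ldistrib matrix_diff_rdistrib)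
  also have "Re (trace (adj D ** (S ** S - S' ** S'))) \<le> norm D * norm (S ** S - S' ** S')"
    unfolding Re_trace_adj_mult by (rule norm_cauchy_schwarz)
  finally have "norm D * ((c + c') * norm D) \<le> norm D * norm (S ** S - S' ** S')"
    by (simp add: power2_eq_square algebra_simps)
  then show ?thesis
    by (cases "D = 0") (auto simp flip: D_def)
qed

lemma psd_sqrt_eqI:
  assumes "pd_between c C S" "0 < c" and sq: "S ** S = A"
  shows "psd_sqrt A = S"
  unfolding psd_sqrt_def
proof (rule the_equality)
  show "hermitian_psd S \<and> S ** S = A"
    using assms pd_between_imp_psd[OF assms(1)] by simp
  fix B assume B: "hermitian_psd B \<and> B ** B = A"
  have "(c + 0) * norm (S - B) \<le> norm (S ** S - B ** B)"
    by (rule square_diff_ge) (use assms B in \<open>auto simp: pd_between_iff hermitian_psd_iff\<close>)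
  then show "B = S" using B sq \<open>0 < c\<close> by (simp add: mult_le_0_iff)
qed

text \<open>For \<open>A = C (I - B)\<close> the root is \<open>\<surd>C (I - X)\<close> where \<open>X\<close> is the fixed point of
  \<open>X \<mapsto> (B + X\<^sup>2) / 2\<close>, a contraction on the Hermitian matrices of norm at most
  \<open>1 - \<surd>(c / C)\<close>.\<close>

lemma pd_square_root_exists:
  fixes A :: "complex ^ 'n ^ 'n"
  assumes A: "pd_between c C A" and c: "0 < c"
  obtains S where "pd_between (sqrt c) (2 * sqrt C) S" "S ** S = A"
proof -
  have cC: "c \<le> C" using A by (rule pd_between_le)
  then have C: "0 < C" using c by linarith
  define B where "B = mat 1 - (1 / C) *\<^sub>R A"
  define r where "r = 1 - sqrt (c / C)"
  have r: "0 \<le> r" "r < 1" using cC c C by (auto simp: r_def)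
  have "(sqrt (c / C))\<^sup>2 = c / C" using c C by simp
  then have rr: "(1 - c / C + r * r) / 2 = r"
    by (simp add: r_def power2_eq_square field_simps)
  have B: "adj B = B" using A by (simp add: B_def pd_between_iff)
  have Bb: "op_bound (1 - c / C) B"
  proof (rule hermitian_op_bound[OF B])
    fix v
    have "v \<bullet> (B *v v) = (norm v)\<^sup>2 - (v \<bullet> (A *v v)) / C"
      by (simp add: B_def matrix_vector_mult_diff_rdistrib matrix_vector_scaleR_left
          inner_diff_right power2_norm_eq_inner)
    moreover have "c / C * (norm v)\<^sup>2 \<le> (v \<bullet> (A *v v)) / C" "(v \<bullet> (A *v v)) / C \<le> (norm v)\<^sup>2"
      using pd_between_lower[OF A, of v] pd_between_upper[OF A, of v] C
      by (auto simp: field_simps)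
    ultimately show "\<bar>v \<bullet> (B *v v)\<bar> \<le> (1 - c / C) * (norm v)\<^sup>2"
      by (simp add: algebra_simps)
  qed
  define K :: "(complex ^ 'n ^ 'n) set" where "K = {X. adj X = X \<and> op_bound r X}"
  define f where "f X = (1 / 2) *\<^sub>R (B + X ** X)" for X
  have "\<exists>!X. X \<in> K \<and> f X = X"
  proof (rule Banach_fix)
    have adj_cont: "continuous_on UNIV (adj :: complex ^ 'n ^ 'n \<Rightarrow> _)"
      unfolding adj_def by (intro continuous_intros)
    have "closed {X. adj X = (X :: complex ^ 'n ^ 'n)}"
      by (intro closed_Collect_eq adj_cont continuous_intros)
    moreover have "closed {X. norm (X *v v) \<le> r * norm v}" for v :: "complex ^ 'n"
      unfolding matrix_vector_mult_def by (intro closed_Collect_le continuous_intros)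
    moreover have "K = {X. adj X = X} \<inter> (\<Inter>v. {X. norm (X *v v) \<le> r * norm v})"
      by (auto simp: K_def op_bound_def)
    ultimately show "Topological_Spaces.complete K"
      by (simp only: complete_eq_closed) (intro closed_Int closed_INT ballI, auto)
    show "K \<noteq> {}" using r by (auto simp: K_def op_bound_def vec_eq_iff intro!: exI[of _ 0])
    show "0 \<le> r" "r < 1" by fact+
    show "f ` K \<subseteq> K"
    proof safe
      fix X assume X: "X \<in> K"
      then have "op_bound (r * r) (X ** X)" using r by (auto simp: K_def intro: op_bound_mult)
      then have "norm (f X *v v) \<le> ((1 - c / C) * norm v + r * r * norm v) / 2" for v
        using op_boundD[OF Bb, of v] op_boundD[of "r * r" "X ** X" v] norm_triangle_ineq[of "B *v v" "(X ** X) *v v"]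
        by (simp add: f_def matrix_vector_scaleR_left matrix_vector_mult_add_rdistrib)
      also have "((1 - c / C) * norm v + r * r * norm v) / 2 = (1 - c / C + r * r) / 2 * norm v" for v :: "complex ^ 'n"
        by (simp add: algebra_simps)
      finally have "op_bound r (f X)" unfolding rr by (simp add: op_bound_def)
      moreover have "adj (f X) = f X" using X B by (simp add: f_def K_def adj_mult)
      ultimately show "f X \<in> K" by (simp add: K_def)
    qed
    fix X Y assume X: "X \<in> K" and Y: "Y \<in> K"
    have "f X - f Y = (1 / 2) *\<^sub>R (X ** (X - Y) + (X - Y) ** Y)"
      by (simp add: f_def matrix_diff_ldistrib matrix_diff_rdistrib flip: scaleR_diff_right)
    then have "norm (f X - f Y) \<le> (norm (X ** (X - Y)) + norm ((X - Y) ** Y)) / 2"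
      using norm_triangle_ineq[of "X ** (X - Y)" "(X - Y) ** Y"] by simp
    also have "\<dots> \<le> (r * norm (X - Y) + r * norm (X - Y)) / 2"
      using X Y r by (intro divide_right_mono add_mono op_bound_norm_mult op_bound_norm_mult_right)
        (auto simp: K_def)
    finally show "dist (f X) (f Y) \<le> r * dist X Y" by (simp add: dist_norm)
  qed
  then obtain X where X: "adj X = X" "op_bound r X" and fX: "f X = X" unfolding K_def by auto
  define S where "S = sqrt C *\<^sub>R (mat 1 - X)"
  have "2 *\<^sub>R X = 2 *\<^sub>R f X" by (simp only: fX)
  also have "\<dots> = B + X ** X" by (simp add: f_def)
  finally have "2 *\<^sub>R X = B + X ** X" .
  then have XX: "X ** X - 2 *\<^sub>R X = - B" by simp
  have "S ** S = C *\<^sub>R ((mat 1 - X) ** (mat 1 - X))"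
    using C by (simp add: S_def matrix_mult_scaleR_left matrix_mult_scaleR_right)
  also have "(mat 1 - X) ** (mat 1 - X) = mat 1 + (X ** X - 2 *\<^sub>R X)"
    by (simp add: matrix_diff_ldistrib matrix_diff_rdistrib scaleR_2)
  also have "C *\<^sub>R \<dots> = A" unfolding XX B_def using C by simp
  finally have SS: "S ** S = A" .
  have "pd_between (sqrt c) (2 * sqrt C) S"
    unfolding pd_between_iff
  proof (intro conjI allI)
    show "adj S = S" using X by (simp add: S_def)
    fix v
    have "\<bar>v \<bullet> (X *v v)\<bar> \<le> norm v * (r * norm v)"
      by (rule order_trans[OF Cauchy_Schwarz_ineq2 mult_left_mono[OF op_boundD[OF X(2)]]]) simp
    then have b: "\<bar>v \<bullet> (X *v v)\<bar> \<le> r * (norm v)\<^sup>2"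
      by (simp add: power2_eq_square mult.left_commute)
    have e: "v \<bullet> (S *v v) = sqrt C * ((norm v)\<^sup>2 - v \<bullet> (X *v v))"
      by (simp add: S_def matrix_vector_mult_diff_rdistrib matrix_vector_scaleR_left
          inner_diff_right power2_norm_eq_inner)
    have "sqrt c = sqrt C * (1 - r)" using C by (simp add: r_def real_sqrt_divide)
    then have "sqrt c * (norm v)\<^sup>2 = sqrt C * ((norm v)\<^sup>2 - r * (norm v)\<^sup>2)"
      by (simp only: mult.assoc left_diff_distrib mult_1_left)
    also have "\<dots> \<le> sqrt C * ((norm v)\<^sup>2 - v \<bullet> (X *v v))"
      using b C by (intro mult_left_mono) auto
    finally show "sqrt c * (norm v)\<^sup>2 \<le> v \<bullet> (S *v v)" using e by simp
    have "r * (norm v)\<^sup>2 \<le> 1 * (norm v)\<^sup>2" using r by (intro mult_right_mono) auto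
    then have "sqrt C * ((norm v)\<^sup>2 - v \<bullet> (X *v v)) \<le> sqrt C * (2 * (norm v)\<^sup>2)"
      using b C by (intro mult_left_mono) auto
    then show "v \<bullet> (S *v v) \<le> 2 * sqrt C * (norm v)\<^sup>2" using e by simp
  qed
  with SS show ?thesis using that by blast
qed

lemma psd_sqrt_pd:
  assumes A: "pd_between c C A" and c: "0 < c"
  shows "pd_between (sqrt c) (2 * sqrt C) (psd_sqrt A)" "psd_sqrt A ** psd_sqrt A = A"
proof -
  obtain S where S: "pd_between (sqrt c) (2 * sqrt C) S" "S ** S = A"
    using pd_square_root_exists[OF assms] .
  have "psd_sqrt A = S" by (rule psd_sqrt_eqI[OF S(1) _ S(2)]) (use c in simp)
  then show "pd_between (sqrt c) (2 * sqrt C) (psd_sqrt A)" "psd_sqrt A ** psd_sqrt A = A"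
    using S by simp_all
qed

lemma continuous_on_psd_sqrt:
  assumes c: "0 < c" shows "continuous_on {A :: complex ^ 'n ^ 'n. pd_between c C A} psd_sqrt"
proof (rule lipschitz_on_continuous_on[where L = "1 / (2 * sqrt c)"], rule lipschitz_onI)
  fix A B :: "complex ^ 'n ^ 'n" assume "A \<in> {A. pd_between c C A}" "B \<in> {A. pd_between c C A}"
  then have AB: "pd_between c C A" "pd_between c C B" by auto
  note SA = psd_sqrt_pd[OF AB(1) c] and SB = psd_sqrt_pd[OF AB(2) c]
  have "(sqrt c + sqrt c) * norm (psd_sqrt A - psd_sqrt B)
      \<le> norm (psd_sqrt A ** psd_sqrt A - psd_sqrt B ** psd_sqrt B)"
    by (rule square_diff_ge) (use SA(1) SB(1) in \<open>auto simp: pd_between_iff\<close>)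
  then show "dist (psd_sqrt A) (psd_sqrt B) \<le> 1 / (2 * sqrt c) * dist A B"
    using c SA(2) SB(2) by (simp add: dist_norm field_simps)
qed (use c in simp)

lemma pd_between_inv:
  assumes A: "pd_between c C A" and c: "0 < c"
  shows "A ** matrix_inv A = mat 1" "matrix_inv A ** A = mat 1"
    "pd_between (c / C\<^sup>2) (1 / c) (matrix_inv A)"
    "op_bound (1 / c) (matrix_inv A)"
proof -
  have C: "0 < C" using c pd_between_le[OF A] by linarith
  have "v = 0" if "A *v v = 0" for v
    using pd_between_lower[OF A, of v] that c by (simp add: mult_le_0_iff)
  then have "\<exists>B. B ** A = mat 1" by (simp add: matrix_left_invertible_ker)
  then have "\<exists>B. A ** B = mat 1 \<and> B ** A = mat 1" by (auto simp: matrix_left_right_inverse)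
  then have "A ** matrix_inv A = mat 1 \<and> matrix_inv A ** A = mat 1"
    unfolding matrix_inv_def by (rule someI_ex)
  then show 1: "A ** matrix_inv A = mat 1" and 2: "matrix_inv A ** A = mat 1" by auto
  have "adj (matrix_inv A) ** A = mat 1"
    using arg_cong[OF 1, of adj] pd_between_adj[OF A] by (simp add: adj_mult)
  then have h: "adj (matrix_inv A) = matrix_inv A"
    by (metis 1 matrix_mul_assoc matrix_mul_lid matrix_mul_rid)
  have *: "A *v (matrix_inv A *v v) = v" for v by (simp add: matrix_vector_mul_assoc 1)
  show ob: "op_bound (1 / c) (matrix_inv A)"
    unfolding op_bound_def
  proof
    fix v
    let ?w = "matrix_inv A *v v"
    have "c * (norm ?w)\<^sup>2 \<le> ?w \<bullet> v" using pd_between_lower[OF A, of ?w] * by simp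
    also have "\<dots> \<le> norm ?w * norm v" by (rule norm_cauchy_schwarz)
    finally have "norm ?w * (c * norm ?w) \<le> norm ?w * norm v"
      by (simp add: power2_eq_square algebra_simps)
    then have "c * norm ?w \<le> norm v" by (cases "?w = 0") auto
    then show "norm ?w \<le> 1 / c * norm v" using c by (simp add: field_simps)
  qed
  show "pd_between (c / C\<^sup>2) (1 / c) (matrix_inv A)"
    unfolding pd_between_iff
  proof (intro conjI allI)
    show "adj (matrix_inv A) = matrix_inv A" by (rule h)
    fix v
    let ?w = "matrix_inv A *v v"
    have vw: "v \<bullet> ?w = ?w \<bullet> (A *v ?w)" by (simp add: * inner_commute)
    have "norm v \<le> C * norm ?w"
      using op_boundD[OF pd_between_op_bound[OF A], of ?w] c * by simp
    then have "(norm v)\<^sup>2 \<le> C\<^sup>2 * (norm ?w)\<^sup>2"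
      by (metis norm_ge_zero power_mono power_mult_distrib)
    then have "c / C\<^sup>2 * (norm v)\<^sup>2 \<le> c * (norm ?w)\<^sup>2" using c C by (simp add: field_simps)
    also have "\<dots> \<le> v \<bullet> ?w" unfolding vw by (rule pd_between_lower[OF A])
    finally show "c / C\<^sup>2 * (norm v)\<^sup>2 \<le> v \<bullet> ?w" .
    have "v \<bullet> ?w \<le> norm v * norm ?w" by (rule norm_cauchy_schwarz)
    also have "\<dots> \<le> norm v * (1 / c * norm v)" by (intro mult_left_mono op_boundD[OF ob]) simp
    finally show "v \<bullet> ?w \<le> 1 / c * (norm v)\<^sup>2" by (simp add: power2_eq_square)
  qed
qed

lemma continuous_on_matrix_inv:
  assumes c: "0 < c" shows "continuous_on {A :: complex ^ 'n ^ 'n. pd_between c C A} matrix_inv"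
proof (rule lipschitz_on_continuous_on[where L = "1 / c * (1 / c)"], rule lipschitz_onI)
  fix A B :: "complex ^ 'n ^ 'n" assume "A \<in> {A. pd_between c C A}" "B \<in> {A. pd_between c C A}"
  then have AB: "pd_between c C A" "pd_between c C B" by auto
  note IA = pd_between_inv[OF AB(1) c] and IB = pd_between_inv[OF AB(2) c]
  have "matrix_inv A - matrix_inv B = matrix_inv A ** ((B - A) ** matrix_inv B)"
    by (simp add: matrix_diff_rdistrib matrix_diff_ldistrib IA IB) (simp add: matrix_mul_assoc IA)
  then have "norm (matrix_inv A - matrix_inv B) \<le> 1 / c * norm ((B - A) ** matrix_inv B)"
    using op_bound_norm_mult[OF IA(4)] c by simp
  also have "\<dots> \<le> 1 / c * (1 / c * norm (B - A))"
    using op_bound_norm_mult_right[OF IB(4)] pd_between_adj[OF IB(3)] c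
    by (intro mult_left_mono) auto
  finally show "dist (matrix_inv A) (matrix_inv B) \<le> 1 / c * (1 / c) * dist A B"
    by (simp add: dist_norm norm_minus_commute)
qed (use c in simp)

lemma pd_between_congruence:
  assumes A: "pd_between a A' P" "0 \<le> a" and B: "pd_between b B' Q" "0 < b"
  shows "pd_between (a * b\<^sup>2) (A' * B'\<^sup>2) (Q ** P ** Q)"
  unfolding pd_between_iff
proof (intro conjI allI)
  show "adj (Q ** P ** Q) = Q ** P ** Q"
    using pd_between_adj[OF A(1)] pd_between_adj[OF B(1)] by (simp add: adj_mult matrix_mul_assoc)
  fix v
  have e: "v \<bullet> ((Q ** P ** Q) *v v) = (Q *v v) \<bullet> (P *v (Q *v v))"
    using inner_adj[of v Q "P *v (Q *v v)"] pd_between_adj[OF B(1)]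
    by (simp add: matrix_vector_mul_assoc matrix_mul_assoc)
  have "b * (norm v)\<^sup>2 \<le> norm v * norm (Q *v v)"
    by (rule order_trans[OF pd_between_lower[OF B(1)] norm_cauchy_schwarz])
  then have "norm v * (b * norm v) \<le> norm v * norm (Q *v v)"
    by (simp add: power2_eq_square algebra_simps)
  then have "b * norm v \<le> norm (Q *v v)" by (cases "v = 0") auto
  then have "b\<^sup>2 * (norm v)\<^sup>2 \<le> (norm (Q *v v))\<^sup>2"
    using B(2) by (metis less_eq_real_def mult_nonneg_nonneg norm_ge_zero power_mono power_mult_distrib)
  then have "a * (b\<^sup>2 * (norm v)\<^sup>2) \<le> a * (norm (Q *v v))\<^sup>2" by (intro mult_left_mono A)
  also have "\<dots> \<le> v \<bullet> ((Q ** P ** Q) *v v)" unfolding e by (rule pd_between_lower[OF A(1)])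
  finally show "(a * b\<^sup>2) * (norm v)\<^sup>2 \<le> v \<bullet> ((Q ** P ** Q) *v v)" by simp
  have "norm (Q *v v) \<le> B' * norm v"
    by (rule op_boundD[OF pd_between_op_bound[OF B(1)]]) (use B(2) in simp)
  then have "(norm (Q *v v))\<^sup>2 \<le> B'\<^sup>2 * (norm v)\<^sup>2"
    by (metis norm_ge_zero power_mono power_mult_distrib)
  then have "A' * (norm (Q *v v))\<^sup>2 \<le> A' * (B'\<^sup>2 * (norm v)\<^sup>2)"
    using A pd_between_le[OF A(1)] by (intro mult_left_mono) auto
  then show "v \<bullet> ((Q ** P ** Q) *v v) \<le> A' * B'\<^sup>2 * (norm v)\<^sup>2"
    unfolding e using pd_between_upper[OF A(1), of "Q *v v"] by simp
qed

definition cconj :: "complex ^ 'n ^ 'm \<Rightarrow> complex ^ 'n ^ 'm" where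
  "cconj A = (\<chi> i k. cnj (A $ i $ k))"

lemma cconj_nth [simp]: "cconj A $ i $ k = cnj (A $ i $ k)"
  by (simp add: cconj_def)

lemma cconj_cconj [simp]: "cconj (cconj A) = A"
  by (simp add: vec_eq_iff)

lemma cconj_mult: "cconj (A ** B) = cconj A ** cconj B"
  by (simp add: vec_eq_iff matrix_matrix_mult_def)

lemma pd_between_cconj: "pd_between c C A \<Longrightarrow> pd_between c C (cconj A)"
proof -
  assume A: "pd_between c C A"
  have "v \<bullet> (cconj A *v v) = (\<chi> i. cnj (v $ i)) \<bullet> (A *v (\<chi> i. cnj (v $ i)))" for v
  proof -
    have "x \<bullet> y = cnj x \<bullet> cnj y" for x y by (simp add: inner_complex_def)
    from this[of "v $ i" "(cconj A *v v) $ i" for i] show ?thesis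
      by (simp add: inner_vec_def matrix_vector_mult_def)
  qed
  moreover have "norm (\<chi> i. cnj (v $ i)) = norm v" for v :: "complex ^ 'a"
    by (simp add: norm_vec_def)
  moreover have "adj (cconj A) = cconj A"
    using pd_between_adj[OF A] by (simp add: vec_eq_iff)
  ultimately show ?thesis using A unfolding pd_between_iff by metis
qed

lemma psd_sqrt_cconj:
  assumes A: "pd_between c C A" and c: "0 < c"
  shows "psd_sqrt (cconj A) = cconj (psd_sqrt A)"
proof (rule psd_sqrt_eqI)
  show "pd_between (sqrt c) (2 * sqrt C) (cconj (psd_sqrt A))"
    by (intro pd_between_cconj psd_sqrt_pd A c)
  show "cconj (psd_sqrt A) ** cconj (psd_sqrt A) = cconj A"
    using psd_sqrt_pd(2)[OF A c] by (metis cconj_mult)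
qed (use c in simp)

lemma matrix_inv_cconj:
  assumes A: "pd_between c C A" and c: "0 < c"
  shows "matrix_inv (cconj A) = cconj (matrix_inv A)"
proof -
  have 1: "cconj (mat 1) = (mat 1 :: complex ^ 'a ^ 'a)" by (auto simp: vec_eq_iff mat_def)
  have "cconj A ** cconj (matrix_inv A) = mat 1"
    using pd_between_inv(1)[OF A c] 1 by (metis cconj_mult)
  then show ?thesis
    using pd_between_inv(2)[OF pd_between_cconj[OF A] c]
    by (metis matrix_mul_assoc matrix_mul_lid matrix_mul_rid)
qed

section \<open>Functions on the torus\<close>

lemma space_torus [simp]: "space torus_measure = cbox (0 :: real ^ 'd) (\<chi> k. 2 * pi)"
  by (simp add: torus_measure_def space_scale_measure)

lemma sets_torus: "sets (torus_measure :: (real ^ 'd) measure) = sets (lebesgue_on (cbox 0 (\<chi> k. 2 * pi)))"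
  by (simp add: torus_measure_def)

lemma borel_measurable_torus_iff:
  "f \<in> borel_measurable (torus_measure :: (real ^ 'd) measure) \<longleftrightarrow>
   f \<in> borel_measurable (lebesgue_on (cbox 0 (\<chi> k. 2 * pi)))"
  by (simp add: measurable_cong_sets[OF sets_torus refl])

lemma borel_imp_torus_measurable:
  "f \<in> borel_measurable borel \<Longrightarrow> f \<in> borel_measurable (torus_measure :: (real ^ 'd) measure)"
  unfolding borel_measurable_torus_iff
  by (intro measurable_restrict_space1 measurable_completion) simp

lemma continuous_imp_torus_measurable:
  "continuous_on UNIV f \<Longrightarrow> f \<in> borel_measurable (torus_measure :: (real ^ 'd) measure)"
  by (intro borel_imp_torus_measurable borel_measurable_continuous_onI)

lemma emeasure_torus:
  "emeasure (torus_measure :: (real ^ 'd) measure) A =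
     ennreal (1 / (2 * pi) ^ CARD('d)) * emeasure (lebesgue_on (cbox 0 (\<chi> k. 2 * pi))) A"
  by (simp add: torus_measure_def)

lemma prob_space_torus: "prob_space (torus_measure :: (real ^ 'd) measure)"
proof
  let ?Q = "cbox (0 :: real ^ 'd) (\<chi> k. 2 * pi)"
  have "(0 :: real ^ 'd) \<in> ?Q" by (simp add: mem_box_cart)
  then have "?Q \<noteq> {}" by blast
  then have "measure lborel ?Q = (2 * pi) ^ CARD('d)"
    by (simp add: content_cbox_cart)
  moreover have "emeasure lborel ?Q = ennreal (measure lborel ?Q)"
    by (intro emeasure_eq_ennreal_measure) (simp add: emeasure_lborel_cbox_eq)
  ultimately have "emeasure lebesgue ?Q = ennreal ((2 * pi) ^ CARD('d))"
    by simp
  then show "emeasure torus_measure (space (torus_measure :: (real ^ 'd) measure)) = 1"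
    by (simp add: emeasure_torus emeasure_restrict_space flip: ennreal_mult)
qed

lemma AE_torus_iff:
  "(AE \<theta> in torus_measure. P \<theta>) \<longleftrightarrow> (AE \<theta> in lebesgue_on (cbox (0 :: real ^ 'd) (\<chi> k. 2 * pi)). P \<theta>)"
proof -
  have "null_sets (torus_measure :: (real ^ 'd) measure) = null_sets (lebesgue_on (cbox 0 (\<chi> k. 2 * pi)))"
    unfolding null_sets_def sets_torus emeasure_torus by (auto simp: divide_le_0_iff)
  then show ?thesis unfolding eventually_ae_filter by (simp add: torus_measure_def space_scale_measure)
qed

lemma complete_measure_torus: "complete_measure (torus_measure :: (real ^ 'd) measure)"
proof
  fix B A assume "B \<subseteq> A" and A: "A \<in> null_sets (torus_measure :: (real ^ 'd) measure)"
  let ?Q = "cbox (0 :: real ^ 'd) (\<chi> k. 2 * pi)"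
  have "A \<in> null_sets (lebesgue_on ?Q)"
    using A unfolding null_sets_def sets_torus emeasure_torus by (auto simp: divide_le_0_iff)
  then have "A \<in> null_sets lebesgue" "A \<subseteq> ?Q"
    by (auto simp: null_sets_restrict_space)
  then have "B \<in> null_sets lebesgue" "B \<subseteq> ?Q"
    using completion.complete2[of B A lborel] \<open>B \<subseteq> A\<close> by auto
  then show "B \<in> sets (torus_measure :: (real ^ 'd) measure)"
    unfolding sets_torus by (auto simp: sets_restrict_space_iff)
qed

lemma (in complete_measure) borel_measurable_AE_cong:
  assumes f: "f \<in> borel_measurable M" and ae: "AE x in M. f x = g x"
  shows "g \<in> borel_measurable M"
proof (rule measurableI)
  fix A :: "'b set" assume A: "A \<in> sets borel"
  show "g -` A \<inter> space M \<in> sets M"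
    by (rule in_sets_AE[OF _ measurable_sets[OF f A]]) (use ae AE_space in \<open>auto elim: AE_mp\<close>)
qed auto

lemma AE_torus_box: "AE \<theta> in torus_measure. \<theta> \<in> box (0 :: real ^ 'd) (\<chi> k. 2 * pi)"
proof -
  let ?Q = "cbox (0 :: real ^ 'd) (\<chi> k. 2 * pi)" and ?B = "box (0 :: real ^ 'd) (\<chi> k. 2 * pi)"
  have "?Q - ?B \<in> null_sets lebesgue"
    using negligible_frontier_interval[of 0 "\<chi> k. 2 * pi"] by (simp add: negligible_iff_null_sets)
  then have "AE \<theta> in lebesgue. \<theta> \<notin> ?Q - ?B" by (rule AE_not_in)
  then show ?thesis unfolding AE_torus_iff by (subst AE_restrict_space_iff) (auto elim: AE_mp)
qed

definition refl_torus :: "real ^ 'd \<Rightarrow> real ^ 'd" where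
  "refl_torus \<theta> = (\<chi> k. 2 * pi) - \<theta>"

lemma refl_torus_refl [simp]: "refl_torus (refl_torus \<theta>) = \<theta>"
  by (simp add: refl_torus_def)

lemma refl_torus_image_lebesgue:
  assumes "A \<in> sets lebesgue"
  shows "refl_torus -` A \<in> sets lebesgue" "emeasure lebesgue (refl_torus -` A) = emeasure lebesgue A"
proof -
  have im: "refl_torus -` A = (\<lambda>x. (-1) *\<^sub>R x + (\<chi> k. 2 * pi)) ` A"
  proof safe
    fix x assume "refl_torus x \<in> A"
    then show "x \<in> (\<lambda>x. (-1) *\<^sub>R x + (\<chi> k. 2 * pi)) ` A"
      by (intro image_eqI[of _ _ "refl_torus x"]) (simp_all add: refl_torus_def)
  qed (simp add: refl_torus_def)
  show "emeasure lebesgue (refl_torus -` A) = emeasure lebesgue A"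
    unfolding im by (subst emeasure_lebesgue_affine) simp
  have "(\<lambda>x :: real ^ 'a. (\<chi> k. 2 * pi) + (\<Sum>j\<in>Basis. (-1 * (x \<bullet> j)) *\<^sub>R j)) \<in> lebesgue \<rightarrow>\<^sub>M lebesgue"
    by (rule lebesgue_affine_measurable) simp
  moreover have "(\<Sum>j\<in>Basis. (-1 * (x \<bullet> j)) *\<^sub>R j) = - x" for x :: "real ^ 'a"
    using euclidean_representation[of "- x"] by simp
  ultimately have "(refl_torus :: real ^ 'a \<Rightarrow> _) \<in> lebesgue \<rightarrow>\<^sub>M lebesgue"
    unfolding refl_torus_def by simp
  from measurable_sets[OF this assms] show "refl_torus -` A \<in> sets lebesgue"
    by (simp only: space_completion space_lborel space_borel Int_UNIV_right)
qed

lemma refl_torus_mem_cbox [simp]: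
  "refl_torus \<theta> \<in> cbox 0 (\<chi> k. 2 * pi) \<longleftrightarrow> \<theta> \<in> cbox (0 :: real ^ 'd) (\<chi> k. 2 * pi)"
  by (auto simp: refl_torus_def mem_box_cart)

lemma refl_torus_vimage:
  assumes "A \<in> sets (torus_measure :: (real ^ 'd) measure)"
  shows "refl_torus -` A \<in> sets torus_measure" "emeasure torus_measure (refl_torus -` A) = emeasure torus_measure A"
proof -
  let ?Q = "cbox (0 :: real ^ 'd) (\<chi> k. 2 * pi)"
  have A: "A \<in> sets lebesgue" "A \<subseteq> ?Q"
    using assms unfolding sets_torus by (auto simp: sets_restrict_space_iff)
  have r: "refl_torus -` A \<in> sets lebesgue" "refl_torus -` A \<subseteq> ?Q"
    using refl_torus_image_lebesgue(1)[OF A(1)] A(2) refl_torus_mem_cbox by blast+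
  then show "refl_torus -` A \<in> sets torus_measure"
    unfolding sets_torus by (auto simp: sets_restrict_space_iff)
  show "emeasure torus_measure (refl_torus -` A) = emeasure torus_measure A"
    using r A refl_torus_image_lebesgue(2)[OF A(1)]
    by (simp add: emeasure_torus emeasure_restrict_space)
qed

lemma refl_torus_measurable [measurable]:
  "refl_torus \<in> (torus_measure :: (real ^ 'd) measure) \<rightarrow>\<^sub>M torus_measure"
proof (rule measurableI)
  fix A assume "A \<in> sets (torus_measure :: (real ^ 'd) measure)"
  then show "refl_torus -` A \<inter> space torus_measure \<in> sets torus_measure"
    using refl_torus_vimage by blast
qed simp

lemma distr_refl_torus: "distr torus_measure torus_measure refl_torus = (torus_measure :: (real ^ 'd) measure)"
proof (rule measure_eqI)
  fix A assume "A \<in> sets (distr torus_measure torus_measure (refl_torus :: real ^ 'd \<Rightarrow> _))"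
  then have A: "A \<in> sets torus_measure" by simp
  then have "refl_torus -` A \<inter> space torus_measure = refl_torus -` A"
    using sets.sets_into_space[OF refl_torus_vimage(1)[OF A]] by blast
  then show "emeasure (distr torus_measure torus_measure refl_torus) A = emeasure torus_measure A"
    using A refl_torus_vimage(2)[OF A] by (simp add: emeasure_distr)
qed simp

lemma integral_refl_torus:
  fixes f :: "real ^ 'd \<Rightarrow> 'b :: {banach, second_countable_topology}"
  assumes "f \<in> borel_measurable torus_measure"
  shows "(\<integral>\<theta>. f (refl_torus \<theta>) \<partial>torus_measure) = (\<integral>\<theta>. f \<theta> \<partial>torus_measure)"
  using integral_distr[OF refl_torus_measurable assms] by (simp add: distr_refl_torus)

definition bdd_meas :: "(real ^ 'd \<Rightarrow> 'b :: real_normed_vector) \<Rightarrow> bool" where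
  "bdd_meas f \<longleftrightarrow> f \<in> borel_measurable torus_measure \<and> (\<exists>B. \<forall>\<theta>. norm (f \<theta>) \<le> B)"

lemma bdd_measI: "f \<in> borel_measurable torus_measure \<Longrightarrow> (\<And>\<theta>. norm (f \<theta>) \<le> B) \<Longrightarrow> bdd_meas f"
  by (auto simp: bdd_meas_def)

lemma bdd_meas_measurable: "bdd_meas f \<Longrightarrow> f \<in> borel_measurable torus_measure"
  by (auto simp: bdd_meas_def)

lemma bdd_measE:
  assumes "bdd_meas f" obtains B where "0 < B" "\<And>\<theta>. norm (f \<theta>) \<le> B"
proof -
  obtain B where "\<And>\<theta>. norm (f \<theta>) \<le> B" using assms by (auto simp: bdd_meas_def)
  then have "\<And>\<theta>. norm (f \<theta>) \<le> max B 1" by (simp add: le_max_iff_disj)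
  then show ?thesis using that[of "max B 1"] by simp
qed

lemma bdd_meas_integrable:
  fixes f :: "real ^ 'd \<Rightarrow> 'b :: {banach, second_countable_topology}"
  assumes "bdd_meas f" shows "integrable torus_measure f"
proof -
  interpret prob_space "torus_measure :: (real ^ 'd) measure" by (rule prob_space_torus)
  from assms obtain B where "\<And>\<theta>. norm (f \<theta>) \<le> B" by (meson bdd_measE)
  then show ?thesis using bdd_meas_measurable[OF assms] by (intro integrable_const_bound[of _ B]) auto
qed

lemma bdd_meas_const [simp]: "bdd_meas (\<lambda>_. c)"
  by (rule bdd_measI) auto

lemma bdd_meas_add:
  fixes f g :: "real ^ 'd \<Rightarrow> 'b :: {second_countable_topology, real_normed_vector}"
  assumes "bdd_meas f" "bdd_meas g" shows "bdd_meas (\<lambda>\<theta>. f \<theta> + g \<theta>)"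
proof -
  from assms obtain A B where "\<And>\<theta>. norm (f \<theta>) \<le> A" "\<And>\<theta>. norm (g \<theta>) \<le> B" by (meson bdd_measE)
  then have "norm (f \<theta> + g \<theta>) \<le> A + B" for \<theta> by (intro norm_triangle_mono)
  then show ?thesis using assms
    by (intro bdd_measI borel_measurable_add) (auto dest: bdd_meas_measurable)
qed

lemma bdd_meas_bounded_bilinear:
  fixes f :: "real ^ 'd \<Rightarrow> 'a :: {second_countable_topology, real_normed_vector}"
    and g :: "real ^ 'd \<Rightarrow> 'b :: {second_countable_topology, real_normed_vector}"
    and prod :: "'a \<Rightarrow> 'b \<Rightarrow> 'c :: real_normed_vector"
  assumes "bounded_bilinear prod" "bdd_meas f" "bdd_meas g" shows "bdd_meas (\<lambda>\<theta>. prod (f \<theta>) (g \<theta>))"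
proof -
  from assms obtain A B where AB: "\<And>\<theta>. norm (f \<theta>) \<le> A" "\<And>\<theta>. norm (g \<theta>) \<le> B" "0 < A" by (meson bdd_measE)
  from bounded_bilinear.pos_bounded[OF assms(1)] obtain K where K: "0 < K"
    "\<And>a b. norm (prod a b) \<le> norm a * norm b * K" by blast
  have "norm (prod (f \<theta>) (g \<theta>)) \<le> A * B * K" for \<theta>
  proof -
    have "norm (f \<theta>) * norm (g \<theta>) \<le> A * B" using AB by (intro mult_mono) auto
    then show ?thesis using K(2)[of "f \<theta>" "g \<theta>"] K(1) by (meson mult_right_mono less_imp_le order_trans)
  qed
  moreover have "continuous_on UNIV (\<lambda>x. prod (fst x) (snd x))"
    by (intro bounded_bilinear.continuous_on[OF assms(1)] continuous_intros)
  then have m: "(\<lambda>x. prod (fst x) (snd x)) \<in> borel_measurable borel"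
    by (rule borel_measurable_continuous_onI)
  have "(\<lambda>\<theta>. prod (f \<theta>) (g \<theta>)) \<in> borel_measurable torus_measure"
    using measurable_compose[OF borel_measurable_Pair[OF assms(2,3)[THEN bdd_meas_measurable]] m]
    by (simp only: fst_conv snd_conv)
  ultimately show ?thesis by (rule bdd_measI[rotated])
qed

lemma bdd_meas_bounded_linear:
  assumes L: "bounded_linear L" and f: "bdd_meas f" shows "bdd_meas (\<lambda>\<theta>. L (f \<theta>))"
proof -
  from f obtain A where A: "\<And>\<theta>. norm (f \<theta>) \<le> A" by (meson bdd_measE)
  from bounded_linear.pos_bounded[OF L] obtain K where K: "0 < K" "\<And>a. norm (L a) \<le> norm a * K" by blast
  have "norm (L (f \<theta>)) \<le> A * K" for \<theta>
    using K(2)[of "f \<theta>"] mult_right_mono[OF A, of K \<theta>] K(1) by linarith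
  moreover have "L \<in> borel_measurable borel"
    by (intro borel_measurable_continuous_onI linear_continuous_on L)
  then have "(\<lambda>\<theta>. L (f \<theta>)) \<in> borel_measurable torus_measure"
    using f by (intro measurable_compose[of f _ borel L]) (auto dest: bdd_meas_measurable)
  ultimately show ?thesis by (rule bdd_measI[rotated])
qed

lemma bdd_meas_inner:
  fixes f g :: "real ^ 'd \<Rightarrow> 'a :: {second_countable_topology, real_inner}"
  shows "bdd_meas f \<Longrightarrow> bdd_meas g \<Longrightarrow> bdd_meas (\<lambda>\<theta>. f \<theta> \<bullet> g \<theta>)"
  by (rule bdd_meas_bounded_bilinear[OF bounded_bilinear_inner])

lemma bdd_meas_mult:
  fixes f g :: "real ^ 'd \<Rightarrow> 'a :: {second_countable_topology, real_normed_algebra}"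
  shows "bdd_meas f \<Longrightarrow> bdd_meas g \<Longrightarrow> bdd_meas (\<lambda>\<theta>. f \<theta> * g \<theta>)"
  by (rule bdd_meas_bounded_bilinear[OF bounded_bilinear_mult])

lemma bdd_meas_scaleR:
  fixes f :: "real ^ 'd \<Rightarrow> 'a :: {second_countable_topology, real_normed_vector}"
  shows "bdd_meas f \<Longrightarrow> bdd_meas (\<lambda>\<theta>. r *\<^sub>R f \<theta>)"
  by (rule bdd_meas_bounded_linear[OF bounded_linear_scaleR_right])

lemma bdd_meas_uminus:
  fixes f :: "real ^ 'd \<Rightarrow> 'a :: {second_countable_topology, real_normed_vector}"
  shows "bdd_meas f \<Longrightarrow> bdd_meas (\<lambda>\<theta>. - f \<theta>)"
  using bdd_meas_scaleR[of f "-1"] by simp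

lemma bdd_meas_diff:
  fixes f g :: "real ^ 'd \<Rightarrow> 'b :: {second_countable_topology, real_normed_vector}"
  assumes "bdd_meas f" "bdd_meas g" shows "bdd_meas (\<lambda>\<theta>. f \<theta> - g \<theta>)"
  using bdd_meas_add[OF assms(1) bdd_meas_uminus[OF assms(2)]] by simp

lemma bdd_meas_sum:
  fixes f :: "'i \<Rightarrow> real ^ 'd \<Rightarrow> 'b :: {second_countable_topology, real_normed_vector}"
  shows "(\<And>i. i \<in> I \<Longrightarrow> bdd_meas (f i)) \<Longrightarrow> bdd_meas (\<lambda>\<theta>. \<Sum>i\<in>I. f i \<theta>)"
  by (induction I rule: infinite_finite_induct) (auto intro: bdd_meas_add)

lemma bdd_meas_norm_power:
  fixes f :: "real ^ 'd \<Rightarrow> 'b :: {second_countable_topology, real_normed_vector}"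
  assumes "bdd_meas f" shows "bdd_meas (\<lambda>\<theta>. norm (f \<theta>) ^ n)"
proof -
  from assms obtain B where "\<And>\<theta>. norm (f \<theta>) \<le> B" by (meson bdd_measE)
  then have "norm (norm (f \<theta>) ^ n) \<le> B ^ n" for \<theta> by (simp add: power_mono)
  then show ?thesis using assms by (intro bdd_measI) (auto dest: bdd_meas_measurable)
qed

section \<open>Trigonometric polynomials\<close>

lemma freq_pairing_add: "freq_pairing \<theta> (s + t) = freq_pairing \<theta> s + freq_pairing \<theta> t"
  by (simp add: freq_pairing_def algebra_simps sum.distrib)

lemma freq_pairing_minus: "freq_pairing \<theta> (- s) = - freq_pairing \<theta> s"
  by (simp add: freq_pairing_def sum_negf)

lemma freq_pairing_0 [simp]: "freq_pairing \<theta> 0 = 0"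
  by (simp add: freq_pairing_def)

lemma freq_pairing_axis: "freq_pairing \<theta> (axis k 1) = \<theta> $ k"
  by (simp add: freq_pairing_def axis_def if_distrib cong: if_cong)

lemma cis_freq_refl: "cis (freq_pairing (refl_torus \<theta>) s) = cis (- freq_pairing \<theta> s)"
proof -
  have "freq_pairing (refl_torus \<theta>) s = 2 * pi * real_of_int (\<Sum>k\<in>UNIV. s $ k) - freq_pairing \<theta> s"
    by (simp add: freq_pairing_def refl_torus_def algebra_simps sum_subtractf sum_distrib_left)
  then show ?thesis
    by (metis cis_divide cis_multiple_2pi Ints_of_int cis_inverse divide_inverse mult_1)
qed

lemma continuous_on_cis_freq [continuous_intros]: "continuous_on A (\<lambda>\<theta>. cis (freq_pairing \<theta> s))"
  unfolding freq_pairing_def by (intro continuous_intros)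

inductive trig_poly :: "(real ^ 'd \<Rightarrow> complex) \<Rightarrow> bool" where
  monom: "trig_poly (\<lambda>\<theta>. c * cis (- freq_pairing \<theta> s))"
| add: "trig_poly f \<Longrightarrow> trig_poly g \<Longrightarrow> trig_poly (\<lambda>\<theta>. f \<theta> + g \<theta>)"

inductive real_trig_poly :: "(real ^ 'd \<Rightarrow> complex) \<Rightarrow> bool" where
  monom: "real_trig_poly (\<lambda>\<theta>. complex_of_real r * cis (- freq_pairing \<theta> s))"
| add: "real_trig_poly f \<Longrightarrow> real_trig_poly g \<Longrightarrow> real_trig_poly (\<lambda>\<theta>. f \<theta> + g \<theta>)"

lemma trig_poly_const: "trig_poly (\<lambda>_. c)"
  using trig_poly.monom[of c 0] by simp

lemma trig_poly_cmult: "trig_poly f \<Longrightarrow> trig_poly (\<lambda>\<theta>. c * f \<theta>)"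
proof (induction rule: trig_poly.induct)
  case (monom a s)
  then show ?case using trig_poly.monom[of "c * a" s] by (simp add: mult.assoc)
next
  case (add f g)
  then show ?case using trig_poly.add by (simp add: distrib_left)
qed

lemma trig_poly_mult:
  assumes "trig_poly f" "trig_poly g" shows "trig_poly (\<lambda>\<theta>. f \<theta> * g \<theta>)"
  using assms(1)
proof (induction rule: trig_poly.induct)
  case f: (monom c s)
  from assms(2) show ?case
  proof (induction rule: trig_poly.induct)
    case (monom c' s')
    have "c * cis (- freq_pairing \<theta> s) * (c' * cis (- freq_pairing \<theta> s'))
        = c * c' * cis (- freq_pairing \<theta> (s + s'))" for \<theta>
    proof -
      have "cis (- freq_pairing \<theta> (s + s')) = cis (- freq_pairing \<theta> s) * cis (- freq_pairing \<theta> s')"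
        by (simp add: freq_pairing_add cis_mult)
      then show ?thesis by (simp only: mult_ac)
    qed
    then show ?case by (simp only:) (rule trig_poly.monom)
  next
    case (add f g)
    then show ?case using trig_poly.add by (simp add: distrib_left)
  qed
next
  case (add f f')
  then show ?case using trig_poly.add by (simp add: distrib_right)
qed

lemma trig_poly_sum: "(\<And>i. i \<in> I \<Longrightarrow> trig_poly (f i)) \<Longrightarrow> trig_poly (\<lambda>\<theta>. \<Sum>i\<in>I. f i \<theta>)"
  by (induction I rule: infinite_finite_induct) (auto intro: trig_poly_const trig_poly.add)

lemma trig_poly_bdd_meas: "trig_poly f \<Longrightarrow> bdd_meas f"
proof (induction rule: trig_poly.induct)
  case (monom c s)
  show ?case
  proof (rule bdd_measI)
    show "(\<lambda>\<theta>. c * cis (- freq_pairing \<theta> s)) \<in> borel_measurable torus_measure"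
      unfolding freq_pairing_minus[symmetric]
      by (intro continuous_imp_torus_measurable continuous_intros)
    show "norm (c * cis (- freq_pairing \<theta> s)) \<le> norm c" for \<theta> by (simp add: norm_mult)
  qed
qed (rule bdd_meas_add)

lemma real_trig_poly_imp_trig_poly: "real_trig_poly f \<Longrightarrow> trig_poly f"
  by (induction rule: real_trig_poly.induct) (auto intro: trig_poly.intros)

lemma trig_poly_real_part:
  "trig_poly f \<Longrightarrow> real_trig_poly (\<lambda>\<theta>. (1 / 2) *\<^sub>R (f \<theta> + cnj (f (refl_torus \<theta>))))"
proof (induction rule: trig_poly.induct)
  case (monom c s)
  have "cnj (c * cis (- freq_pairing (refl_torus \<theta>) s)) = cnj c * cis (- freq_pairing \<theta> s)" for \<theta>
    using cis_freq_refl[of \<theta> s] by (simp add: cis_cnj)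
  then have "(1 / 2) *\<^sub>R (c * cis (- freq_pairing \<theta> s) + cnj (c * cis (- freq_pairing (refl_torus \<theta>) s)))
      = complex_of_real (Re c) * cis (- freq_pairing \<theta> s)" for \<theta>
    by (simp only: flip: distrib_right) (simp add: complex_add_cnj scaleR_conv_of_real)
  then show ?case using real_trig_poly.monom[of "Re c" s] by simp
next
  case (add f g)
  from real_trig_poly.add[OF add.IH] show ?case by (simp add: scaleR_add_right add_ac)
qed

definition torus_embed :: "real ^ 'd \<Rightarrow> complex ^ 'd" where
  "torus_embed \<theta> = (\<chi> k. cis (\<theta> $ k))"

lemma continuous_on_torus_embed: "continuous_on A torus_embed"
  unfolding torus_embed_def by (intro continuous_intros)

lemma trig_poly_torus_embed:
  fixes g :: "complex ^ 'd \<Rightarrow> real"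
  assumes "real_polynomial_function g"
  shows "trig_poly (\<lambda>\<theta>. complex_of_real (g (torus_embed \<theta>)))"
  using assms
proof (induction rule: real_polynomial_function.induct)
  case (linear g)
  then interpret g: bounded_linear g .
  define a b where "a k = complex_of_real (g (axis k 1))" and "b k = complex_of_real (g (axis k \<i>))" for k
  have ax: "axis k z = Re z *\<^sub>R axis k 1 + Im z *\<^sub>R axis k \<i>" for k :: 'd and z
    by (simp add: vec_eq_iff axis_def complex_eq_iff)
  have "w = (\<Sum>k\<in>UNIV. axis k (w $ k))" for w :: "complex ^ 'd"
    by (simp add: vec_eq_iff axis_def if_distrib cong: if_cong)
  then have dec: "w = (\<Sum>k\<in>UNIV. Re (w $ k) *\<^sub>R axis k 1 + Im (w $ k) *\<^sub>R axis k \<i>)" for w :: "complex ^ 'd"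
    by (simp only: ax[symmetric])
  have gw: "g w = (\<Sum>k\<in>UNIV. Re (w $ k) * g (axis k 1) + Im (w $ k) * g (axis k \<i>))" for w
    by (subst dec) (simp only: g.sum g.add g.scaleR real_scaleR_def)
  have cis: "complex_of_real (cos x) = (cis x + cis (- x)) / 2"
    "complex_of_real (sin x) = (cis x - cis (- x)) / (2 * \<i>)" for x
    by (simp_all add: complex_eq_iff)
  have "complex_of_real (g (torus_embed \<theta>)) = (\<Sum>k\<in>UNIV.
      ((a k / 2 + b k / (2 * \<i>)) * cis (- freq_pairing \<theta> (- axis k 1)) +
       (a k / 2 - b k / (2 * \<i>)) * cis (- freq_pairing \<theta> (axis k 1))))" for \<theta>
    unfolding freq_pairing_minus freq_pairing_axis
    by (subst gw, subst of_real_sum, intro sum.cong refl) (simp add: torus_embed_def a_def b_def cis, simp add: field_simps)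
  then show ?case
    by (simp only:) (intro trig_poly_sum trig_poly.intros)
next
  case (const c)
  show ?case by (rule trig_poly_const)
next
  case (add f g)
  then show ?case by (simp add: trig_poly.add)
next
  case (mult f g)
  then show ?case by (simp add: trig_poly_mult)
qed

lemma cis_eq_imp_eq:
  assumes "cis x = cis y" "0 \<le> x" "x < 2 * pi" "0 \<le> y" "y < 2 * pi" shows "x = y"
proof -
  have "Arg2pi (cis x) = x" "Arg2pi (cis y) = y"
    using assms by (auto intro!: Arg2pi_unique[of 1] simp: cis_conv_exp)
  then show ?thesis using assms(1) by metis
qed

lemma cube_boundaryE:
  assumes "x \<in> cbox (0 :: real ^ 'd) (\<chi> k. 2 * pi)" "x \<notin> box 0 (\<chi> k. 2 * pi)"
  obtains k where "x $ k = 0 \<or> x $ k = 2 * pi"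
proof -
  from assms(2) obtain k where "\<not> (0 < x $ k \<and> x $ k < 2 * pi)" by (auto simp: mem_box_cart)
  moreover have "0 \<le> x $ k" "x $ k \<le> 2 * pi" using assms(1) by (auto simp: mem_box_cart)
  ultimately show ?thesis using that[of k] by linarith
qed

text \<open>The boundary of the cube, where \<open>h\<close> vanishes, contains all the identifications made by
  \<open>torus_embed\<close>, so \<open>h\<close> factors through a continuous function on its compact image.\<close>

lemma trig_poly_uniform_approx:
  fixes h :: "real ^ 'd \<Rightarrow> real"
  assumes h: "continuous_on UNIV h"
    and bdry: "\<And>\<theta>. \<theta> \<in> cbox 0 (\<chi> k. 2 * pi) \<Longrightarrow> \<theta> \<notin> box 0 (\<chi> k. 2 * pi) \<Longrightarrow> h \<theta> = 0"
    and e: "0 < e"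
  obtains p where "trig_poly p" "\<And>\<theta>. \<theta> \<in> cbox 0 (\<chi> k. 2 * pi) \<Longrightarrow> norm (complex_of_real (h \<theta>) - p \<theta>) < e"
proof -
  let ?Q = "cbox (0 :: real ^ 'd) (\<chi> k. 2 * pi)"
  define T where "T = torus_embed ` ?Q"
  have inj: "h x = h y" if xy: "x \<in> ?Q" "y \<in> ?Q" "torus_embed x = torus_embed y" for x y
  proof (cases "x \<in> box 0 (\<chi> k. 2 * pi) \<and> y \<in> box 0 (\<chi> k. 2 * pi)")
    case True
    have "x $ k = y $ k" for k
      using xy(3) True by (intro cis_eq_imp_eq) (auto simp: torus_embed_def vec_eq_iff mem_box_cart less_imp_le)
    then have "x = y" by (simp add: vec_eq_iff)
    then show ?thesis by simp
  next
    case False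
    have aux: "y' \<notin> box 0 (\<chi> k. 2 * pi)"
      if "x' \<in> ?Q" "x' \<notin> box 0 (\<chi> k. 2 * pi)" "torus_embed x' = torus_embed y'" for x' y' :: "real ^ 'd"
    proof
      assume y': "y' \<in> box 0 (\<chi> k. 2 * pi)"
      from that(1,2) obtain k where k: "x' $ k = 0 \<or> x' $ k = 2 * pi"
        by (elim cube_boundaryE)
      then have "cis (y' $ k) = cis 0"
        using that(3) by (auto simp: torus_embed_def vec_eq_iff cis_2pi dest: spec[of _ k])
      then have "y' $ k = 0"
        by (rule cis_eq_imp_eq) (use y' in \<open>auto simp: mem_box_cart less_imp_le\<close>)
      moreover have "0 < y' $ k" using y' by (simp add: mem_box_cart)
      ultimately show False by simp
    qed
    have "x \<notin> box 0 (\<chi> k. 2 * pi)" "y \<notin> box 0 (\<chi> k. 2 * pi)"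
      using False aux[OF xy(1) _ xy(3)] aux[OF xy(2) _ xy(3)[symmetric]] by blast+
    from bdry[OF xy(1) this(1)] bdry[OF xy(2) this(2)] show ?thesis by simp
  qed
  define H where "H w = h (SOME x. x \<in> ?Q \<and> torus_embed x = w)" for w
  have H: "H (torus_embed x) = h x" if "x \<in> ?Q" for x
    unfolding H_def using someI[of "\<lambda>y. y \<in> ?Q \<and> torus_embed y = torus_embed x" x] that inj by blast
  have T: "compact T" unfolding T_def
    by (intro compact_continuous_image continuous_on_torus_embed compact_cbox)
  have "continuous_on T H"
    unfolding continuous_on_closed_vimage[OF compact_imp_closed[OF T]]
  proof safe
    fix B :: "real set" assume "closed B"
    have "H -` B \<inter> T = torus_embed ` (h -` B \<inter> ?Q)"
      using H by (auto simp: T_def)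
    moreover have "compact (h -` B \<inter> ?Q)"
      by (intro closed_Int_compact continuous_closed_vimage \<open>closed B\<close> compact_cbox)
        (use h in \<open>auto simp: continuous_on_eq_continuous_at\<close>)
    ultimately show "closed (H -` B \<inter> T)"
      by (simp add: compact_imp_closed compact_continuous_image continuous_on_torus_embed)
  qed
  with T obtain g where g: "real_polynomial_function g" "\<And>x. x \<in> T \<Longrightarrow> \<bar>H x - g x\<bar> < e"
    using Stone_Weierstrass_real_polynomial_function[OF _ _ e] by metis
  show ?thesis
  proof (rule that)
    show "trig_poly (\<lambda>\<theta>. complex_of_real (g (torus_embed \<theta>)))" by (rule trig_poly_torus_embed[OF g(1)])
    fix \<theta> assume "\<theta> \<in> ?Q"
    then show "norm (complex_of_real (h \<theta>) - complex_of_real (g (torus_embed \<theta>))) < e"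
      using g(2)[of "torus_embed \<theta>"] H[of \<theta>] by (simp add: T_def flip: of_real_diff)
  qed
qed

lemma norm_add_square_le: "(norm (x + y))\<^sup>2 \<le> 2 * (norm x)\<^sup>2 + 2 * (norm (y :: 'a :: real_inner))\<^sup>2"
proof -
  have "2 * (x \<bullet> y) \<le> (norm x)\<^sup>2 + (norm y)\<^sup>2"
    using zero_le_power2[of "norm (x - y)"]
    by (simp add: power2_norm_eq_inner inner_diff_left inner_diff_right inner_commute)
  then show ?thesis by (simp add: power2_norm_eq_inner inner_add_left inner_add_right inner_commute)
qed

lemma trig_poly_dense_real:
  fixes f :: "real ^ 'd \<Rightarrow> real"
  assumes f: "bdd_meas f" and e: "0 < e"
  obtains p where "trig_poly p" "(\<integral>\<theta>. (norm (complex_of_real (f \<theta>) - p \<theta>))\<^sup>2 \<partial>torus_measure) < e"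
proof -
  let ?Q = "cbox (0 :: real ^ 'd) (\<chi> k. 2 * pi)"
  interpret prob_space "torus_measure :: (real ^ 'd) measure" by (rule prob_space_torus)
  from f obtain B where B: "0 < B" "\<And>\<theta>. norm (f \<theta>) \<le> B" by (meson bdd_measE)
  have "f measurable_on ?Q"
    using bdd_meas_measurable[OF f] by (simp add: measurable_on_iff_borel_measurable borel_measurable_torus_iff)
  then obtain N g where N: "negligible N" and g: "\<And>n. continuous_on UNIV (g n)"
    and lim: "\<And>x. x \<notin> N \<Longrightarrow> (\<lambda>n. g n x) \<longlonglongrightarrow> (if x \<in> ?Q then f x else 0)"
    unfolding measurable_on_def by blast
  define \<phi> where "\<phi> n x = (\<Prod>k\<in>UNIV. max 0 (min 1 (real n * ((x $ k) * (2 * pi - x $ k)))))" for n and x :: "real ^ 'd"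
  define h where "h n x = \<phi> n x * max (- B) (min B (g n x))" for n x
  have \<phi>: "0 \<le> \<phi> n x" "\<phi> n x \<le> 1" for n x
    unfolding \<phi>_def by (auto intro!: prod_nonneg prod_le_1)
  have hB: "\<bar>h n x\<bar> \<le> B" for n x
  proof -
    have "\<bar>h n x\<bar> \<le> 1 * B"
      unfolding h_def abs_mult using \<phi>[of n x] B(1) by (intro mult_mono) auto
    then show ?thesis by simp
  qed
  have hc: "continuous_on UNIV (h n)" for n
    unfolding h_def \<phi>_def by (intro continuous_intros g)
  have h0: "h n x = 0" if "x \<in> ?Q" "x \<notin> box 0 (\<chi> k. 2 * pi)" for n x
  proof -
    from that obtain k where "x $ k = 0 \<or> x $ k = 2 * pi" by (elim cube_boundaryE)
    then have "max 0 (min 1 (real n * ((x $ k) * (2 * pi - x $ k)))) = 0" by auto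
    then have "\<phi> n x = 0" unfolding \<phi>_def by (auto intro!: prod_zero)
    then show ?thesis by (simp add: h_def)
  qed
  have hlim: "(\<lambda>n. h n x) \<longlonglongrightarrow> f x" if "x \<notin> N" "x \<in> box 0 (\<chi> k. 2 * pi)" for x
  proof -
    have x: "x \<in> ?Q" using that(2) box_subset_cbox by blast
    have "eventually (\<lambda>n. \<forall>k. 1 \<le> real n * ((x $ k) * (2 * pi - x $ k))) sequentially"
    proof (rule eventually_all_finite)
      fix k
      have pos: "0 < (x $ k) * (2 * pi - x $ k)" using that(2) by (auto simp: mem_box_cart)
      obtain m where m: "1 / ((x $ k) * (2 * pi - x $ k)) < real m" using reals_Archimedean2 by blast
      show "eventually (\<lambda>n. 1 \<le> real n * ((x $ k) * (2 * pi - x $ k))) sequentially"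
        using eventually_ge_at_top[of m]
      proof eventually_elim
        case (elim n)
        then have "1 / ((x $ k) * (2 * pi - x $ k)) \<le> real n" using m by linarith
        then show ?case using pos by (simp add: pos_divide_le_eq)
      qed
    qed
    then have "eventually (\<lambda>n. \<phi> n x = 1) sequentially"
      by eventually_elim (simp add: \<phi>_def min_absorb1)
    then have l1: "(\<lambda>n. \<phi> n x) \<longlonglongrightarrow> 1" by (rule tendsto_eventually)
    have l2: "(\<lambda>n. max (- B) (min B (g n x))) \<longlonglongrightarrow> max (- B) (min B (f x))"
      using lim[OF that(1)] x by (intro tendsto_intros) auto
    have "max (- B) (min B (f x)) = f x" using B(2)[of x] by auto
    then show ?thesis using tendsto_mult[OF l1 l2] unfolding h_def by simp
  qed
  have hm: "bdd_meas (h n)" for n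
    by (rule bdd_measI[OF continuous_imp_torus_measurable[OF hc]]) (use hB in auto)
  have "AE x in torus_measure. x \<notin> N"
  proof -
    have "AE x in lebesgue. x \<notin> N" using N by (simp add: AE_not_in negligible_iff_null_sets)
    then show ?thesis unfolding AE_torus_iff by (subst AE_restrict_space_iff) auto
  qed
  then have ae: "AE x in torus_measure. (\<lambda>n. (f x - h n x)\<^sup>2) \<longlonglongrightarrow> 0"
    using AE_torus_box
  proof eventually_elim
    case (elim x)
    have "(\<lambda>n. (f x - h n x)\<^sup>2) \<longlonglongrightarrow> (f x - f x)\<^sup>2" by (intro tendsto_intros hlim elim)
    then show ?case by simp
  qed
  have "(\<lambda>n. \<integral>x. (f x - h n x)\<^sup>2 \<partial>torus_measure) \<longlonglongrightarrow> (\<integral>x. 0 \<partial>(torus_measure :: (real ^ 'd) measure))"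
  proof (rule integral_dominated_convergence[where w = "\<lambda>_. (2 * B)\<^sup>2"])
    show "AE x in torus_measure. norm ((f x - h n x)\<^sup>2) \<le> (2 * B)\<^sup>2" for n
    proof (rule AE_I2)
      fix x
      have "\<bar>f x - h n x\<bar> \<le> 2 * B" using B(2)[of x] hB[of n x] by simp
      then have "(f x - h n x)\<^sup>2 \<le> (2 * B)\<^sup>2" using B(1) abs_le_square_iff[of _ "2 * B"] by simp
      then show "norm ((f x - h n x)\<^sup>2) \<le> (2 * B)\<^sup>2" by simp
    qed
  qed (use ae bdd_meas_measurable[OF f] bdd_meas_measurable[OF hm] in auto)
  then have "eventually (\<lambda>n. (\<integral>x. (f x - h n x)\<^sup>2 \<partial>torus_measure) < e / 4) sequentially"
    using e by (intro order_tendstoD(2)) auto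
  then obtain n where n: "(\<integral>x. (f x - h n x)\<^sup>2 \<partial>torus_measure) < e / 4"
    by (auto simp: eventually_sequentially)
  define d where "d = sqrt (e / 4)"
  have d: "0 < d" "d\<^sup>2 = e / 4" using e by (auto simp: d_def)
  obtain p where p: "trig_poly p" "\<And>\<theta>. \<theta> \<in> ?Q \<Longrightarrow> norm (complex_of_real (h n \<theta>) - p \<theta>) < d"
    using trig_poly_uniform_approx[OF hc[of n] h0 d(1)] by metis
  have i1: "integrable torus_measure (\<lambda>x. (f x - h n x)\<^sup>2)"
    using bdd_meas_integrable[OF bdd_meas_norm_power[OF bdd_meas_diff[OF f hm[of n]], where n = 2]] by simp
  have i2: "integrable torus_measure (\<lambda>x. (norm (complex_of_real (f x) - p x))\<^sup>2)"
    using p(1) f by (intro bdd_meas_integrable bdd_meas_norm_power bdd_meas_diff trig_poly_bdd_meas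
        bdd_meas_bounded_linear[OF bounded_linear_of_real])
  have "(\<integral>x. (norm (complex_of_real (f x) - p x))\<^sup>2 \<partial>torus_measure)
      \<le> (\<integral>x. 2 * (f x - h n x)\<^sup>2 + 2 * (e / 4) \<partial>torus_measure)"
  proof (rule integral_mono[OF i2])
    show "integrable torus_measure (\<lambda>x. 2 * (f x - h n x)\<^sup>2 + 2 * (e / 4))" using i1 by simp
    fix x assume "x \<in> space (torus_measure :: (real ^ 'd) measure)"
    then have "(norm (complex_of_real (h n x) - p x))\<^sup>2 \<le> d\<^sup>2"
      using p(2)[of x] by (intro power_mono) auto
    moreover have "(norm (complex_of_real (f x) - complex_of_real (h n x)))\<^sup>2 = (f x - h n x)\<^sup>2"
      by (simp flip: of_real_diff)
    ultimately show "(norm (complex_of_real (f x) - p x))\<^sup>2 \<le> 2 * (f x - h n x)\<^sup>2 + 2 * (e / 4)"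
      using norm_add_square_le[of "complex_of_real (f x) - complex_of_real (h n x)" "complex_of_real (h n x) - p x"] d(2)
      by simp
  qed
  also have "\<dots> = 2 * (\<integral>x. (f x - h n x)\<^sup>2 \<partial>torus_measure) + e / 2"
    using i1 prob_space by simp
  also have "\<dots> < e" using n by simp
  finally show ?thesis using that p(1) by blast
qed

lemma trig_poly_dense:
  fixes f :: "real ^ 'd \<Rightarrow> complex"
  assumes f: "bdd_meas f" and e: "0 < e"
  obtains p where "trig_poly p" "(\<integral>\<theta>. (norm (f \<theta> - p \<theta>))\<^sup>2 \<partial>torus_measure) < e"
proof -
  have fRI: "bdd_meas (\<lambda>\<theta>. Re (f \<theta>))" "bdd_meas (\<lambda>\<theta>. Im (f \<theta>))"
    by (intro bdd_meas_bounded_linear[OF bounded_linear_Re f] bdd_meas_bounded_linear[OF bounded_linear_Im f])+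
  obtain p1 where p1: "trig_poly p1" "(\<integral>\<theta>. (norm (complex_of_real (Re (f \<theta>)) - p1 \<theta>))\<^sup>2 \<partial>torus_measure) < e / 4"
    using trig_poly_dense_real[OF fRI(1), of "e / 4"] e by auto
  obtain p2 where p2: "trig_poly p2" "(\<integral>\<theta>. (norm (complex_of_real (Im (f \<theta>)) - p2 \<theta>))\<^sup>2 \<partial>torus_measure) < e / 4"
    using trig_poly_dense_real[OF fRI(2), of "e / 4"] e by auto
  define p where "p \<theta> = p1 \<theta> + \<i> * p2 \<theta>" for \<theta>
  have p: "trig_poly p" unfolding p_def by (intro trig_poly.add trig_poly_cmult p1 p2)
  have bm: "bdd_meas (\<lambda>\<theta>. f \<theta> - p \<theta>)" "bdd_meas (\<lambda>\<theta>. complex_of_real (Re (f \<theta>)) - p1 \<theta>)"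
    "bdd_meas (\<lambda>\<theta>. complex_of_real (Im (f \<theta>)) - p2 \<theta>)"
    by (rule bdd_meas_diff[OF f trig_poly_bdd_meas[OF p]]
        bdd_meas_diff[OF bdd_meas_bounded_linear[OF bounded_linear_of_real] trig_poly_bdd_meas] fRI p1(1) p2(1))+
  note i = bm[THEN bdd_meas_norm_power, THEN bdd_meas_integrable]
  have "(\<integral>\<theta>. (norm (f \<theta> - p \<theta>))\<^sup>2 \<partial>torus_measure)
      \<le> (\<integral>\<theta>. 2 * (norm (complex_of_real (Re (f \<theta>)) - p1 \<theta>))\<^sup>2 + 2 * (norm (complex_of_real (Im (f \<theta>)) - p2 \<theta>))\<^sup>2 \<partial>torus_measure)"
  proof (rule integral_mono)
    fix \<theta>
    have "f \<theta> - p \<theta> = (complex_of_real (Re (f \<theta>)) - p1 \<theta>) + \<i> * (complex_of_real (Im (f \<theta>)) - p2 \<theta>)"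
      by (simp add: p_def algebra_simps complex_eq[symmetric])
    then show "(norm (f \<theta> - p \<theta>))\<^sup>2
      \<le> 2 * (norm (complex_of_real (Re (f \<theta>)) - p1 \<theta>))\<^sup>2 + 2 * (norm (complex_of_real (Im (f \<theta>)) - p2 \<theta>))\<^sup>2"
      using norm_add_square_le[of "complex_of_real (Re (f \<theta>)) - p1 \<theta>" "\<i> * (complex_of_real (Im (f \<theta>)) - p2 \<theta>)"]
      by (simp add: norm_mult)
  qed (use i in auto)
  also have "\<dots> = 2 * (\<integral>\<theta>. (norm (complex_of_real (Re (f \<theta>)) - p1 \<theta>))\<^sup>2 \<partial>torus_measure)
      + 2 * (\<integral>\<theta>. (norm (complex_of_real (Im (f \<theta>)) - p2 \<theta>))\<^sup>2 \<partial>torus_measure)"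
    using i by (subst Bochner_Integration.integral_add) auto
  also have "\<dots> < e" using p1(2) p2(2) by simp
  finally show ?thesis using that p by blast
qed

lemma real_trig_poly_dense:
  fixes f :: "real ^ 'd \<Rightarrow> complex"
  assumes f: "bdd_meas f" and sym: "\<And>\<theta>. f (refl_torus \<theta>) = cnj (f \<theta>)" and e: "0 < e"
  obtains p where "real_trig_poly p" "(\<integral>\<theta>. (norm (f \<theta> - p \<theta>))\<^sup>2 \<partial>torus_measure) < e"
proof -
  obtain p where p: "trig_poly p" and fp: "(\<integral>\<theta>. (norm (f \<theta> - p \<theta>))\<^sup>2 \<partial>torus_measure) < e"
    using trig_poly_dense[OF f e] by blast
  define q where "q \<theta> = (1 / 2) *\<^sub>R (p \<theta> + cnj (p (refl_torus \<theta>)))" for \<theta>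
  have q: "real_trig_poly q" unfolding q_def by (rule trig_poly_real_part[OF p])
  have fpm: "bdd_meas (\<lambda>\<theta>. (norm (f \<theta> - p \<theta>))\<^sup>2)"
    by (intro bdd_meas_norm_power bdd_meas_diff f trig_poly_bdd_meas p)
  then have fpm': "bdd_meas (\<lambda>\<theta>. (norm (f (refl_torus \<theta>) - p (refl_torus \<theta>)))\<^sup>2)"
    using measurable_compose[OF refl_torus_measurable bdd_meas_measurable[OF fpm]]
    by (elim bdd_measE) (rule bdd_measI)
  have "(\<integral>\<theta>. (norm (f \<theta> - q \<theta>))\<^sup>2 \<partial>torus_measure)
      \<le> (\<integral>\<theta>. 1 / 2 * (norm (f \<theta> - p \<theta>))\<^sup>2 + 1 / 2 * (norm (f (refl_torus \<theta>) - p (refl_torus \<theta>)))\<^sup>2 \<partial>torus_measure)"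
  proof (rule integral_mono)
    fix \<theta>
    let ?a = "f \<theta> - p \<theta>" and ?b = "f (refl_torus \<theta>) - p (refl_torus \<theta>)"
    have "f \<theta> - q \<theta> = (1 / 2) *\<^sub>R (?a + cnj ?b)"
      using sym[of \<theta>] by (simp add: q_def scaleR_diff_right scaleR_add_right flip: scaleR_left_distrib)
    then have "(norm (f \<theta> - q \<theta>))\<^sup>2 = 1 / 4 * (norm (?a + cnj ?b))\<^sup>2"
      by (simp add: power_divide)
    also have "\<dots> \<le> 1 / 4 * (2 * (norm ?a)\<^sup>2 + 2 * (norm (cnj ?b))\<^sup>2)"
      by (intro mult_left_mono norm_add_square_le) simp
    finally show "(norm (f \<theta> - q \<theta>))\<^sup>2 \<le> 1 / 2 * (norm ?a)\<^sup>2 + 1 / 2 * (norm ?b)\<^sup>2"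
      by (simp only: complex_mod_cnj) simp
  next
    show "integrable torus_measure (\<lambda>\<theta>. (norm (f \<theta> - q \<theta>))\<^sup>2)"
      by (intro bdd_meas_integrable bdd_meas_norm_power bdd_meas_diff f trig_poly_bdd_meas
          real_trig_poly_imp_trig_poly q)
  qed (use bdd_meas_integrable[OF fpm] bdd_meas_integrable[OF fpm'] in auto)
  also have "\<dots> = 1 / 2 * (\<integral>\<theta>. (norm (f \<theta> - p \<theta>))\<^sup>2 \<partial>torus_measure)
      + 1 / 2 * (\<integral>\<theta>. (norm (f (refl_torus \<theta>) - p (refl_torus \<theta>)))\<^sup>2 \<partial>torus_measure)"
    using bdd_meas_integrable[OF fpm] bdd_meas_integrable[OF fpm']
    by (subst Bochner_Integration.integral_add) auto
  also have "\<dots> = (\<integral>\<theta>. (norm (f \<theta> - p \<theta>))\<^sup>2 \<partial>torus_measure)"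
    using integral_refl_torus[OF bdd_meas_measurable[OF fpm]] by simp
  also note fp
  finally show ?thesis using that q by blast
qed

section \<open>Gaussian laws and characteristic functions\<close>

definition centered_gaussian :: "real \<Rightarrow> real measure" where
  "centered_gaussian V =
     (if V = 0 then return borel 0 else density lborel (normal_density 0 (sqrt V)))"

lemma centered_gaussian_real_distribution:
  assumes "0 \<le> V" shows "real_distribution (centered_gaussian V)"
  using assms prob_space_normal_density[of "sqrt V" 0] prob_space_return[of "0 :: real" borel]
  by (auto simp: centered_gaussian_def real_distribution_def real_distribution_axioms_def)

lemma centered_gaussian_law: "0 \<le> V \<Longrightarrow> gaussian_law (centered_gaussian V)"
  unfolding gaussian_law_def centered_gaussian_def by (metis real_sqrt_gt_zero less_eq_real_def)

lemma char_centered_gaussian: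
  assumes "0 \<le> V"
  shows "char (centered_gaussian V) u = complex_of_real (exp (- (u\<^sup>2 * V) / 2))"
proof (cases "V = 0")
  case True
  then show ?thesis by (simp add: centered_gaussian_def char_def integral_return)
next
  case False
  with assms have s: "0 < sqrt V" by simp
  interpret std: prob_space std_normal_distribution
    using real_dist_normal_dist by (simp add: real_distribution_def)
  have "distributed std_normal_distribution lborel (\<lambda>x. x) std_normal_density"
    by (auto simp: distributed_def distr_id2)
  then have "distributed std_normal_distribution lborel (\<lambda>x. 0 + sqrt V * x)
      (normal_density (0 + sqrt V * 0) (\<bar>sqrt V\<bar> * 1))"
    by (rule std.normal_density_affine) (use s in auto)
  then have "centered_gaussian V = distr std_normal_distribution lborel (\<lambda>x. sqrt V * x)"
    using s assms False by (simp add: distributed_def centered_gaussian_def)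
  then have "char (centered_gaussian V) u = (CLINT x|std_normal_distribution. iexp (u * (sqrt V * x)))"
    by (simp add: char_def integral_distr)
  also have "\<dots> = char std_normal_distribution (u * sqrt V)"
    by (simp add: char_def mult.assoc)
  also have "\<dots> = complex_of_real (exp (- (u\<^sup>2 * V) / 2))"
    using assms by (simp add: char_std_normal_distribution power_mult_distrib)
  finally show ?thesis .
qed

lemma centered_gaussian_moments:
  assumes "0 \<le> V"
  shows "integrable (centered_gaussian V) (\<lambda>x. x)" "(\<integral>x. x \<partial>centered_gaussian V) = 0"
    "integrable (centered_gaussian V) (\<lambda>x. x\<^sup>2)" "(\<integral>x. x\<^sup>2 \<partial>centered_gaussian V) = V"
proof -
  have "integrable (centered_gaussian V) (\<lambda>x. x) \<and> (\<integral>x. x \<partial>centered_gaussian V) = 0 \<and>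
    integrable (centered_gaussian V) (\<lambda>x. x\<^sup>2) \<and> (\<integral>x. x\<^sup>2 \<partial>centered_gaussian V) = V"
  proof (cases "V = 0")
    case True
    interpret prob_space "return borel (0 :: real)" by (rule prob_space_return) simp
    have ae: "AE x in return borel (0 :: real). x = 0" by (subst AE_return) auto
    have int: "integrable (return borel (0 :: real)) f" if "f \<in> borel_measurable borel" "f 0 = 0"
      for f :: "real \<Rightarrow> real"
    proof (rule integrable_const_bound[where B = 0])
      show "AE x in return borel 0. norm (f x) \<le> 0" using ae by eventually_elim (use that in simp)
    qed (use that in simp)
    have "integrable (return borel (0 :: real)) (\<lambda>x. x)" "integrable (return borel (0 :: real)) (\<lambda>x. x\<^sup>2)"
      by (rule int; simp)+
    moreover have "(\<integral>x. x \<partial>return borel 0) = (0 :: real)" "(\<integral>x. x\<^sup>2 \<partial>return borel 0) = (0 :: real)"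
      by (subst integral_return; simp)+
    moreover have "centered_gaussian V = return borel 0" using True by (simp add: centered_gaussian_def)
    ultimately show ?thesis using True by (simp only: simp_thms)
  next
    case False
    with assms have s: "0 < sqrt V" by simp
    have nn: "AE x in lborel. 0 \<le> normal_density 0 (sqrt V) x" by simp
    have 1: "integrable lborel (\<lambda>x. normal_density 0 (sqrt V) x * x)"
      "(\<integral>x. normal_density 0 (sqrt V) x * x \<partial>lborel) = 0"
      using integrable_normal_moment_nz_1[OF s, of 0] integral_normal_moment_nz_1[OF s, of 0] by auto
    have 2: "integrable lborel (\<lambda>x. normal_density 0 (sqrt V) x * x\<^sup>2)"
      "(\<integral>x. normal_density 0 (sqrt V) x * x\<^sup>2 \<partial>lborel) = V"
      using integrable_normal_moment[OF s, of 0 2] integral_normal_moment_even[OF s, of 0 1] s assms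
      by (auto simp: fact_numeral)
    show ?thesis
      using False 1 2 nn by (simp add: centered_gaussian_def integral_density integrable_density)
  qed
  then show "integrable (centered_gaussian V) (\<lambda>x. x)" "(\<integral>x. x \<partial>centered_gaussian V) = 0"
    "integrable (centered_gaussian V) (\<lambda>x. x\<^sup>2)" "(\<integral>x. x\<^sup>2 \<partial>centered_gaussian V) = V" by auto
qed

lemma gaussian_law_centered:
  assumes "gaussian_law N" "(\<integral>x. x \<partial>N) = 0" shows "N = centered_gaussian (\<integral>x. x\<^sup>2 \<partial>N)"
  using assms(1) unfolding gaussian_law_def
proof safe
  fix \<mu> assume N: "N = return borel \<mu>"
  then have "\<mu> = 0" using assms(2) by (simp add: integral_return)
  then show "return borel \<mu> = centered_gaussian (\<integral>x. x\<^sup>2 \<partial>return borel \<mu>)"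
    by (simp add: integral_return centered_gaussian_def)
next
  fix \<mu> \<sigma> :: real assume s: "0 < \<sigma>" and N: "N = density lborel (normal_density \<mu> \<sigma>)"
  have nn: "AE x in lborel. 0 \<le> normal_density \<mu> \<sigma> x" by simp
  have "\<mu> = 0"
    using assms(2) integral_normal_moment_nz_1[OF s, of \<mu>] nn unfolding N by (simp add: integral_density)
  moreover have "(\<integral>x. x\<^sup>2 \<partial>density lborel (normal_density 0 \<sigma>)) = \<sigma>\<^sup>2"
    using integral_normal_moment_even[OF s, of 0 1] s by (simp add: integral_density fact_numeral)
  ultimately show "density lborel (normal_density \<mu> \<sigma>)
      = centered_gaussian (\<integral>x. x\<^sup>2 \<partial>density lborel (normal_density \<mu> \<sigma>))"
    using s by (simp add: centered_gaussian_def)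
qed

lemma (in prob_space) centered_gaussian_limit:
  fixes X :: "nat \<Rightarrow> 'a \<Rightarrow> real"
  assumes X: "\<And>n. X n \<in> borel_measurable M" and Y: "Y \<in> borel_measurable M"
    and lim: "AE x in M. (\<lambda>n. X n x) \<longlonglongrightarrow> Y x"
    and law: "\<And>n. distr M borel (X n) = centered_gaussian (V n)" and V: "\<And>n. 0 \<le> V n" "V \<longlonglongrightarrow> W"
  shows "distr M borel Y = centered_gaussian W"
proof -
  have W: "0 \<le> W" using V by (intro LIMSEQ_le_const) auto
  have ch: "char (distr M borel Z) u = (CLINT x|M. iexp (u * Z x))" if "Z \<in> borel_measurable M" for Z u
    unfolding char_def using that by (subst integral_distr) auto
  show ?thesis
  proof (rule Levy_uniqueness)
    show "real_distribution (distr M borel Y)" using Y by (rule real_distribution_distr)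
    show "real_distribution (centered_gaussian W)" by (rule centered_gaussian_real_distribution[OF W])
    show "char (distr M borel Y) = char (centered_gaussian W)"
    proof
      fix u
      have "(\<lambda>n. CLINT x|M. iexp (u * X n x)) \<longlonglongrightarrow> (CLINT x|M. iexp (u * Y x))"
      proof (rule integral_dominated_convergence[where w = "\<lambda>_. 1"])
        show "AE x in M. (\<lambda>n. iexp (u * X n x)) \<longlonglongrightarrow> iexp (u * Y x)"
          using lim by eventually_elim (intro tendsto_intros)
      qed (use X Y in auto)
      then have "(\<lambda>n. char (distr M borel (X n)) u) \<longlonglongrightarrow> char (distr M borel Y) u"
        by (simp only: ch[OF X] ch[OF Y])
      then have "(\<lambda>n. complex_of_real (exp (- (u\<^sup>2 * V n) / 2))) \<longlonglongrightarrow> char (distr M borel Y) u"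
        by (simp only: law char_centered_gaussian[OF V(1)])
      moreover have "(\<lambda>n. complex_of_real (exp (- (u\<^sup>2 * V n) / 2))) \<longlonglongrightarrow> complex_of_real (exp (- (u\<^sup>2 * W) / 2))"
        by (intro tendsto_intros V) auto
      ultimately show "char (distr M borel Y) u = char (centered_gaussian W) u"
        unfolding char_centered_gaussian[OF W] by (rule LIMSEQ_unique)
    qed
  qed
qed

text \<open>The one-dimensional uniqueness theorem, applied to the law of \<open>X\<close> under the measure with
  density \<open>w\<close>.\<close>

lemma weighted_char_uniqueness:
  fixes X w :: "'a \<Rightarrow> real"
  assumes M: "prob_space M" and N: "prob_space N"
    and X: "X \<in> borel_measurable M" "X \<in> borel_measurable N"
    and w: "w \<in> borel_measurable M" "w \<in> borel_measurable N" "\<And>x. 0 \<le> w x" "\<And>x. w x \<le> B"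
    and eq: "\<And>v. (CLINT x|M. w x *\<^sub>R cis (v * X x)) = (CLINT x|N. w x *\<^sub>R cis (v * X x))"
    and A: "A \<in> sets borel"
  shows "(\<integral>x. w x * indicat_real A (X x) \<partial>M) = (\<integral>x. w x * indicat_real A (X x) \<partial>N)"
proof -
  have int: "integrable P w" if "prob_space P" "w \<in> borel_measurable P" for P
    using that w(3,4) by (intro finite_measure.integrable_const_bound[of P w B]) (auto simp: prob_space_def)
  define c where "c = (\<integral>x. w x \<partial>M)"
  have "complex_of_real (\<integral>x. w x \<partial>M) = complex_of_real (\<integral>x. w x \<partial>N)"
    using eq[of 0] by (simp add: scaleR_conv_of_real)
  then have cN: "c = (\<integral>x. w x \<partial>N)" by (simp add: c_def)
  show ?thesis
  proof (cases "c = 0")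
    case True
    have "(\<integral>x. w x * indicat_real A (X x) \<partial>P) = 0" if "prob_space P" "w \<in> borel_measurable P" "(\<integral>x. w x \<partial>P) = 0" for P
    proof -
      have "AE x in P. w x = 0" using integral_nonneg_eq_0_iff_AE[OF int[OF that(1,2)]] w(3) that(3) by simp
      then have "AE x in P. w x * indicat_real A (X x) = 0" by eventually_elim simp
      then show ?thesis by (rule integral_eq_zero_AE)
    qed
    then show ?thesis using M N w True c_def cN by simp
  next
    case False
    moreover have "0 \<le> c" unfolding c_def by (intro integral_nonneg_AE) (use w in auto)
    ultimately have c: "0 < c" by simp
    define D where "D P = distr (density P (\<lambda>x. w x / c)) borel X" for P
    have D: "real_distribution (D P)" "char (D P) = (\<lambda>v. (1 / c) *\<^sub>R (CLINT x|P. w x *\<^sub>R cis (v * X x)))"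
      "(\<integral>x. w x * indicat_real A (X x) \<partial>P) = c * measure (D P) A"
      if P: "prob_space P" "w \<in> borel_measurable P" "X \<in> borel_measurable P" "(\<integral>x. w x \<partial>P) = c" for P
    proof -
      have nn: "AE x in P. 0 \<le> w x / c" using w(3) c by simp
      have m: "X \<in> borel_measurable (density P (\<lambda>x. w x / c))" using P by simp
      have "emeasure (density P (\<lambda>x. w x / c)) (space P) = ennreal (\<integral>x. w x / c \<partial>P)"
        using int[OF P(1,2)] nn P by (simp add: emeasure_density nn_integral_eq_integral cong: nn_integral_cong)
      also have "\<dots> = 1" using P(4) c by simp
      finally have "prob_space (density P (\<lambda>x. w x / c))" by (intro prob_spaceI) simp
      then show "real_distribution (D P)"
        unfolding D_def using m by (rule prob_space.real_distribution_distr)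
      show "char (D P) = (\<lambda>v. (1 / c) *\<^sub>R (CLINT x|P. w x *\<^sub>R cis (v * X x)))"
      proof
        fix v
        have "char (D P) v = (CLINT x|P. (w x / c) *\<^sub>R iexp (v * X x))"
          unfolding D_def char_def using P nn m by (subst integral_distr) (auto simp: integral_density)
        also have "\<dots> = (CLINT x|P. (1 / c) *\<^sub>R (w x *\<^sub>R cis (v * X x)))"
          by (intro Bochner_Integration.integral_cong refl) (simp add: cis_conv_exp divide_inverse_commute)
        finally show "char (D P) v = (1 / c) *\<^sub>R (CLINT x|P. w x *\<^sub>R cis (v * X x))"
          by (simp only: integral_scaleR_right)
      qed
      have "measure (D P) A = (\<integral>x. indicat_real A x \<partial>D P)"
        using A by (simp add: D_def)
      also have "\<dots> = (\<integral>x. (w x / c) * indicat_real A (X x) \<partial>P)"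
        unfolding D_def using P nn m A by (subst integral_distr) (auto simp: integral_density)
      finally show "(\<integral>x. w x * indicat_real A (X x) \<partial>P) = c * measure (D P) A" using c by simp
    qed
    note DM = D[OF M w(1) X(1) c_def[symmetric]] and DN = D[OF N w(2) X(2) cN[symmetric]]
    have "D M = D N" by (rule Levy_uniqueness[OF DM(1) DN(1)]) (simp add: DM(2) DN(2) eq)
    then show ?thesis using DM(3) DN(3) by simp
  qed
qed

text \<open>The factors \<open>exp (i u X)\<close> are replaced one at a time by indicators of Borel sets; the
  positive weights \<open>1 + cos\<close> and \<open>1 + sin\<close> carry the factors not yet replaced.\<close>

lemma joint_char_uniqueness:
  fixes X :: "'k \<Rightarrow> 'a \<Rightarrow> real"
  assumes M: "prob_space M" and N: "prob_space N" and K: "finite K"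
    and X: "\<And>k. X k \<in> borel_measurable M" "\<And>k. X k \<in> borel_measurable N"
    and eq: "\<And>u. (CLINT x|M. cis (\<Sum>k\<in>K. u k * X k x)) = (CLINT x|N. cis (\<Sum>k\<in>K. u k * X k x))"
    and A: "\<And>k. A k \<in> sets borel"
  shows "(\<integral>x. (\<Prod>k\<in>K. indicat_real (A k) (X k x)) \<partial>M) = (\<integral>x. (\<Prod>k\<in>K. indicat_real (A k) (X k x)) \<partial>N)"
proof -
  define e where "e u x = cis (\<Sum>k\<in>K. u k * X k x)" for u x
  define g where "g I x = (\<Prod>k\<in>I. indicat_real (A k) (X k x))" for I x
  have e_add: "e (\<lambda>k. u k + v k) x = e u x * e v x" for u v x
    by (simp add: e_def cis_mult distrib_right sum.distrib)
  have e_minus: "e (\<lambda>k. - u k) x = cnj (e u x)" for u x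
    by (simp add: e_def cis_cnj sum_negf)
  have g01: "0 \<le> g I x" "g I x \<le> 1" for I x
    unfolding g_def by (auto intro!: prod_nonneg prod_le_1)
  have me: "e u \<in> borel_measurable P" and mg: "g I \<in> borel_measurable P"
    if "\<And>k. X k \<in> borel_measurable P" for P u I
  proof -
    note [measurable] = that A
    show "e u \<in> borel_measurable P" unfolding e_def cis_conv_exp by measurable
    show "g I \<in> borel_measurable P" unfolding g_def by measurable
  qed
  have ige: "integrable P (\<lambda>x. g I x *\<^sub>R e u x)"
    if "prob_space P" "\<And>k. X k \<in> borel_measurable P" for P u I
  proof (rule finite_measure.integrable_const_bound[of P _ 1])
    show "AE x in P. norm (g I x *\<^sub>R e u x) \<le> 1" using g01 by (simp add: e_def)
    show "(\<lambda>x. g I x *\<^sub>R e u x) \<in> borel_measurable P"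
      by (intro borel_measurable_scaleR me mg that)
  qed (use that(1) in \<open>simp add: prob_space_def\<close>)
  have main: "(CLINT x|M. g I x *\<^sub>R e u x) = (CLINT x|N. g I x *\<^sub>R e u x)" if "finite I" "I \<subseteq> K" for I u
    using that
  proof (induction I arbitrary: u rule: finite_induct)
    case empty
    then show ?case using eq by (simp add: g_def e_def)
  next
    case (insert j I)
    have j: "j \<in> K" and IH: "\<And>u. (CLINT x|M. g I x *\<^sub>R e u x) = (CLINT x|N. g I x *\<^sub>R e u x)"
      using insert by auto
    define \<delta> where "\<delta> v k = (if k = j then v else 0 :: real)" for v k
    have e\<delta>: "cis (v * X j x) = e (\<delta> v) x" for v x
      using j K by (simp add: e_def \<delta>_def if_distribR if_distrib cong: if_cong)
    have pull: "(CLINT x|P. a *\<^sub>R (g I x *\<^sub>R e (\<delta> v) x) + b * (g I x *\<^sub>R e (\<lambda>k. u k + \<delta> v k) x)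
          + c * (g I x *\<^sub>R e (\<lambda>k. - u k + \<delta> v k) x))
        = a *\<^sub>R (CLINT x|P. g I x *\<^sub>R e (\<delta> v) x) + b * (CLINT x|P. g I x *\<^sub>R e (\<lambda>k. u k + \<delta> v k) x)
          + c * (CLINT x|P. g I x *\<^sub>R e (\<lambda>k. - u k + \<delta> v k) x)"
      if P: "prob_space P" "\<And>k. X k \<in> borel_measurable P" for P a b c v
    proof -
      have "(CLINT x|P. a *\<^sub>R f x + b * f' x + c * f'' x) =
          a *\<^sub>R (CLINT x|P. f x) + b * (CLINT x|P. f' x) + c * (CLINT x|P. f'' x)"
        if "integrable P f" "integrable P f'" "integrable P f''" for f f' f'' :: "'a \<Rightarrow> complex"
        using that by simp
      from this[OF ige[OF P] ige[OF P] ige[OF P]] show ?thesis .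
    qed
    have step: "(\<integral>x. w x * indicat_real (A j) (X j x) \<partial>M) = (\<integral>x. w x * indicat_real (A j) (X j x) \<partial>N)"
      if w: "w = (\<lambda>x. g I x * (a + Re (b * e u x) + Re (c * cnj (e u x))))"
        and nn: "\<And>x. 0 \<le> a + Re (b * e u x) + Re (c * cnj (e u x))"
          "\<And>x. a + Re (b * e u x) + Re (c * cnj (e u x)) \<le> 2"
        and real: "\<And>x. b * e u x + c * cnj (e u x) \<in> \<real>" for w a b c
    proof (rule weighted_char_uniqueness[OF M N X, where B = 2])
      show "w \<in> borel_measurable M" "w \<in> borel_measurable N"
      proof -
        note [measurable] = mg[OF X(1)] mg[OF X(2)] me[OF X(1)] me[OF X(2)]
        show "w \<in> borel_measurable M" unfolding w e_minus[symmetric] by measurable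
        show "w \<in> borel_measurable N" unfolding w e_minus[symmetric] by measurable
      qed
      show "0 \<le> w x" for x unfolding w using g01 nn by simp
      show "w x \<le> 2" for x
        unfolding w using mult_mono[OF g01(2) nn(2) _ nn(1)] by (simp add: g01)
      fix v
      have "w x *\<^sub>R cis (v * X j x) = a *\<^sub>R (g I x *\<^sub>R e (\<delta> v) x) + b * (g I x *\<^sub>R e (\<lambda>k. u k + \<delta> v k) x)
          + c * (g I x *\<^sub>R e (\<lambda>k. - u k + \<delta> v k) x)" for x
      proof -
        have "complex_of_real (Re (b * e u x) + Re (c * cnj (e u x))) = b * e u x + c * cnj (e u x)"
          using real[of x] by (metis of_real_Re plus_complex.sel(1))
        then have "complex_of_real (w x) = g I x * (a + (b * e u x + c * cnj (e u x)))"
          unfolding w by (simp add: add.assoc del: of_real_add flip: of_real_add[of a])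
            (metis (no_types, lifting) add.assoc of_real_add)
        moreover have "e (\<lambda>k. - u k + \<delta> v k) x = cnj (e u x) * e (\<delta> v) x"
          using e_add[of "\<lambda>k. - u k" "\<delta> v" x] by (simp only: e_minus)
        ultimately show ?thesis
          by (simp only: scaleR_conv_of_real e\<delta> e_add) (simp only: algebra_simps)
      qed
      then show "(CLINT x|M. w x *\<^sub>R cis (v * X j x)) = (CLINT x|N. w x *\<^sub>R cis (v * X j x))"
        by (simp only: pull[OF M X(1)] pull[OF N X(2)] IH)
    qed fact
    have Rb: "\<bar>Re (e u x)\<bar> \<le> 1" "\<bar>Im (e u x)\<bar> \<le> 1" for x by (simp_all add: e_def)
    have Rp: "0 \<le> Re (e u x) + 1" "0 \<le> Im (e u x) + 1" for x using Rb[of x] by linarith+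
    have c1: "(\<integral>x. g I x * (1 + Re (e u x)) * indicat_real (A j) (X j x) \<partial>M) = (\<integral>x. g I x * (1 + Re (e u x)) * indicat_real (A j) (X j x) \<partial>N)"
      by (rule step[where a = 1 and b = "1/2" and c = "1/2"])
        (use Rb Rp in \<open>auto simp: complex_is_Real_iff abs_le_iff add.commute\<close>)
    have c2: "(\<integral>x. g I x * (1 + Im (e u x)) * indicat_real (A j) (X j x) \<partial>M) = (\<integral>x. g I x * (1 + Im (e u x)) * indicat_real (A j) (X j x) \<partial>N)"
      by (rule step[where a = 1 and b = "- \<i>/2" and c = "\<i>/2"])
        (use Rb Rp in \<open>auto simp: complex_is_Real_iff abs_le_iff add.commute\<close>)
    have c0: "(\<integral>x. g I x * indicat_real (A j) (X j x) \<partial>M) = (\<integral>x. g I x * indicat_real (A j) (X j x) \<partial>N)"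
      by (rule step[where a = 1 and b = 0 and c = 0]) auto
    have fin: "(CLINT x|P. g (insert j I) x *\<^sub>R e u x) =
        ((\<integral>x. g I x * (1 + Re (e u x)) * indicat_real (A j) (X j x) \<partial>P) - (\<integral>x. g I x * indicat_real (A j) (X j x) \<partial>P))
        + \<i> * ((\<integral>x. g I x * (1 + Im (e u x)) * indicat_real (A j) (X j x) \<partial>P) - (\<integral>x. g I x * indicat_real (A j) (X j x) \<partial>P))"
      if P: "prob_space P" "\<And>k. X k \<in> borel_measurable P" for P
    proof -
      note [measurable] = P(2) A me[OF P(2)] mg[OF P(2)]
      have bd: "integrable P f" if "f \<in> borel_measurable P" "\<And>x. norm (f x) \<le> 2" for f :: "_ \<Rightarrow> real"
        using that P(1) by (intro finite_measure.integrable_const_bound[of P _ 2]) (auto simp: prob_space_def)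
      have ind: "\<bar>g I x * r * indicat_real (A j) (X j x)\<bar> \<le> 2" if "\<bar>r\<bar> \<le> 2" for x r
      proof -
        have "\<bar>g I x * r * indicat_real (A j) (X j x)\<bar> \<le> 1 * 2 * 1"
          unfolding abs_mult using that g01 by (intro mult_mono) (auto simp: indicator_def)
        then show ?thesis by simp
      qed
      have i1: "integrable P (\<lambda>x. g I x * (1 + Re (e u x)) * indicat_real (A j) (X j x))"
      proof (rule bd)
        fix x
        have "\<bar>1 + Re (e u x)\<bar> \<le> 2" using Rb[of x] by linarith
        from ind[OF this, of x] show "norm (g I x * (1 + Re (e u x)) * indicat_real (A j) (X j x)) \<le> 2"
          by (simp only: real_norm_def)
      qed measurable
      have i2: "integrable P (\<lambda>x. g I x * (1 + Im (e u x)) * indicat_real (A j) (X j x))"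
      proof (rule bd)
        fix x
        have "\<bar>1 + Im (e u x)\<bar> \<le> 2" using Rb[of x] by linarith
        from ind[OF this, of x] show "norm (g I x * (1 + Im (e u x)) * indicat_real (A j) (X j x)) \<le> 2"
          by (simp only: real_norm_def)
      qed measurable
      have i0: "integrable P (\<lambda>x. g I x * indicat_real (A j) (X j x))"
        using ind[of 1] by (intro bd) auto
      have "g (insert j I) x *\<^sub>R e u x
        = complex_of_real (g I x * (1 + Re (e u x)) * indicat_real (A j) (X j x) - g I x * indicat_real (A j) (X j x))
        + \<i> * complex_of_real (g I x * (1 + Im (e u x)) * indicat_real (A j) (X j x) - g I x * indicat_real (A j) (X j x))" for x
      proof -
        have "g (insert j I) x = g I x * indicat_real (A j) (X j x)"
          using insert(1,2) by (simp add: g_def)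
        then show ?thesis by (simp add: complex_eq_iff algebra_simps)
      qed
      then show ?thesis using i0 i1 i2 by (simp del: of_real_diff of_real_add of_real_mult)
    qed
    show ?case using c0 c1 c2 by (simp only: fin[OF M X(1)] fin[OF N X(2)])
  qed
  from main[OF K order_refl, of "\<lambda>_. 0"]
  have "complex_of_real (\<integral>x. g K x \<partial>M) = complex_of_real (\<integral>x. g K x \<partial>N)"
    by (simp add: e_def scaleR_conv_of_real)
  then show ?thesis by (simp add: g_def)
qed

lemma measurable_field_component:
  "(\<lambda>z. z t $ i) \<in> borel_measurable (field_space :: (int ^ 'd \<Rightarrow> real ^ 'n) measure)"
proof -
  have "(\<lambda>z. z t) \<in> field_space \<rightarrow>\<^sub>M (borel :: (real ^ 'n) measure)"
    unfolding field_space_def by (rule measurable_component_singleton) simp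
  then show ?thesis by (rule measurable_compose) simp
qed

lemma space_field_space [simp]: "space field_space = UNIV"
  by (simp add: field_space_def space_PiM)

lemma measurable_field_spaceI:
  fixes f :: "'a \<Rightarrow> int ^ 'd \<Rightarrow> real ^ 'n"
  assumes "\<And>t i. (\<lambda>x. f x t $ i) \<in> borel_measurable M"
  shows "f \<in> M \<rightarrow>\<^sub>M field_space"
  unfolding field_space_def
proof (rule measurable_PiM_single')
  fix t
  have "(\<lambda>x. f x t \<bullet> b) \<in> borel_measurable M" if "b \<in> Basis" for b
    using that assms by (auto simp: Basis_vec_def inner_axis)
  then show "(\<lambda>x. f x t) \<in> borel_measurable M"
    by (subst borel_measurable_euclidean_space) auto
qed auto

lemma field_law_eqI:
  fixes p q :: "(int ^ 'd \<Rightarrow> real ^ 'n) measure"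
  assumes p: "prob_space p" "sets p = sets field_space" and q: "prob_space q" "sets q = sets field_space"
    and eq: "\<And>K u. finite K \<Longrightarrow> distr p borel (\<lambda>z. \<Sum>k\<in>K. u k * z (fst k) $ snd k)
      = distr q borel (\<lambda>z. \<Sum>k\<in>K. u k * z (fst k) $ snd k)"
  shows "p = q"
proof -
  define F :: "((int ^ 'd) \<times> 'n \<Rightarrow> real) measure" where "F = (\<Pi>\<^sub>M k\<in>UNIV. borel)"
  define \<phi> :: "(int ^ 'd \<Rightarrow> real ^ 'n) \<Rightarrow> (int ^ 'd) \<times> 'n \<Rightarrow> real" where "\<phi> z k = z (fst k) $ snd k" for z k
  define \<psi> :: "((int ^ 'd) \<times> 'n \<Rightarrow> real) \<Rightarrow> int ^ 'd \<Rightarrow> real ^ 'n" where "\<psi> w t = (\<chi> i. w (t, i))" for w t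
  have comp: "(\<lambda>z. z t $ i) \<in> borel_measurable r" if "sets r = sets field_space" for r :: "(int ^ 'd \<Rightarrow> real ^ 'n) measure" and t i
    using measurable_field_component by (simp add: measurable_cong_sets[OF that refl])
  have \<phi>m: "\<phi> \<in> r \<rightarrow>\<^sub>M F" if "sets r = sets field_space" for r
    unfolding F_def \<phi>_def using comp[OF that] by (intro measurable_PiM_single') auto
  have \<psi>m: "\<psi> \<in> F \<rightarrow>\<^sub>M field_space"
    by (rule measurable_field_spaceI) (simp add: \<psi>_def F_def)
  have \<psi>\<phi>: "\<psi> (\<phi> z) = z" for z by (simp add: \<psi>_def \<phi>_def fun_eq_iff vec_eq_iff)
  have retract: "distr (distr r F \<phi>) field_space \<psi> = r" if "sets r = sets field_space" for r
    using that by (subst distr_distr[OF \<psi>m \<phi>m[OF that]]) (simp add: o_def \<psi>\<phi> distr_id2)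
  have "distr p F \<phi> = distr q F \<phi>"
  proof (rule measure_eqI_PiM_infinite)
    show "sets (distr p F \<phi>) = sets (\<Pi>\<^sub>M k\<in>UNIV. borel)" "sets (distr q F \<phi>) = sets (\<Pi>\<^sub>M k\<in>UNIV. borel)"
      by (simp_all add: F_def)
    show "finite_measure (distr p F \<phi>)"
      using p prob_space.prob_space_distr[OF p(1) \<phi>m[OF p(2)]] by (simp add: prob_space_def)
    fix A :: "(int ^ 'd) \<times> 'n \<Rightarrow> real set" and J :: "((int ^ 'd) \<times> 'n) set"
    assume J: "finite J" and A: "\<And>k. k \<in> J \<Longrightarrow> A k \<in> sets borel"
    define A' where "A' k = (if k \<in> J then A k else UNIV)" for k
    have A': "A' k \<in> sets borel" for k using A by (simp add: A'_def)
    have ch: "(CLINT z|r. cis (\<Sum>k\<in>J. u k * \<phi> z k)) = char (distr r borel (\<lambda>z. \<Sum>k\<in>J. u k * z (fst k) $ snd k)) 1"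
      if r: "sets r = sets field_space" for r u
    proof -
      note [measurable] = comp[OF r]
      show ?thesis unfolding char_def by (subst integral_distr) (auto simp: cis_conv_exp \<phi>_def)
    qed
    have "(\<integral>z. (\<Prod>k\<in>J. indicat_real (A' k) (\<phi> z k)) \<partial>p) = (\<integral>z. (\<Prod>k\<in>J. indicat_real (A' k) (\<phi> z k)) \<partial>q)"
      using comp[OF p(2)] comp[OF q(2)]
      by (intro joint_char_uniqueness[OF p(1) q(1) J _ _ _ A'])
        (auto simp: \<phi>_def eq[OF J] ch[OF p(2), unfolded \<phi>_def] ch[OF q(2), unfolded \<phi>_def])
    moreover have m: "(\<integral>z. (\<Prod>k\<in>J. indicat_real (A' k) (\<phi> z k)) \<partial>r) =
        measure (distr r F \<phi>) (prod_emb UNIV (\<lambda>_. borel) J (Pi\<^sub>E J A))"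
      if r: "prob_space r" "sets r = sets field_space" for r
    proof -
      let ?E = "prod_emb UNIV (\<lambda>_. borel) J (Pi\<^sub>E J A) :: ((int ^ 'd) \<times> 'n \<Rightarrow> real) set"
      have E: "?E \<in> sets F" unfolding F_def using J A by (intro sets_PiM_I) auto
      have "(\<Prod>k\<in>J. indicat_real (A' k) (\<phi> z k)) = indicat_real ?E (\<phi> z)" for z
      proof -
        have "\<phi> z \<in> ?E \<longleftrightarrow> (\<forall>k\<in>J. \<phi> z k \<in> A' k)"
          by (auto simp: prod_emb_def A'_def PiE_iff)
        then show ?thesis using J by (auto simp: indicator_def prod_zero_iff intro!: prod.neutral)
      qed
      then have "(\<integral>z. (\<Prod>k\<in>J. indicat_real (A' k) (\<phi> z k)) \<partial>r) = (\<integral>w. indicat_real ?E w \<partial>distr r F \<phi>)"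
        using E \<phi>m[OF r(2)] by (subst integral_distr) auto
      then show ?thesis using E by simp
    qed
    ultimately have "measure (distr p F \<phi>) (prod_emb UNIV (\<lambda>_. borel) J (Pi\<^sub>E J A)) =
        measure (distr q F \<phi>) (prod_emb UNIV (\<lambda>_. borel) J (Pi\<^sub>E J A))"
      by (simp only: m[OF p] m[OF q])
    then show "emeasure (distr p F \<phi>) (prod_emb UNIV (\<lambda>_. borel) J (Pi\<^sub>E J A)) =
        emeasure (distr q F \<phi>) (prod_emb UNIV (\<lambda>_. borel) J (Pi\<^sub>E J A))"
      using prob_space.prob_space_distr[OF p(1) \<phi>m[OF p(2)]] prob_space.prob_space_distr[OF q(1) \<phi>m[OF q(2)]]
      by (simp add: prob_space_def finite_measure.emeasure_eq_measure)
  qed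
  from arg_cong[OF this, of "\<lambda>r. distr r field_space \<psi>"] show ?thesis
    by (simp only: retract[OF p(2)] retract[OF q(2)])
qed

section \<open>Linear filters and their symbols\<close>

lemma axis_zero: "axis k 0 = 0"
  by (simp add: vec_eq_iff axis_def)

lemma norm_axis_eq: "norm (axis k x :: 'a :: real_normed_vector ^ 'n) = norm x"
proof -
  have "(\<Sum>i\<in>UNIV. (norm ((axis k x :: 'a ^ 'n) $ i))\<^sup>2) = (\<Sum>i\<in>UNIV. if i = k then (norm x)\<^sup>2 else 0)"
    by (intro sum.cong) (auto simp: axis_def)
  then show ?thesis by (simp add: norm_vec_def L2_set_def)
qed

lemma bounded_bilinear_matrix_vector:
  "bounded_bilinear ((*v) :: complex ^ 'n ^ 'm \<Rightarrow> complex ^ 'n \<Rightarrow> complex ^ 'm)"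
proof (intro bounded_bilinear.intro exI allI)
  show "norm (A *v v) \<le> norm A * norm v * 1" for A :: "complex ^ 'n ^ 'm" and v
    using op_boundD[OF op_bound_norm] by simp
qed (simp_all add: matrix_vector_mult_add_rdistrib matrix_vector_right_distrib
    matrix_vector_scaleR_left matrix_vector_scaleR_right)

lemma bounded_bilinear_matrix_mult:
  "bounded_bilinear ((**) :: complex ^ 'n ^ 'm \<Rightarrow> complex ^ 'k ^ 'n \<Rightarrow> complex ^ 'k ^ 'm)"
proof (intro bounded_bilinear.intro exI allI)
  show "norm (A ** B) \<le> norm A * norm B * 1" for A :: "complex ^ 'n ^ 'm" and B :: "complex ^ 'k ^ 'n"
    using op_bound_norm_mult[OF op_bound_norm] by simp
qed (simp_all add: matrix_add_ldistrib matrix_mult_scaleR_left matrix_mult_scaleR_right,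
    simp add: vec_eq_iff matrix_matrix_mult_def distrib_right sum.distrib)

lemmas bdd_meas_matrix_vector = bdd_meas_bounded_bilinear[OF bounded_bilinear_matrix_vector]
lemmas bdd_meas_matrix_mult = bdd_meas_bounded_bilinear[OF bounded_bilinear_matrix_mult]

lemma bdd_meas_vec_nth: "bdd_meas f \<Longrightarrow> bdd_meas (\<lambda>\<theta>. f \<theta> $ k)"
  by (rule bdd_meas_bounded_linear[OF bounded_linear_vec_nth])

lemma bounded_linear_axis: "bounded_linear (axis k :: 'a :: real_normed_vector \<Rightarrow> 'a ^ 'n)"
proof (rule bounded_linear_intro)
  show "norm (axis k x :: 'a ^ 'n) \<le> norm x * 1" for x :: 'a
    using norm_axis_eq[of k x] by simp
qed (simp_all add: vec_eq_iff axis_def)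

text \<open>A finite linear functional of the field together with its symbol in the frequency domain;
  the shift by \<open>s\<close> has symbol \<open>exp (- j \<theta> s)\<close>.\<close>

inductive linear_filter :: "((int ^ 'd \<Rightarrow> real ^ 'n) \<Rightarrow> real) \<Rightarrow> (real ^ 'd \<Rightarrow> complex ^ 'n) \<Rightarrow> bool" where
  coordinate: "linear_filter (\<lambda>z. r * z s $ k) (\<lambda>\<theta>. axis k (complex_of_real r * cis (- freq_pairing \<theta> s)))"
| add: "linear_filter l f \<Longrightarrow> linear_filter m g \<Longrightarrow> linear_filter (\<lambda>z. l z + m z) (\<lambda>\<theta>. f \<theta> + g \<theta>)"

lemma linear_filter_zero: "linear_filter (\<lambda>_. 0) (\<lambda>_. 0)"
  using linear_filter.coordinate[of 0 0 undefined] by (simp add: axis_zero)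

lemma linear_filter_scale: "linear_filter l f \<Longrightarrow> linear_filter (\<lambda>z. c * l z) (\<lambda>\<theta>. c *\<^sub>R f \<theta>)"
proof (induction rule: linear_filter.induct)
  case (coordinate r s k)
  have "c *\<^sub>R axis k (complex_of_real r * cis (- freq_pairing \<theta> s)) =
      (axis k (complex_of_real (c * r) * cis (- freq_pairing \<theta> s)) :: complex ^ 'b)" for \<theta> :: "real ^ 'a"
    by (simp add: vec_eq_iff axis_def) (simp add: scaleR_conv_of_real)
  then show ?case using linear_filter.coordinate[of "c * r" s k] by (simp add: mult.assoc)
next
  case (add l f m g)
  from linear_filter.add[OF add.IH] show ?case by (simp add: scaleR_add_right distrib_left)
qed

lemma linear_filter_diff:
  assumes "linear_filter l f" "linear_filter m g"
  shows "linear_filter (\<lambda>z. l z - m z) (\<lambda>\<theta>. f \<theta> - g \<theta>)"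
  using linear_filter.add[OF assms(1) linear_filter_scale[OF assms(2), of "-1"]] by simp

lemma linear_filter_sum:
  "(\<And>i. i \<in> I \<Longrightarrow> linear_filter (l i) (f i)) \<Longrightarrow>
   linear_filter (\<lambda>z. \<Sum>i\<in>I. l i z) (\<lambda>\<theta>. \<Sum>i\<in>I. f i \<theta>)"
  by (induction I rule: infinite_finite_induct) (auto intro: linear_filter_zero linear_filter.add)

lemma linear_filter_coordinate: "linear_filter (\<lambda>z. z s $ k) (\<lambda>\<theta>. axis k (cis (- freq_pairing \<theta> s)))"
  using linear_filter.coordinate[of 1 s k] by simp

lemma linear_filter_shift:
  "linear_filter l f \<Longrightarrow>
   linear_filter (\<lambda>z. l (\<lambda>t. z (t + s))) (\<lambda>\<theta>. cis (- freq_pairing \<theta> s) *s f \<theta>)"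
proof (induction rule: linear_filter.induct)
  case (coordinate r s' k)
  have "cis (- freq_pairing \<theta> s) *s axis k (complex_of_real r * cis (- freq_pairing \<theta> s')) =
      (axis k (complex_of_real r * cis (- freq_pairing \<theta> (s' + s))) :: complex ^ 'b)" for \<theta>
  proof -
    have "cis (- freq_pairing \<theta> (s' + s)) = cis (- freq_pairing \<theta> s) * cis (- freq_pairing \<theta> s')"
      by (simp add: freq_pairing_add cis_mult add.commute)
    then show ?thesis by (auto simp: vec_eq_iff axis_def)
  qed
  then show ?case using linear_filter.coordinate[of r "s' + s" k] by simp
next
  case (add l f m g)
  from linear_filter.add[OF add.IH] show ?case by (simp add: vector_add_ldistrib)
qed

lemma linear_filter_bdd_meas: "linear_filter l f \<Longrightarrow> bdd_meas f"
proof (induction rule: linear_filter.induct)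
  case (coordinate r s k)
  show ?case
    by (intro bdd_meas_bounded_linear[OF bounded_linear_axis] trig_poly_bdd_meas trig_poly.monom)
qed (rule bdd_meas_add)

lemma linear_filter_measurable: "linear_filter l f \<Longrightarrow> l \<in> borel_measurable field_space"
proof (induction rule: linear_filter.induct)
  case (coordinate r s k)
  show ?case by (intro borel_measurable_times measurable_field_component) simp
qed (rule borel_measurable_add)

lemma linear_filter_finite_sum:
  "linear_filter l f \<Longrightarrow> \<exists>T a. finite T \<and> (\<forall>z. l z = (\<Sum>t\<in>T. a t \<bullet> z t))"
proof (induction rule: linear_filter.induct)
  case (coordinate r s k)
  show ?case
    by (rule exI[of _ "{s}"], rule exI[of _ "\<lambda>_. axis k r"]) (simp add: inner_axis')
next
  case (add l f m g)
  then obtain T a U b where T: "finite T" "\<And>z. l z = (\<Sum>t\<in>T. a t \<bullet> z t)"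
    and U: "finite U" "\<And>z. m z = (\<Sum>t\<in>U. b t \<bullet> z t)" by blast
  have "l z + m z = (\<Sum>t\<in>T \<union> U. ((if t \<in> T then a t else 0) + (if t \<in> U then b t else 0)) \<bullet> z t)" for z
  proof -
    have "(\<Sum>t\<in>T \<union> U. (if t \<in> T then a t else 0) \<bullet> z t) = (\<Sum>t\<in>T. a t \<bullet> z t)"
      "(\<Sum>t\<in>T \<union> U. (if t \<in> U then b t else 0) \<bullet> z t) = (\<Sum>t\<in>U. b t \<bullet> z t)"
      using T(1) U(1) by (auto intro!: sum.mono_neutral_cong_right)
    then show ?thesis by (simp add: T U inner_add_left sum.distrib)
  qed
  then show ?case using T(1) U(1) by (intro exI[of _ "T \<union> U"] exI conjI allI) auto
qed

lemma linear_filter_of_finite_sum: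
  assumes "finite T"
  obtains f where "linear_filter (\<lambda>z. \<Sum>t\<in>T. a t \<bullet> z t) f"
proof -
  have "linear_filter (\<lambda>z. \<Sum>t\<in>T. \<Sum>k\<in>UNIV. a t $ k * z t $ k)
      (\<lambda>\<theta>. \<Sum>t\<in>T. \<Sum>k\<in>UNIV. axis k (complex_of_real (a t $ k) * cis (- freq_pairing \<theta> t)))"
    by (intro linear_filter_sum linear_filter.coordinate)
  then show ?thesis using that by (simp add: inner_vec_def)
qed

lemma field_law_eqI_filter:
  fixes p q :: "(int ^ 'd \<Rightarrow> real ^ 'n) measure"
  assumes "prob_space p" "sets p = sets field_space" "prob_space q" "sets q = sets field_space"
    and eq: "\<And>l f. linear_filter l f \<Longrightarrow> distr p borel l = distr q borel l"
  shows "p = q"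
proof (rule field_law_eqI[OF assms(1-4)])
  fix K :: "((int ^ 'd) \<times> 'n) set" and u
  show "distr p borel (\<lambda>z. \<Sum>k\<in>K. u k * z (fst k) $ snd k) = distr q borel (\<lambda>z. \<Sum>k\<in>K. u k * z (fst k) $ snd k)"
    by (rule eq[OF linear_filter_sum[OF linear_filter.coordinate]])
qed

lemma real_trig_poly_filter:
  "real_trig_poly p \<Longrightarrow> \<exists>l. linear_filter l (\<lambda>\<theta>. axis k (p \<theta>))"
proof (induction rule: real_trig_poly.induct)
  case (monom r s)
  then show ?case using linear_filter.coordinate by blast
next
  case (add f g)
  then obtain l m where "linear_filter l (\<lambda>\<theta>. axis k (f \<theta>))" "linear_filter m (\<lambda>\<theta>. axis k (g \<theta>))" by blast
  from linear_filter.add[OF this] show ?case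
    by (auto simp: linear_simps[OF bounded_linear_axis] intro!: exI)
qed

lemma norm_vec_square_sum: "(norm (v :: 'a :: real_normed_vector ^ 'n))\<^sup>2 = (\<Sum>k\<in>UNIV. (norm (v $ k))\<^sup>2)"
  by (simp add: norm_vec_def L2_set_def sum_nonneg)

lemma linear_filter_dense:
  fixes F :: "real ^ 'd \<Rightarrow> complex ^ 'n"
  assumes F: "bdd_meas F" and sym: "\<And>\<theta> k. F (refl_torus \<theta>) $ k = cnj (F \<theta> $ k)" and e: "0 < e"
  obtains l f where "linear_filter l f" "(\<integral>\<theta>. (norm (f \<theta> - F \<theta>))\<^sup>2 \<partial>torus_measure) < e"
proof -
  have "\<exists>p. real_trig_poly p \<and> (\<integral>\<theta>. (norm (F \<theta> $ k - p \<theta>))\<^sup>2 \<partial>torus_measure) < e / CARD('n)" for k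
    using real_trig_poly_dense[OF bdd_meas_vec_nth[OF F] sym, of "e / CARD('n)" k] e by auto
  then have "\<forall>k. \<exists>p. real_trig_poly p \<and> (\<integral>\<theta>. (norm (F \<theta> $ k - p \<theta>))\<^sup>2 \<partial>torus_measure) < e / CARD('n)" ..
  from choice[OF this] obtain p where p: "\<And>k. real_trig_poly (p k)"
    "\<And>k. (\<integral>\<theta>. (norm (F \<theta> $ k - p k \<theta>))\<^sup>2 \<partial>torus_measure) < e / CARD('n)" by blast
  have "\<forall>k. \<exists>l. linear_filter l (\<lambda>\<theta>. axis k (p k \<theta>))"
    using real_trig_poly_filter[OF p(1)] ..
  from choice[OF this] obtain l where l: "\<And>k. linear_filter (l k) (\<lambda>\<theta>. axis k (p k \<theta>))" by blast
  define f where "f \<theta> = (\<Sum>k\<in>UNIV. axis k (p k \<theta>))" for \<theta>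
  have fk: "f \<theta> $ k = p k \<theta>" for \<theta> k
    by (simp add: f_def axis_def if_distrib cong: if_cong)
  have int: "integrable torus_measure (\<lambda>\<theta>. (norm (F \<theta> $ k - p k \<theta>))\<^sup>2)" for k
    by (intro bdd_meas_integrable bdd_meas_norm_power bdd_meas_diff bdd_meas_vec_nth F
        trig_poly_bdd_meas real_trig_poly_imp_trig_poly p)
  have "(\<integral>\<theta>. (norm (f \<theta> - F \<theta>))\<^sup>2 \<partial>torus_measure) = (\<Sum>k\<in>UNIV. \<integral>\<theta>. (norm (F \<theta> $ k - p k \<theta>))\<^sup>2 \<partial>torus_measure)"
    unfolding norm_vec_square_sum using int by (simp add: fk norm_minus_commute)
  also have "\<dots> < (\<Sum>k\<in>(UNIV :: 'n set). e / CARD('n))"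
    by (intro sum_strict_mono p) auto
  finally have "(\<integral>\<theta>. (norm (f \<theta> - F \<theta>))\<^sup>2 \<partial>torus_measure) < e" by simp
  moreover have "linear_filter (\<lambda>z. \<Sum>k\<in>UNIV. l k z) f"
    unfolding f_def[abs_def] by (intro linear_filter_sum l)
  ultimately show ?thesis using that by blast
qed

definition quad_int :: "(real ^ 'd \<Rightarrow> complex ^ 'n ^ 'n) \<Rightarrow> (real ^ 'd \<Rightarrow> complex ^ 'n) \<Rightarrow> real" where
  "quad_int \<Phi> f = (\<integral>\<theta>. f \<theta> \<bullet> (\<Phi> \<theta> *v f \<theta>) \<partial>torus_measure)"

lemma zero_mean_stationary_shift:
  fixes p :: "(int ^ 'd \<Rightarrow> real ^ 'n) measure" and h :: "_ \<Rightarrow> 'b :: {banach, second_countable_topology}"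
  assumes p: "zero_mean_stationary p" and h: "h \<in> borel_measurable field_space"
  shows "(\<integral>z. h (\<lambda>t. z (t + s)) \<partial>p) = (\<integral>z. h z \<partial>p)"
proof -
  have sets: "sets p = sets field_space" and d: "distr p field_space (\<lambda>z t. z (t + s)) = p"
    using p by (auto simp: zero_mean_stationary_def)
  have "(\<lambda>z t. z (t + s)) \<in> p \<rightarrow>\<^sub>M field_space"
    by (rule measurable_field_spaceI) (simp add: measurable_cong_sets[OF sets refl] measurable_field_component)
  from integral_distr[OF this h] show ?thesis by (simp add: d)
qed

lemma (in prob_space) integrable_of_norm_square:
  fixes f :: "'a \<Rightarrow> 'b :: {banach, second_countable_topology}"
  assumes "f \<in> borel_measurable M" "integrable M (\<lambda>x. (norm (f x))\<^sup>2)"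
  shows "integrable M f"
proof (rule Bochner_Integration.integrable_bound[OF _ assms(1)])
  show "integrable M (\<lambda>x. 1 + (norm (f x))\<^sup>2)" using assms(2) by simp
  show "AE x in M. norm (f x) \<le> norm (1 + (norm (f x))\<^sup>2)"
  proof (rule AE_I2)
    fix x
    have "2 * norm (f x) \<le> 1 + (norm (f x))\<^sup>2" using sum_squares_bound[of 1 "norm (f x)"] by simp
    then have "norm (f x) \<le> 1 + (norm (f x))\<^sup>2" using norm_ge_zero[of "f x"] by linarith
    then show "norm (f x) \<le> norm (1 + (norm (f x))\<^sup>2)" by simp
  qed
qed

lemma zero_mean_stationary_integrable:
  fixes p :: "(int ^ 'd \<Rightarrow> real ^ 'n) measure"
  assumes p: "zero_mean_stationary p"
  shows "integrable p (\<lambda>z. z s $ i * z t $ k)" "integrable p (\<lambda>z. z s $ i)" "(\<integral>z. z s $ i \<partial>p) = 0"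
proof -
  have ps: "prob_space p" and sets: "sets p = sets field_space"
    and sq: "\<And>t. integrable p (\<lambda>z. (norm (z t))\<^sup>2)" and mean: "\<And>t. (\<integral>z. z t \<partial>p) = 0"
    using p by (auto simp: zero_mean_stationary_def)
  interpret prob_space p by (rule ps)
  have m: "(\<lambda>z. z t $ i) \<in> borel_measurable p" for t i
    using measurable_field_component by (simp add: measurable_cong_sets[OF sets refl])
  show "integrable p (\<lambda>z. z s $ i * z t $ k)"
  proof (rule Bochner_Integration.integrable_bound)
    show "integrable p (\<lambda>z. (norm (z s))\<^sup>2 + (norm (z t))\<^sup>2)" by (intro Bochner_Integration.integrable_add sq)
    show "AE z in p. norm (z s $ i * z t $ k) \<le> norm ((norm (z s))\<^sup>2 + (norm (z t))\<^sup>2)"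
    proof (rule AE_I2)
      fix z :: "int ^ 'd \<Rightarrow> real ^ 'n"
      have "\<bar>z s $ i\<bar> * \<bar>z t $ k\<bar> \<le> norm (z s) * norm (z t)"
        by (intro mult_mono component_le_norm_cart) auto
      also have "\<dots> \<le> (norm (z s))\<^sup>2 + (norm (z t))\<^sup>2"
        using sum_squares_bound[of "norm (z s)" "norm (z t)"] mult_nonneg_nonneg[of "norm (z s)" "norm (z t)"]
          norm_ge_zero[of "z s"] norm_ge_zero[of "z t"] by linarith
      finally show "norm (z s $ i * z t $ k) \<le> norm ((norm (z s))\<^sup>2 + (norm (z t))\<^sup>2)"
        by (simp add: abs_mult)
    qed
  qed (intro borel_measurable_times m)
  have mv: "(\<lambda>z. z s) \<in> borel_measurable p"
    unfolding measurable_cong_sets[OF sets refl] field_space_def by (rule measurable_component_singleton) simp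
  have iv: "integrable p (\<lambda>z. z s)" by (rule integrable_of_norm_square[OF mv sq])
  show "integrable p (\<lambda>z. z s $ i)" by (rule integrable_bounded_linear[OF bounded_linear_vec_nth iv])
  show "(\<integral>z. z s $ i \<partial>p) = 0" using integral_bounded_linear[OF bounded_linear_vec_nth iv] mean by simp
qed

context
  fixes p :: "(int ^ 'd \<Rightarrow> real ^ 'n) measure" and \<Phi> :: "real ^ 'd \<Rightarrow> complex ^ 'n ^ 'n"
  assumes p: "zero_mean_stationary p" and \<Phi>: "spectral_density p \<Phi>" "bdd_meas \<Phi>"
begin

lemma covariance_coordinates:
  "(\<integral>z. z s $ i * z t $ k \<partial>p) =
   (\<integral>\<theta>. axis i (cis (- freq_pairing \<theta> s)) \<bullet> (\<Phi> \<theta> *v axis k (cis (- freq_pairing \<theta> t))) \<partial>torus_measure)"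
proof -
  have "(\<integral>z. z s $ i * z t $ k \<partial>p) = (\<integral>z. z (s - t) $ i * z 0 $ k \<partial>p)"
    using zero_mean_stationary_shift[OF p, of "\<lambda>z. z (s - t) $ i * z 0 $ k" t]
    by (simp add: borel_measurable_times measurable_field_component)
  also have "\<dots> = Re (\<integral>\<theta>. \<Phi> \<theta> $ i $ k * cis (freq_pairing \<theta> (s - t)) \<partial>torus_measure)"
  proof -
    have "complex_of_real (covariance_field p (s - t) $ i $ k) =
        (\<integral>\<theta>. \<Phi> \<theta> $ i $ k * cis (freq_pairing \<theta> (s - t)) \<partial>torus_measure)"
      using \<Phi>(1) unfolding spectral_density_def by blast
    from arg_cong[OF this, of Re] show ?thesis by (simp add: covariance_field_def)
  qed
  also have "\<dots> = (\<integral>\<theta>. Re (\<Phi> \<theta> $ i $ k * cis (freq_pairing \<theta> (s - t))) \<partial>torus_measure)"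
  proof (rule integral_Re[symmetric], intro bdd_meas_integrable bdd_meas_mult bdd_meas_vec_nth \<Phi>)
    show "bdd_meas (\<lambda>\<theta>. cis (freq_pairing \<theta> (s - t)))"
      using trig_poly_bdd_meas[OF trig_poly.monom[of 1 "- (s - t)"]] by (simp only: freq_pairing_minus minus_minus mult_1)
  qed
  finally have *: "(\<integral>z. z s $ i * z t $ k \<partial>p) =
      (\<integral>\<theta>. Re (\<Phi> \<theta> $ i $ k * cis (freq_pairing \<theta> (s - t))) \<partial>torus_measure)" .
  have "Re (\<Phi> \<theta> $ i $ k * cis (freq_pairing \<theta> (s - t))) =
      axis i (cis (- freq_pairing \<theta> s)) \<bullet> (\<Phi> \<theta> *v axis k (cis (- freq_pairing \<theta> t)))" for \<theta>
  proof -
    have "(\<Phi> \<theta> *v axis k (cis (- freq_pairing \<theta> t))) $ i = \<Phi> \<theta> $ i $ k * cis (- freq_pairing \<theta> t)"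
      by (simp add: matrix_vector_mult_def axis_def if_distrib cong: if_cong)
    moreover have "cis (freq_pairing \<theta> (s - t)) = cis (freq_pairing \<theta> s) * cis (- freq_pairing \<theta> t)"
      using freq_pairing_add[of \<theta> s "- t"] freq_pairing_minus[of \<theta> t] by (simp add: cis_mult)
    ultimately show ?thesis
      by (simp only: inner_axis') (simp add: inner_complex_def algebra_simps)
  qed
  then show ?thesis by (simp only: *)
qed

lemma linear_filter_covariance:
  assumes "linear_filter l f" "linear_filter m g"
  shows "integrable p (\<lambda>z. l z * m z) \<and>
    (\<integral>z. l z * m z \<partial>p) = (\<integral>\<theta>. f \<theta> \<bullet> (\<Phi> \<theta> *v g \<theta>) \<partial>torus_measure)"
  using assms(1)
proof (induction rule: linear_filter.induct)
  case c: (coordinate r s k)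
  from assms(2) show ?case
  proof (induction rule: linear_filter.induct)
    case (coordinate r' s' k')
    have ax: "axis j (complex_of_real a * x) = a *\<^sub>R axis j x" for j and a x
      by (simp add: vec_eq_iff axis_def) (simp add: scaleR_conv_of_real)
    have "integrable p (\<lambda>z. (r * r') * (z s $ k * z s' $ k'))"
      by (intro integrable_mult_right zero_mean_stationary_integrable[OF p])
    moreover have "(\<integral>z. (r * r') * (z s $ k * z s' $ k') \<partial>p) = (r * r') *
        (\<integral>\<theta>. axis k (cis (- freq_pairing \<theta> s)) \<bullet> (\<Phi> \<theta> *v axis k' (cis (- freq_pairing \<theta> s'))) \<partial>torus_measure)"
      by (simp add: covariance_coordinates)
    ultimately show ?case
      by (simp add: ax matrix_vector_scaleR_right mult_ac)
  next
    case (add m g m' g')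
    let ?f = "\<lambda>\<theta>. axis k (complex_of_real r * cis (- freq_pairing \<theta> s)) :: complex ^ 'n"
    have "bdd_meas ?f" by (rule linear_filter_bdd_meas[OF linear_filter.coordinate])
    then have "integrable torus_measure (\<lambda>\<theta>. ?f \<theta> \<bullet> (\<Phi> \<theta> *v g \<theta>))"
      "integrable torus_measure (\<lambda>\<theta>. ?f \<theta> \<bullet> (\<Phi> \<theta> *v g' \<theta>))"
      using linear_filter_bdd_meas[OF add.hyps(1)] linear_filter_bdd_meas[OF add.hyps(2)]
      by (auto intro!: bdd_meas_integrable bdd_meas_inner bdd_meas_matrix_vector \<Phi>)
    then show ?case using add.IH
      by (simp add: distrib_left matrix_vector_right_distrib inner_add_right)
  qed
next
  case (add l f l' f')
  have "integrable torus_measure (\<lambda>\<theta>. f \<theta> \<bullet> (\<Phi> \<theta> *v g \<theta>))"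
    "integrable torus_measure (\<lambda>\<theta>. f' \<theta> \<bullet> (\<Phi> \<theta> *v g \<theta>))"
    using linear_filter_bdd_meas[OF add.hyps(1)] linear_filter_bdd_meas[OF add.hyps(2)] linear_filter_bdd_meas[OF assms(2)]
    by (auto intro!: bdd_meas_integrable bdd_meas_inner bdd_meas_matrix_vector \<Phi>)
  then show ?case using add.IH by (simp add: distrib_right inner_add_left)
qed

lemma linear_filter_variance:
  assumes "linear_filter l f"
  shows "integrable p (\<lambda>z. (l z)\<^sup>2)" "(\<integral>z. (l z)\<^sup>2 \<partial>p) = quad_int \<Phi> f" "0 \<le> quad_int \<Phi> f"
proof -
  show "integrable p (\<lambda>z. (l z)\<^sup>2)" "(\<integral>z. (l z)\<^sup>2 \<partial>p) = quad_int \<Phi> f"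
    using linear_filter_covariance[OF assms assms] by (simp_all add: power2_eq_square quad_int_def)
  then show "0 \<le> quad_int \<Phi> f" by (metis Bochner_Integration.integral_nonneg zero_le_power2)
qed

lemma linear_filter_mean:
  "linear_filter l f \<Longrightarrow> integrable p l \<and> (\<integral>z. l z \<partial>p) = 0"
proof (induction rule: linear_filter.induct)
  case (coordinate r s k)
  show ?case using zero_mean_stationary_integrable[OF p] by simp
qed auto

lemma linear_filter_law:
  assumes g: "gaussian_field p" and l: "linear_filter l f"
  shows "distr p borel l = centered_gaussian (quad_int \<Phi> f)"
proof -
  have m: "l \<in> borel_measurable p"
    using linear_filter_measurable[OF l] p by (simp add: zero_mean_stationary_def cong: measurable_cong_sets)
  obtain T a where T: "finite T" "l = (\<lambda>z. \<Sum>t\<in>T. a t \<bullet> z t)"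
    using linear_filter_finite_sum[OF l] by (auto simp: fun_eq_iff)
  then have "gaussian_law (distr p borel l)" using g by (auto simp: gaussian_field_def)
  moreover have "(\<integral>x. x \<partial>distr p borel l) = 0"
    using linear_filter_mean[OF l] m by (simp add: integral_distr)
  moreover have "(\<integral>x. x\<^sup>2 \<partial>distr p borel l) = quad_int \<Phi> f"
    using linear_filter_variance(2)[OF l] m by (simp add: integral_distr)
  ultimately show ?thesis using gaussian_law_centered by metis
qed

end

lemma torus_integral_norm_le:
  fixes h :: "real ^ 'd \<Rightarrow> 'b :: {second_countable_topology, real_normed_vector}"
  assumes "bdd_meas h"
  shows "(\<integral>\<theta>. norm (h \<theta>) \<partial>torus_measure) \<le> sqrt (\<integral>\<theta>. (norm (h \<theta>))\<^sup>2 \<partial>torus_measure)"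
proof -
  interpret prob_space "torus_measure :: (real ^ 'd) measure" by (rule prob_space_torus)
  have "integrable torus_measure (\<lambda>\<theta>. norm (h \<theta>))" "integrable torus_measure (\<lambda>\<theta>. (norm (h \<theta>))\<^sup>2)"
    using bdd_meas_integrable[OF bdd_meas_norm_power[OF assms, where n = 1]]
      bdd_meas_integrable[OF bdd_meas_norm_power[OF assms, where n = 2]] by simp_all
  from variance_eq[OF this] variance_positive[of "\<lambda>\<theta>. norm (h \<theta>)"]
  have "(\<integral>\<theta>. norm (h \<theta>) \<partial>torus_measure)\<^sup>2 \<le> (\<integral>\<theta>. (norm (h \<theta>))\<^sup>2 \<partial>torus_measure)" by simp
  then show ?thesis by (rule real_le_rsqrt)
qed

lemma quad_int_tendsto:
  fixes f :: "nat \<Rightarrow> real ^ 'd \<Rightarrow> complex ^ 'n"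
  assumes \<Phi>: "bdd_meas \<Phi>" and f: "\<And>n. bdd_meas (f n)" and g: "bdd_meas g"
    and lim: "(\<lambda>n. \<integral>\<theta>. (norm (f n \<theta> - g \<theta>))\<^sup>2 \<partial>torus_measure) \<longlonglongrightarrow> 0"
  shows "(\<lambda>n. quad_int \<Phi> (f n)) \<longlonglongrightarrow> quad_int \<Phi> g"
proof -
  from \<Phi> obtain C where C: "0 < C" "\<And>\<theta>. norm (\<Phi> \<theta>) \<le> C" by (meson bdd_measE)
  from g obtain B where B: "0 < B" "\<And>\<theta>. norm (g \<theta>) \<le> B" by (meson bdd_measE)
  define I where "I n = (\<integral>\<theta>. (norm (f n \<theta> - g \<theta>))\<^sup>2 \<partial>torus_measure)" for n
  have mh: "bdd_meas (\<lambda>\<theta>. f n \<theta> - g \<theta>)" for n by (intro bdd_meas_diff f g)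
  have b: "\<bar>u \<bullet> (\<Phi> \<theta> *v v)\<bar> \<le> C * (norm u * norm v)" for u v \<theta>
  proof -
    have "\<bar>u \<bullet> (\<Phi> \<theta> *v v)\<bar> \<le> norm u * norm (\<Phi> \<theta> *v v)" by (rule Cauchy_Schwarz_ineq2)
    also have "\<dots> \<le> norm u * (C * norm v)"
      by (intro mult_left_mono order_trans[OF op_boundD[OF op_bound_norm]] mult_right_mono C) auto
    finally show ?thesis by (simp add: mult_ac)
  qed
  have bound: "\<bar>quad_int \<Phi> (f n) - quad_int \<Phi> g\<bar> \<le> C * I n + 2 * C * B * sqrt (I n)" for n
  proof -
    let ?h = "\<lambda>\<theta>. f n \<theta> - g \<theta>"
    have int: "integrable torus_measure (\<lambda>\<theta>. f n \<theta> \<bullet> (\<Phi> \<theta> *v f n \<theta>))"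
      "integrable torus_measure (\<lambda>\<theta>. g \<theta> \<bullet> (\<Phi> \<theta> *v g \<theta>))"
      by (intro bdd_meas_integrable bdd_meas_inner bdd_meas_matrix_vector \<Phi> f g)+
    have ih: "integrable torus_measure (\<lambda>\<theta>. (norm (?h \<theta>))\<^sup>2)" "integrable torus_measure (\<lambda>\<theta>. norm (?h \<theta>))"
      using bdd_meas_integrable[OF bdd_meas_norm_power[OF mh, where n = 2]]
        bdd_meas_integrable[OF bdd_meas_norm_power[OF mh, where n = 1]] by simp_all
    have "\<bar>quad_int \<Phi> (f n) - quad_int \<Phi> g\<bar> =
        \<bar>\<integral>\<theta>. f n \<theta> \<bullet> (\<Phi> \<theta> *v f n \<theta>) - g \<theta> \<bullet> (\<Phi> \<theta> *v g \<theta>) \<partial>torus_measure\<bar>"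
      using int by (simp add: quad_int_def)
    also have "\<dots> \<le> (\<integral>\<theta>. \<bar>f n \<theta> \<bullet> (\<Phi> \<theta> *v f n \<theta>) - g \<theta> \<bullet> (\<Phi> \<theta> *v g \<theta>)\<bar> \<partial>torus_measure)"
      by (rule integral_abs_bound)
    also have "\<dots> \<le> (\<integral>\<theta>. C * (norm (?h \<theta>))\<^sup>2 + 2 * C * B * norm (?h \<theta>) \<partial>torus_measure)"
    proof (rule integral_mono)
      fix \<theta>
      have "f n \<theta> \<bullet> (\<Phi> \<theta> *v f n \<theta>) - g \<theta> \<bullet> (\<Phi> \<theta> *v g \<theta>)
        = ?h \<theta> \<bullet> (\<Phi> \<theta> *v ?h \<theta>) + ?h \<theta> \<bullet> (\<Phi> \<theta> *v g \<theta>) + g \<theta> \<bullet> (\<Phi> \<theta> *v ?h \<theta>)"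
        by (simp add: matrix_vector_mult_diff_distrib inner_diff_left inner_diff_right)
      moreover have "\<bar>?h \<theta> \<bullet> (\<Phi> \<theta> *v ?h \<theta>)\<bar> \<le> C * (norm (?h \<theta>))\<^sup>2"
        using b[of "?h \<theta>" \<theta> "?h \<theta>"] by (simp add: power2_eq_square)
      moreover have "C * (norm (?h \<theta>) * norm (g \<theta>)) \<le> C * (norm (?h \<theta>) * B)"
        using C B by (intro mult_left_mono) auto
      ultimately show "\<bar>f n \<theta> \<bullet> (\<Phi> \<theta> *v f n \<theta>) - g \<theta> \<bullet> (\<Phi> \<theta> *v g \<theta>)\<bar>
          \<le> C * (norm (?h \<theta>))\<^sup>2 + 2 * C * B * norm (?h \<theta>)"
        using b[of "?h \<theta>" \<theta> "g \<theta>"] b[of "g \<theta>" \<theta> "?h \<theta>"] by (simp add: mult_ac)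
    qed (use int ih in auto)
    also have "\<dots> = C * I n + 2 * C * B * (\<integral>\<theta>. norm (?h \<theta>) \<partial>torus_measure)"
      using ih by (simp add: I_def)
    also have "\<dots> \<le> C * I n + 2 * C * B * sqrt (I n)"
      using torus_integral_norm_le[OF mh, of n] C B by (auto simp: I_def intro!: mult_left_mono)
    finally show ?thesis .
  qed
  have "(\<lambda>n. C * I n + 2 * C * B * sqrt (I n)) \<longlonglongrightarrow> C * 0 + 2 * C * B * sqrt 0"
    unfolding I_def by (intro tendsto_intros lim)
  then have lim0: "(\<lambda>n. C * I n + 2 * C * B * sqrt (I n)) \<longlonglongrightarrow> 0" by simp
  have "(\<lambda>n. quad_int \<Phi> (f n) - quad_int \<Phi> g) \<longlonglongrightarrow> 0"
    by (rule Lim_null_comparison[OF always_eventually lim0]) (simp only: real_norm_def bound, simp)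
  then show ?thesis by (rule LIM_zero_cancel)
qed

section \<open>The optimal coupling\<close>

lemma trace_scaleR: "trace (r *\<^sub>R A) = r *\<^sub>R trace (A :: complex ^ 'n ^ 'n)"
  by (simp add: trace_def scaleR_right.sum)

lemma axis_scale: "axis k c = c *s (axis k 1 :: complex ^ 'n)"
  by (simp add: vec_eq_iff axis_def)

lemma matrix_vector_mult_vector_scale: "A *v (c *s v) = c *s (A *v (v :: complex ^ 'n))"
  by (simp add: vec_eq_iff matrix_vector_mult_def sum_distrib_left mult_ac)

lemma norm_vector_scale: "norm (c *s (v :: complex ^ 'n)) = norm c * norm v"
  by (simp add: norm_vec_def norm_mult L2_set_left_distrib mult.commute[of "norm c"])

lemma inner_unit_scale:
  assumes "norm c = 1" shows "(c *s v) \<bullet> (c *s w) = v \<bullet> (w :: complex ^ 'n)"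
proof -
  have "(c * x) \<bullet> (c * y) = x \<bullet> y" for x y
  proof -
    have "(c * x) \<bullet> (c * y) = (norm c)\<^sup>2 * (x \<bullet> y)"
      unfolding cmod_power2 by (simp add: inner_complex_def algebra_simps power2_eq_square)
    then show ?thesis using assms by simp
  qed
  then show ?thesis by (simp add: inner_vec_def)
qed

lemma quad_int_phase: "quad_int \<Phi> (\<lambda>\<theta>. cis (a \<theta>) *s f \<theta>) = quad_int \<Phi> f"
  by (simp add: quad_int_def matrix_vector_mult_vector_scale inner_unit_scale)

lemma (in prob_space) AE_convergent_of_summable_L1:
  fixes X :: "nat \<Rightarrow> 'a \<Rightarrow> real"
  assumes X: "\<And>n. X n \<in> borel_measurable M"
    and int: "\<And>n. integrable M (\<lambda>x. X (Suc n) x - X n x)"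
    and sm: "summable (\<lambda>n. \<integral>x. \<bar>X (Suc n) x - X n x\<bar> \<partial>M)"
  shows "AE x in M. convergent (\<lambda>n. X n x)"
proof -
  define d where "d n x = \<bar>X (Suc n) x - X n x\<bar>" for n x
  have dm: "d n \<in> borel_measurable M" for n unfolding d_def using X by measurable
  have di: "integrable M (d n)" for n unfolding d_def by (intro integrable_abs int)
  have "(\<integral>\<^sup>+x. (\<Sum>n. ennreal (d n x)) \<partial>M) = (\<Sum>n. \<integral>\<^sup>+x. ennreal (d n x) \<partial>M)"
    using dm by (intro nn_integral_suminf) simp
  also have "\<dots> = (\<Sum>n. ennreal (\<integral>x. d n x \<partial>M))"
    by (intro suminf_cong nn_integral_eq_integral[OF di]) (simp add: d_def)
  also have "\<dots> = ennreal (\<Sum>n. \<integral>x. d n x \<partial>M)"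
    using sm by (intro suminf_ennreal2) (auto simp: d_def)
  finally have "(\<integral>\<^sup>+x. (\<Sum>n. ennreal (d n x)) \<partial>M) \<noteq> \<infinity>" by simp
  then have "AE x in M. (\<Sum>n. ennreal (d n x)) \<noteq> \<infinity>"
    using dm by (intro nn_integral_PInf_AE) auto
  then show ?thesis
  proof eventually_elim
    case (elim x)
    then have "summable (\<lambda>n. d n x)" by (intro summable_suminf_not_top) (auto simp: d_def)
    then have "summable (\<lambda>n. X (Suc n) x - X n x)"
      unfolding d_def by (rule summable_rabs_cancel)
    then have "convergent (\<lambda>n. \<Sum>k<n. X (Suc k) x - X k x)" by (simp add: summable_iff_convergent)
    moreover have "(\<Sum>k<n. X (Suc k) x - X k x) = X n x - X 0 x" for n
      by (rule sum_lessThan_telescope)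
    ultimately have "convergent (\<lambda>n. X n x - X 0 x)" by simp
    then have "convergent (\<lambda>n. (X n x - X 0 x) + X 0 x)" by (intro convergent_add convergent_const)
    then show ?case by simp
  qed
qed

lemma quad_int_le:
  assumes \<Phi>: "bdd_meas \<Phi>" "\<And>\<theta>. norm (\<Phi> \<theta>) \<le> C" and f: "bdd_meas f"
  shows "quad_int \<Phi> f \<le> C * (\<integral>\<theta>. (norm (f \<theta>))\<^sup>2 \<partial>torus_measure)"
proof -
  have i: "integrable torus_measure (\<lambda>\<theta>. (norm (f \<theta>))\<^sup>2)"
    by (intro bdd_meas_integrable bdd_meas_norm_power f)
  have "quad_int \<Phi> f \<le> (\<integral>\<theta>. C * (norm (f \<theta>))\<^sup>2 \<partial>torus_measure)"
    unfolding quad_int_def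
  proof (rule integral_mono)
    show "integrable torus_measure (\<lambda>\<theta>. f \<theta> \<bullet> (\<Phi> \<theta> *v f \<theta>))"
      by (intro bdd_meas_integrable bdd_meas_inner bdd_meas_matrix_vector \<Phi> f)
    fix \<theta>
    have "f \<theta> \<bullet> (\<Phi> \<theta> *v f \<theta>) \<le> norm (f \<theta>) * norm (\<Phi> \<theta> *v f \<theta>)" by (rule norm_cauchy_schwarz)
    also have "\<dots> \<le> norm (f \<theta>) * (C * norm (f \<theta>))"
      by (intro mult_left_mono order_trans[OF op_boundD[OF op_bound_norm]] mult_right_mono \<Phi>) auto
    finally show "f \<theta> \<bullet> (\<Phi> \<theta> *v f \<theta>) \<le> C * (norm (f \<theta>))\<^sup>2"
      by (simp add: power2_eq_square mult_ac)
  qed (use i in simp)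
  then show ?thesis by simp
qed

definition inl_part :: "complex ^ ('m::finite + 'm) \<Rightarrow> complex ^ 'm" where
  "inl_part v = (\<chi> i. v $ Inl i)"

definition inr_part :: "complex ^ ('m::finite + 'm) \<Rightarrow> complex ^ 'm" where
  "inr_part v = (\<chi> i. v $ Inr i)"

lemma bounded_linear_inl_part: "bounded_linear inl_part"
  and bounded_linear_inr_part: "bounded_linear inr_part"
  unfolding linear_conv_bounded_linear[symmetric]
  by (auto intro!: linearI simp: inl_part_def inr_part_def vec_eq_iff)

lemma part_axis [simp]:
  "inl_part (axis (Inl i) c) = axis i c" "inl_part (axis (Inr i) c) = 0"
  "inr_part (axis (Inr i) c) = axis i c" "inr_part (axis (Inl i) c) = 0"
  by (auto simp: inl_part_def inr_part_def vec_eq_iff axis_def)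

lemma sum_tendsto_zero_add_norm_square:
  fixes a b :: "nat \<Rightarrow> real ^ 'd \<Rightarrow> complex ^ 'n"
  assumes a: "\<And>n. bdd_meas (a n)" "(\<lambda>n. \<integral>\<theta>. (norm (a n \<theta>))\<^sup>2 \<partial>torus_measure) \<longlonglongrightarrow> 0"
    and b: "\<And>n. bdd_meas (b n)" "(\<lambda>n. \<integral>\<theta>. (norm (b n \<theta>))\<^sup>2 \<partial>torus_measure) \<longlonglongrightarrow> 0"
  shows "(\<lambda>n. \<integral>\<theta>. (norm (a n \<theta> + b n \<theta>))\<^sup>2 \<partial>torus_measure) \<longlonglongrightarrow> 0"
proof (rule tendsto_sandwich[OF _ _ tendsto_const])
  have i: "integrable torus_measure (\<lambda>\<theta>. (norm (a n \<theta>))\<^sup>2)" "integrable torus_measure (\<lambda>\<theta>. (norm (b n \<theta>))\<^sup>2)" for n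
    by (intro bdd_meas_integrable bdd_meas_norm_power a b)+
  show "\<forall>\<^sub>F n in sequentially. 0 \<le> (\<integral>\<theta>. (norm (a n \<theta> + b n \<theta>))\<^sup>2 \<partial>torus_measure)"
    by simp
  have "(\<integral>\<theta>. (norm (a n \<theta> + b n \<theta>))\<^sup>2 \<partial>torus_measure)
      \<le> (\<integral>\<theta>. 2 * (norm (a n \<theta>))\<^sup>2 + 2 * (norm (b n \<theta>))\<^sup>2 \<partial>torus_measure)" for n
  proof (rule integral_mono)
    show "integrable torus_measure (\<lambda>\<theta>. (norm (a n \<theta> + b n \<theta>))\<^sup>2)"
      by (intro bdd_meas_integrable bdd_meas_norm_power bdd_meas_add a b)
    show "(norm (a n \<theta> + b n \<theta>))\<^sup>2 \<le> 2 * (norm (a n \<theta>))\<^sup>2 + 2 * (norm (b n \<theta>))\<^sup>2" for \<theta>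
      by (rule norm_add_square_le)
  qed (use i in simp)
  then show "\<forall>\<^sub>F n in sequentially. (\<integral>\<theta>. (norm (a n \<theta> + b n \<theta>))\<^sup>2 \<partial>torus_measure)
      \<le> 2 * (\<integral>\<theta>. (norm (a n \<theta>))\<^sup>2 \<partial>torus_measure) + 2 * (\<integral>\<theta>. (norm (b n \<theta>))\<^sup>2 \<partial>torus_measure)"
    using i by simp
  show "(\<lambda>n. 2 * (\<integral>\<theta>. (norm (a n \<theta>))\<^sup>2 \<partial>torus_measure) + 2 * (\<integral>\<theta>. (norm (b n \<theta>))\<^sup>2 \<partial>torus_measure)) \<longlonglongrightarrow> 0"
    by (rule tendsto_eq_intros a b | simp)+
qed

lemma symmetric_column:
  assumes "T (refl_torus \<theta>) = cconj (T \<theta>)"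
  shows "(T (refl_torus \<theta>) *v axis i 1) $ k = cnj ((T \<theta> *v axis i 1) $ k)"
  by (simp add: matrix_vector_axis assms)

text \<open>Errors below \<open>4\<^sup>-\<^sup>n\<close> in mean square make the increments summable in mean, hence almost surely.\<close>

lemma filter_limit_exists:
  fixes p :: "(int ^ 'd \<Rightarrow> real ^ 'm) measure"
  assumes p: "zero_mean_stationary p" and Y: "spectral_density p Y" "bdd_meas Y"
    and F: "bdd_meas F" and sym: "\<And>\<theta> k. F (refl_torus \<theta>) $ k = cnj (F \<theta> $ k)"
  obtains l f V where "\<And>n. linear_filter (l n) (f n)" "V \<in> borel_measurable field_space"
    "AE z in p. (\<lambda>n. l n z) \<longlonglongrightarrow> V z"
    "(\<lambda>n. \<integral>\<theta>. (norm (f n \<theta> - F \<theta>))\<^sup>2 \<partial>torus_measure) \<longlonglongrightarrow> 0"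
proof -
  have ps: "prob_space p" and sets: "sets p = sets field_space"
    using p by (auto simp: zero_mean_stationary_def)
  interpret prob_space p by (rule ps)
  have "\<exists>lf. linear_filter (fst lf) (snd lf) \<and> (\<integral>\<theta>. (norm (snd lf \<theta> - F \<theta>))\<^sup>2 \<partial>torus_measure) < (1 / 4) ^ n" for n :: nat
  proof -
    have "0 < (1 / 4 :: real) ^ n" by simp
    from linear_filter_dense[OF F sym this] obtain l f
      where "linear_filter l f" "(\<integral>\<theta>. (norm (f \<theta> - F \<theta>))\<^sup>2 \<partial>torus_measure) < (1 / 4) ^ n" by blast
    then show ?thesis by (intro exI[of _ "(l, f)"]) simp
  qed
  then have "\<forall>n. \<exists>lf. linear_filter (fst lf) (snd lf) \<and> (\<integral>\<theta>. (norm (snd lf \<theta> - F \<theta>))\<^sup>2 \<partial>torus_measure) < (1 / 4) ^ n" ..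
  from choice[OF this] obtain lf where lf: "\<And>n. linear_filter (fst (lf n)) (snd (lf n))"
    "\<And>n. (\<integral>\<theta>. (norm (snd (lf n) \<theta> - F \<theta>))\<^sup>2 \<partial>torus_measure) < (1 / 4) ^ n" by blast
  define l f where "l n = fst (lf n)" and "f n = snd (lf n)" for n
  have l: "linear_filter (l n) (f n)" and fF: "(\<integral>\<theta>. (norm (f n \<theta> - F \<theta>))\<^sup>2 \<partial>torus_measure) < (1 / 4) ^ n" for n
    using lf[of n] by (auto simp: l_def f_def)
  have fm: "bdd_meas (f n)" for n by (rule linear_filter_bdd_meas[OF l])
  have lm: "l n \<in> borel_measurable p" for n
    using linear_filter_measurable[OF l] by (simp add: measurable_cong_sets[OF sets refl])
  from Y(2) obtain C where C: "0 < C" "\<And>\<theta>. norm (Y \<theta>) \<le> C" by (meson bdd_measE)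
  have d: "linear_filter (\<lambda>z. l (Suc n) z - l n z) (\<lambda>\<theta>. f (Suc n) \<theta> - f n \<theta>)" for n
    by (rule linear_filter_diff[OF l l])
  have E: "(\<integral>z. \<bar>l (Suc n) z - l n z\<bar> \<partial>p) \<le> sqrt (4 * C) * (1 / 2) ^ n" for n
  proof -
    note v = linear_filter_variance[OF p Y d, of n]
    have i: "integrable p (\<lambda>z. l (Suc n) z - l n z)" using linear_filter_mean[OF p Y d, of n] by simp
    have "variance (\<lambda>z. \<bar>l (Suc n) z - l n z\<bar>) = expectation (\<lambda>z. \<bar>l (Suc n) z - l n z\<bar>\<^sup>2) - (expectation (\<lambda>z. \<bar>l (Suc n) z - l n z\<bar>))\<^sup>2"
      using v(1) i by (intro variance_eq) auto
    then have "(\<integral>z. \<bar>l (Suc n) z - l n z\<bar> \<partial>p)\<^sup>2 \<le> quad_int Y (\<lambda>\<theta>. f (Suc n) \<theta> - f n \<theta>)"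
      using variance_positive[of "\<lambda>z. \<bar>l (Suc n) z - l n z\<bar>"] v(2) by simp
    also have "\<dots> \<le> C * (\<integral>\<theta>. (norm (f (Suc n) \<theta> - f n \<theta>))\<^sup>2 \<partial>torus_measure)"
      by (intro quad_int_le Y C bdd_meas_diff fm)
    also have "(\<integral>\<theta>. (norm (f (Suc n) \<theta> - f n \<theta>))\<^sup>2 \<partial>torus_measure)
        \<le> (\<integral>\<theta>. 2 * (norm (f (Suc n) \<theta> - F \<theta>))\<^sup>2 + 2 * (norm (f n \<theta> - F \<theta>))\<^sup>2 \<partial>torus_measure)"
    proof (rule integral_mono)
      fix \<theta>
      show "(norm (f (Suc n) \<theta> - f n \<theta>))\<^sup>2 \<le> 2 * (norm (f (Suc n) \<theta> - F \<theta>))\<^sup>2 + 2 * (norm (f n \<theta> - F \<theta>))\<^sup>2"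
        using norm_add_square_le[of "f (Suc n) \<theta> - F \<theta>" "F \<theta> - f n \<theta>"] by (simp add: norm_minus_commute)
    qed (intro bdd_meas_integrable bdd_meas_norm_power bdd_meas_diff bdd_meas_add bdd_meas_mult bdd_meas_const fm F)+
    also have "\<dots> = 2 * (\<integral>\<theta>. (norm (f (Suc n) \<theta> - F \<theta>))\<^sup>2 \<partial>torus_measure) + 2 * (\<integral>\<theta>. (norm (f n \<theta> - F \<theta>))\<^sup>2 \<partial>torus_measure)"
      using bdd_meas_integrable[OF bdd_meas_norm_power[OF bdd_meas_diff[OF fm F], where n = 2]] by simp
    also have "\<dots> \<le> 2 * (1 / 4) ^ Suc n + 2 * (1 / 4) ^ n"
      by (intro add_mono mult_left_mono less_imp_le[OF fF]) auto
    also have "\<dots> \<le> 4 * (1 / 4) ^ n" by simp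
    finally have "(\<integral>z. \<bar>l (Suc n) z - l n z\<bar> \<partial>p)\<^sup>2 \<le> C * (4 * (1 / 4) ^ n)"
      using C by simp
    also have "\<dots> = (sqrt (4 * C) * (1 / 2) ^ n)\<^sup>2"
      using C by (simp add: power_mult_distrib power_divide flip: power_mult) (simp add: power_mult mult.commute[of n])
    finally show ?thesis by (rule power2_le_imp_le) (use C in simp)
  qed
  have "AE z in p. convergent (\<lambda>n. l n z)"
  proof (rule AE_convergent_of_summable_L1[OF lm])
    show "integrable p (\<lambda>z. l (Suc n) z - l n z)" for n using linear_filter_mean[OF p Y d, of n] by simp
    show "summable (\<lambda>n. \<integral>z. \<bar>l (Suc n) z - l n z\<bar> \<partial>p)"
    proof (rule summable_comparison_test')
      show "summable (\<lambda>n. sqrt (4 * C) * (1 / 2 :: real) ^ n)" by (intro summable_mult summable_geometric) simp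
      show "norm (\<integral>z. \<bar>l (Suc n) z - l n z\<bar> \<partial>p) \<le> sqrt (4 * C) * (1 / 2) ^ n" for n
        using E[of n] by (simp add: abs_of_nonneg)
    qed
  qed
  then have "AE z in p. (\<lambda>n. l n z) \<longlonglongrightarrow> lim (\<lambda>n. l n z)"
    by eventually_elim (simp add: convergent_LIMSEQ_iff)
  moreover have "(\<lambda>z. lim (\<lambda>n. l n z)) \<in> borel_measurable field_space"
    by (intro borel_measurable_lim_metric linear_filter_measurable[OF l])
  moreover have "(\<lambda>n. \<integral>\<theta>. (norm (f n \<theta> - F \<theta>))\<^sup>2 \<partial>torus_measure) \<longlonglongrightarrow> 0"
  proof (rule tendsto_sandwich[OF _ _ tendsto_const])
    show "(\<lambda>n. (1 / 4 :: real) ^ n) \<longlonglongrightarrow> 0" by (rule LIMSEQ_realpow_zero) auto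
    show "\<forall>\<^sub>F n in sequentially. (\<integral>\<theta>. (norm (f n \<theta> - F \<theta>))\<^sup>2 \<partial>torus_measure) \<le> (1 / 4) ^ n"
      using fF by (simp add: less_imp_le)
  qed simp
  ultimately show ?thesis using that[of l f] l by blast
qed

lemma linear_filter_x_part:
  "linear_filter l f \<Longrightarrow> \<exists>g. linear_filter (\<lambda>z. l (\<lambda>t. x_part (z t))) g \<and>
     (\<forall>\<theta>. inl_part (g \<theta>) = f \<theta> \<and> inr_part (g \<theta>) = 0)"
proof (induction rule: linear_filter.induct)
  case (coordinate r s k)
  show ?case
    using linear_filter.coordinate[of r s "Inl k"] by (intro exI conjI) (auto simp: x_part_def)
next
  case (add l f l' f')
  then obtain g g' where g: "linear_filter (\<lambda>z. l (\<lambda>t. x_part (z t))) g" "\<And>\<theta>. inl_part (g \<theta>) = f \<theta> \<and> inr_part (g \<theta>) = 0"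
    and g': "linear_filter (\<lambda>z. l' (\<lambda>t. x_part (z t))) g'" "\<And>\<theta>. inl_part (g' \<theta>) = f' \<theta> \<and> inr_part (g' \<theta>) = 0"
    by blast
  from linear_filter.add[OF g(1) g'(1)] show ?case
    by (intro exI conjI allI, assumption)
      (use g(2) g'(2) in \<open>auto simp: linear_simps[OF bounded_linear_inl_part] linear_simps[OF bounded_linear_inr_part]\<close>)
qed

lemma optimal_coupling_exists:
  fixes px py :: "(int ^ 'd \<Rightarrow> real ^ 'm) measure" and t :: "int ^ 'd"
  assumes px: "zero_mean_gaussian_stationary px" "spectral_density px X" "bdd_meas X"
    and py: "zero_mean_gaussian_stationary py" "spectral_density py Y" "bdd_meas Y"
    and T: "bdd_meas T" "\<And>\<theta>. T (refl_torus \<theta>) = cconj (T \<theta>)" "\<And>\<theta>. adj (T \<theta>) = T \<theta>"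
    and X: "\<And>\<theta>. T \<theta> ** Y \<theta> ** T \<theta> = X \<theta>"
  obtains q where "q \<in> gaussian_couplings px py"
    "transport_cost q t = (\<integral>\<theta>. Re (trace (X \<theta> + Y \<theta> - 2 *\<^sub>R (T \<theta> ** Y \<theta>))) \<partial>torus_measure)"
proof -
  have st: "zero_mean_stationary py" and ga: "gaussian_field py" and ps: "prob_space py"
    and sets: "sets py = sets field_space"
    and shift: "\<And>s. distr py field_space (\<lambda>z t. z (t + s)) = py"
    using py(1) by (auto simp: zero_mean_gaussian_stationary_def zero_mean_stationary_def)
  interpret prob_space py by (rule ps)
  have mp: "h \<in> borel_measurable py" if "h \<in> borel_measurable field_space" for h :: "(int ^ 'd \<Rightarrow> real ^ 'm) \<Rightarrow> real"
    using that by (simp add: measurable_cong_sets[OF sets refl])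
  have sm: "(\<lambda>z t. z (t + s)) \<in> r \<rightarrow>\<^sub>M (field_space :: (int ^ 'd \<Rightarrow> real ^ 'k) measure)"
    if "sets r = sets field_space" for s and r :: "(int ^ 'd \<Rightarrow> real ^ 'k) measure"
    by (rule measurable_field_spaceI) (simp add: measurable_cong_sets[OF that refl] measurable_field_component)
  have Tc: "bdd_meas (\<lambda>\<theta>. T \<theta> *v axis i 1)" for i
    by (intro bdd_meas_matrix_vector T bdd_meas_const)
  define P where "P i x \<longleftrightarrow> (\<forall>n. linear_filter (fst x n) (fst (snd x) n)) \<and>
      snd (snd x) \<in> borel_measurable field_space \<and>
      (AE z in py. (\<lambda>n. fst x n z) \<longlonglongrightarrow> snd (snd x) z) \<and>
      (\<lambda>n. \<integral>\<theta>. (norm (fst (snd x) n \<theta> - T \<theta> *v axis i 1))\<^sup>2 \<partial>torus_measure) \<longlonglongrightarrow> 0" for i x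
  have "\<exists>x. P i x" for i
  proof -
    have "(T (refl_torus \<theta>) *v axis i 1) $ k = cnj ((T \<theta> *v axis i 1) $ k)" for \<theta> k
      by (rule symmetric_column) (rule T)
    from filter_limit_exists[OF st py(2,3) Tc this] obtain l f V where
      "\<And>n. linear_filter (l n) (f n)" "V \<in> borel_measurable field_space"
      "AE z in py. (\<lambda>n. l n z) \<longlonglongrightarrow> V z"
      "(\<lambda>n. \<integral>\<theta>. (norm (f n \<theta> - T \<theta> *v axis i 1))\<^sup>2 \<partial>torus_measure) \<longlonglongrightarrow> 0" by blast
    then have "P i (l, f, V)" by (simp add: P_def)
    then show ?thesis ..
  qed
  then have "\<forall>i. \<exists>x. P i x" ..
  from choice[OF this] obtain x where x: "\<And>i. P i (x i)" by blast
  define l f V where "l i = fst (x i)" and "f i = fst (snd (x i))" and "V i = snd (snd (x i))" for i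
  have l: "linear_filter (l i n) (f i n)" and V: "V i \<in> borel_measurable field_space"
    and lV: "AE z in py. (\<lambda>n. l i n z) \<longlonglongrightarrow> V i z"
    and fT: "(\<lambda>n. \<integral>\<theta>. (norm (f i n \<theta> - T \<theta> *v axis i 1))\<^sup>2 \<partial>torus_measure) \<longlonglongrightarrow> 0" for i n
    using x[of i] unfolding P_def l_def f_def V_def by blast+
  define W :: "(int ^ 'd \<Rightarrow> real ^ 'm) \<Rightarrow> int ^ 'd \<Rightarrow> real ^ ('m + 'm)" where
    "W z t = (\<chi> j. case j of Inl i \<Rightarrow> V i (\<lambda>s. z (s + t)) | Inr i \<Rightarrow> z t $ i)" for z t
  have Wm: "W \<in> py \<rightarrow>\<^sub>M field_space"
  proof (rule measurable_field_spaceI)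
    fix t :: "int ^ 'd" and j :: "'m + 'm"
    show "(\<lambda>z. W z t $ j) \<in> borel_measurable py"
      using measurable_compose[OF sm[OF sets, of t] V] measurable_field_component
      by (cases j) (auto simp: W_def measurable_cong_sets[OF sets refl])
  qed
  define G where "G g \<theta> = T \<theta> *v inl_part (g \<theta>) + inr_part (g \<theta>)" for g and \<theta> :: "real ^ 'd"
  have Gm: "bdd_meas (G g)" if "bdd_meas g" for g
    unfolding G_def[abs_def]
    by (intro bdd_meas_add bdd_meas_matrix_vector T bdd_meas_bounded_linear[OF bounded_linear_inl_part]
        bdd_meas_bounded_linear[OF bounded_linear_inr_part] that)
  have approx: "\<exists>a b. (\<forall>n. linear_filter (a n) (b n)) \<and> (AE z in py. (\<lambda>n. a n z) \<longlonglongrightarrow> h (W z)) \<and>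
      (\<lambda>n. \<integral>\<theta>. (norm (b n \<theta> - G g \<theta>))\<^sup>2 \<partial>torus_measure) \<longlonglongrightarrow> 0"
    if "linear_filter h g" for h and g :: "real ^ 'd \<Rightarrow> complex ^ ('m + 'm)"
    using that
  proof (induction rule: linear_filter.induct)
    case (coordinate r s j)
    show ?case
    proof (cases j)
      case (Inl i)
      define a where "a n z = r * l i n (\<lambda>t. z (t + s))" for n z
      define b where "b n \<theta> = r *\<^sub>R (cis (- freq_pairing \<theta> s) *s f i n \<theta>)" for n \<theta>
      have "linear_filter (a n) (b n)" for n
        unfolding a_def[abs_def] b_def[abs_def] by (intro linear_filter_scale linear_filter_shift l)
      moreover have "AE z in py. (\<lambda>n. l i n (\<lambda>t. z (t + s))) \<longlonglongrightarrow> V i (\<lambda>t. z (t + s))"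
      proof (rule AE_distrD[OF sm[OF sets]])
        show "AE z in distr py field_space (\<lambda>z t. z (t + s)). (\<lambda>n. l i n z) \<longlonglongrightarrow> V i z"
          using lV[of i] by (subst shift) assumption
      qed
      then have "AE z in py. (\<lambda>n. a n z) \<longlonglongrightarrow> r * W z s $ j"
        by eventually_elim (auto simp: a_def W_def Inl intro!: tendsto_intros)
      moreover have "(\<lambda>n. \<integral>\<theta>. (norm (b n \<theta> - G (\<lambda>\<theta>. axis j (complex_of_real r * cis (- freq_pairing \<theta> s))) \<theta>))\<^sup>2 \<partial>torus_measure) \<longlonglongrightarrow> 0"
      proof -
        have "G (\<lambda>\<theta>. axis j (complex_of_real r * cis (- freq_pairing \<theta> s))) \<theta>
            = r *\<^sub>R (cis (- freq_pairing \<theta> s) *s (T \<theta> *v axis i 1))" for \<theta>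
        proof -
          have "axis i (complex_of_real r * cis (- freq_pairing \<theta> s)) = r *\<^sub>R (cis (- freq_pairing \<theta> s) *s axis i 1)"
            by (simp add: vec_eq_iff axis_def) (simp add: scaleR_conv_of_real)
          then show ?thesis
            by (simp add: G_def Inl matrix_vector_scaleR_right matrix_vector_mult_vector_scale)
        qed
        then have "norm (b n \<theta> - G (\<lambda>\<theta>. axis j (complex_of_real r * cis (- freq_pairing \<theta> s))) \<theta>)
            = \<bar>r\<bar> * norm (f i n \<theta> - T \<theta> *v axis i 1)" for n \<theta>
          by (simp add: b_def norm_vector_scale flip: scaleR_diff_right vector_ssub_ldistrib)
        then show ?thesis
          using tendsto_mult_left[OF fT[of i], of "r\<^sup>2"] by (simp add: power_mult_distrib)
      qed
      ultimately show ?thesis by blast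
    next
      case (Inr i)
      have "(\<lambda>\<theta>. axis i (complex_of_real r * cis (- freq_pairing \<theta> s)))
          = G (\<lambda>\<theta>. axis j (complex_of_real r * cis (- freq_pairing \<theta> s)))"
        by (simp add: G_def[abs_def] Inr)
      then show ?thesis
        using linear_filter.coordinate[of r s i]
        by (intro exI[of _ "\<lambda>_ z. r * z s $ i"] exI[of _ "\<lambda>_. G (\<lambda>\<theta>. axis j (complex_of_real r * cis (- freq_pairing \<theta> s)))"])
          (simp add: W_def Inr)
    qed
  next
    case (add h g h' g')
    then obtain a b a' b' where ab: "\<And>n. linear_filter (a n) (b n)" "AE z in py. (\<lambda>n. a n z) \<longlonglongrightarrow> h (W z)"
        "(\<lambda>n. \<integral>\<theta>. (norm (b n \<theta> - G g \<theta>))\<^sup>2 \<partial>torus_measure) \<longlonglongrightarrow> 0"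
      and ab': "\<And>n. linear_filter (a' n) (b' n)" "AE z in py. (\<lambda>n. a' n z) \<longlonglongrightarrow> h' (W z)"
        "(\<lambda>n. \<integral>\<theta>. (norm (b' n \<theta> - G g' \<theta>))\<^sup>2 \<partial>torus_measure) \<longlonglongrightarrow> 0" by blast
    have "AE z in py. (\<lambda>n. a n z + a' n z) \<longlonglongrightarrow> h (W z) + h' (W z)"
      using ab(2) ab'(2) by eventually_elim (rule tendsto_add)
    moreover have "(\<lambda>n. \<integral>\<theta>. (norm ((b n \<theta> - G g \<theta>) + (b' n \<theta> - G g' \<theta>)))\<^sup>2 \<partial>torus_measure) \<longlonglongrightarrow> 0"
      by (intro sum_tendsto_zero_add_norm_square ab(3) ab'(3) bdd_meas_diff Gm
          linear_filter_bdd_meas[OF ab(1)] linear_filter_bdd_meas[OF ab'(1)]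
          linear_filter_bdd_meas[OF add.hyps(1)] linear_filter_bdd_meas[OF add.hyps(2)])
    moreover have "(b n \<theta> - G g \<theta>) + (b' n \<theta> - G g' \<theta>) = (b n \<theta> + b' n \<theta>) - G (\<lambda>\<theta>. g \<theta> + g' \<theta>) \<theta>" for n \<theta>
      by (simp add: G_def linear_simps[OF bounded_linear_inl_part] linear_simps[OF bounded_linear_inr_part]
          matrix_vector_right_distrib)
    ultimately show ?case
      using linear_filter.add[OF ab(1) ab'(1)]
      by (intro exI[of _ "\<lambda>n z. a n z + a' n z"] exI[of _ "\<lambda>n \<theta>. b n \<theta> + b' n \<theta>"]) simp
  qed
  define q where "q = distr py field_space W"
  have qsets: "sets q = sets field_space" and qps: "prob_space q"
    unfolding q_def using Wm by (auto intro: prob_space_distr)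
  have law: "distr q borel h = centered_gaussian (quad_int Y (G g)) \<and> 0 \<le> quad_int Y (G g)"
    if hg: "linear_filter h g" for h g
  proof -
    obtain a b where ab: "\<And>n. linear_filter (a n) (b n)" "AE z in py. (\<lambda>n. a n z) \<longlonglongrightarrow> h (W z)"
        "(\<lambda>n. \<integral>\<theta>. (norm (b n \<theta> - G g \<theta>))\<^sup>2 \<partial>torus_measure) \<longlonglongrightarrow> 0" using approx[OF hg] by blast
    have conv: "(\<lambda>n. quad_int Y (b n)) \<longlonglongrightarrow> quad_int Y (G g)"
      by (intro quad_int_tendsto py(3) Gm linear_filter_bdd_meas[OF hg] linear_filter_bdd_meas[OF ab(1)] ab(3))
    have nn: "0 \<le> quad_int Y (b n)" for n by (rule linear_filter_variance(3)[OF st py(2,3) ab(1)])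
    have hm: "h \<in> borel_measurable field_space" by (rule linear_filter_measurable[OF hg])
    have "distr py borel (\<lambda>z. h (W z)) = centered_gaussian (quad_int Y (G g))"
    proof (rule centered_gaussian_limit[OF _ _ ab(2) _ nn conv])
      show "a n \<in> borel_measurable py" for n by (intro mp linear_filter_measurable[OF ab(1)])
      show "(\<lambda>z. h (W z)) \<in> borel_measurable py" by (rule measurable_compose[OF Wm hm])
      show "distr py borel (a n) = centered_gaussian (quad_int Y (b n))" for n
        by (rule linear_filter_law[OF st py(2,3) ga ab(1)])
    qed
    moreover have "distr q borel h = distr py borel (\<lambda>z. h (W z))"
      unfolding q_def using distr_distr[OF hm Wm] by (simp add: o_def)
    moreover have "0 \<le> quad_int Y (G g)" using conv nn by (intro LIMSEQ_le_const) auto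
    ultimately show ?thesis by simp
  qed
  have mq: "h \<in> borel_measurable q" if "linear_filter h g" for h g
    using linear_filter_measurable[OF that] by (simp add: measurable_cong_sets[OF qsets refl])
  have mom: "integrable q h" "(\<integral>z. h z \<partial>q) = 0" "integrable q (\<lambda>z. (h z)\<^sup>2)" "(\<integral>z. (h z)\<^sup>2 \<partial>q) = quad_int Y (G g)"
    if hg: "linear_filter h g" for h g
  proof -
    note L = law[OF hg] and m = mq[OF hg]
    note cg = centered_gaussian_moments[OF conjunct2[OF L], folded conjunct1[OF L]]
    show "integrable q h" using cg(1) integrable_distr[OF m, of "\<lambda>x. x"] by simp
    show "(\<integral>z. h z \<partial>q) = 0" using cg(2) integral_distr[OF m, of "\<lambda>x. x"] by simp
    show "integrable q (\<lambda>z. (h z)\<^sup>2)" using cg(3) integrable_distr[OF m, of "\<lambda>x. x\<^sup>2"] by simp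
    show "(\<integral>z. (h z)\<^sup>2 \<partial>q) = quad_int Y (G g)" using cg(4) integral_distr[OF m, of "\<lambda>x. x\<^sup>2"] by simp
  qed
  have qst: "zero_mean_stationary q"
    unfolding zero_mean_stationary_def
  proof (intro conjI allI)
    show "prob_space q" "sets q = sets field_space" by (fact qps qsets)+
    show sq: "integrable q (\<lambda>z. (norm (z t))\<^sup>2)" for t
      unfolding norm_vec_square_sum using mom(3)[OF linear_filter_coordinate] by simp
    show "(\<integral>z. z t \<partial>q) = 0" for t
    proof -
      interpret q: prob_space q by (rule qps)
      have m: "(\<lambda>z. z t) \<in> borel_measurable q"
        unfolding measurable_cong_sets[OF qsets refl] field_space_def by (rule measurable_component_singleton) simp
      have "integrable q (\<lambda>z. z t)" by (rule q.integrable_of_norm_square[OF m sq])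
      then have "(\<integral>z. z t \<partial>q) $ j = (\<integral>z. z t $ j \<partial>q)" for j
        using integral_bounded_linear[OF bounded_linear_vec_nth] by metis
      then show ?thesis using mom(2)[OF linear_filter_coordinate] by (simp add: vec_eq_iff)
    qed
    fix s :: "int ^ 'd"
    show "distr q field_space (\<lambda>z t. z (t + s)) = q"
    proof (rule field_law_eqI_filter)
      show "prob_space (distr q field_space (\<lambda>z t. z (t + s)))"
        by (rule prob_space.prob_space_distr[OF qps sm[OF qsets]])
      fix h and g :: "real ^ 'd \<Rightarrow> complex ^ ('m + 'm)" assume hg: "linear_filter h g"
      have "distr (distr q field_space (\<lambda>z t. z (t + s))) borel h = distr q borel (\<lambda>z. h (\<lambda>t. z (t + s)))"
        using distr_distr[OF linear_filter_measurable[OF hg] sm[OF qsets]] by (simp add: o_def)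
      also have "\<dots> = centered_gaussian (quad_int Y (G (\<lambda>\<theta>. cis (- freq_pairing \<theta> s) *s g \<theta>)))"
        using law[OF linear_filter_shift[OF hg]] by simp
      also have "G (\<lambda>\<theta>. cis (- freq_pairing \<theta> s) *s g \<theta>) = (\<lambda>\<theta>. cis (- freq_pairing \<theta> s) *s G g \<theta>)"
      proof
        fix \<theta>
        have "inl_part (c *s v) = c *s inl_part v" "inr_part (c *s v) = c *s inr_part v" for c and v :: "complex ^ ('m + 'm)"
          by (simp_all add: inl_part_def inr_part_def vec_eq_iff)
        then show "G (\<lambda>\<theta>. cis (- freq_pairing \<theta> s) *s g \<theta>) \<theta> = cis (- freq_pairing \<theta> s) *s G g \<theta>"
          by (simp add: G_def matrix_vector_mult_vector_scale vector_add_ldistrib)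
      qed
      also have "quad_int Y \<dots> = quad_int Y (G g)" by (rule quad_int_phase)
      also have "centered_gaussian \<dots> = distr q borel h" using law[OF hg] by simp
      finally show "distr (distr q field_space (\<lambda>z t. z (t + s))) borel h = distr q borel h" .
    qed (use qps qsets in auto)
  qed
  have "gaussian_field q"
    unfolding gaussian_field_def
  proof (intro allI impI)
    fix U :: "(int ^ 'd) set" and a :: "int ^ 'd \<Rightarrow> real ^ ('m + 'm)" assume "finite U"
    then obtain g where "linear_filter (\<lambda>z. \<Sum>t\<in>U. a t \<bullet> z t) g" by (rule linear_filter_of_finite_sum)
    then show "gaussian_law (distr q borel (\<lambda>z. \<Sum>t\<in>U. a t \<bullet> z t))"
      using law centered_gaussian_law by metis
  qed
  with qst have qz: "zero_mean_gaussian_stationary q" by (simp add: zero_mean_gaussian_stationary_def)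
  have xm: "(\<lambda>z t. x_part (z t)) \<in> q \<rightarrow>\<^sub>M field_space" and ym: "(\<lambda>z t. y_part (z t)) \<in> (field_space :: (int ^ 'd \<Rightarrow> real ^ ('m + 'm)) measure) \<rightarrow>\<^sub>M field_space"
    by (auto intro!: measurable_field_spaceI simp: x_part_def y_part_def measurable_cong_sets[OF qsets refl] measurable_field_component)
  have "distr q field_space (\<lambda>z t. y_part (z t)) = distr py field_space (\<lambda>z t. y_part (W z t))"
    unfolding q_def using distr_distr[OF ym Wm] by (simp add: o_def)
  also have "(\<lambda>z t. y_part (W z t)) = (\<lambda>z. z)"
    by (simp add: y_part_def W_def fun_eq_iff vec_eq_iff)
  also have "distr py field_space (\<lambda>z. z) = py" using sets by (simp add: distr_id2)
  finally have ymarg: "distr q field_space (\<lambda>z t. y_part (z t)) = py" .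
  have xmarg: "distr q field_space (\<lambda>z t. x_part (z t)) = px"
  proof (rule field_law_eqI_filter)
    have pxst: "zero_mean_stationary px" "gaussian_field px" using px(1) by (auto simp: zero_mean_gaussian_stationary_def)
    then show "prob_space px" "sets px = sets field_space" by (auto simp: zero_mean_stationary_def)
    show "prob_space (distr q field_space (\<lambda>z t. x_part (z t)))" by (rule prob_space.prob_space_distr[OF qps xm])
    fix h and g :: "real ^ 'd \<Rightarrow> complex ^ 'm" assume hg: "linear_filter h g"
    from linear_filter_x_part[OF hg] obtain g' where g': "linear_filter (\<lambda>z. h (\<lambda>t. x_part (z t))) g'"
      "\<And>\<theta>. inl_part (g' \<theta>) = g \<theta> \<and> inr_part (g' \<theta>) = 0" by blast
    have "distr (distr q field_space (\<lambda>z t. x_part (z t))) borel h = distr q borel (\<lambda>z. h (\<lambda>t. x_part (z t)))"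
      using distr_distr[OF linear_filter_measurable[OF hg] xm] by (simp add: o_def)
    also have "\<dots> = centered_gaussian (quad_int Y (G g'))" using law[OF g'(1)] by simp
    also have "quad_int Y (G g') = quad_int X g"
    proof -
      have "G g' \<theta> \<bullet> (Y \<theta> *v G g' \<theta>) = g \<theta> \<bullet> (X \<theta> *v g \<theta>)" for \<theta>
      proof -
        have "G g' \<theta> = T \<theta> *v g \<theta>" using g'(2)[of \<theta>] by (simp add: G_def)
        then have "G g' \<theta> \<bullet> (Y \<theta> *v G g' \<theta>) = g \<theta> \<bullet> (T \<theta> *v (Y \<theta> *v (T \<theta> *v g \<theta>)))"
          using inner_adj[of "g \<theta>" "T \<theta>" "Y \<theta> *v (T \<theta> *v g \<theta>)"] by (simp add: T(3))
        then show ?thesis by (simp add: matrix_vector_mul_assoc X flip: matrix_mul_assoc) (simp add: matrix_mul_assoc X)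
      qed
      then show ?thesis by (simp add: quad_int_def)
    qed
    also have "centered_gaussian \<dots> = distr px borel h"
      using linear_filter_law[OF pxst(1) px(2,3) pxst(2) hg] by simp
    finally show "distr (distr q field_space (\<lambda>z t. x_part (z t))) borel h = distr px borel h" .
  qed simp
  have "q \<in> gaussian_couplings px py" using qz xmarg ymarg by (simp add: gaussian_couplings_def)
  moreover have "transport_cost q t = (\<integral>\<theta>. Re (trace (X \<theta> + Y \<theta> - 2 *\<^sub>R (T \<theta> ** Y \<theta>))) \<partial>torus_measure)"
  proof -
    define g where "g i \<theta> = axis (Inl i) (cis (- freq_pairing \<theta> t)) - axis (Inr i) (cis (- freq_pairing \<theta> t))" for i :: 'm and \<theta> :: "real ^ 'd"
    have g: "linear_filter (\<lambda>z. z t $ Inl i - z t $ Inr i) (g i)" for i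
      unfolding g_def[abs_def] by (intro linear_filter_diff linear_filter_coordinate)
    have Gg: "G (g i) = (\<lambda>\<theta>. cis (- freq_pairing \<theta> t) *s ((T \<theta> - mat 1) *v axis i 1))" for i
    proof
      fix \<theta>
      have "G (g i) \<theta> = T \<theta> *v axis i (cis (- freq_pairing \<theta> t)) - axis i (cis (- freq_pairing \<theta> t))"
        by (simp add: G_def g_def linear_simps[OF bounded_linear_inl_part] linear_simps[OF bounded_linear_inr_part])
      also have "\<dots> = cis (- freq_pairing \<theta> t) *s ((T \<theta> - mat 1) *v axis i 1)"
        by (subst (1 2) axis_scale) (simp add: matrix_vector_mult_vector_scale matrix_vector_mult_diff_rdistrib vector_ssub_ldistrib)
      finally show "G (g i) \<theta> = cis (- freq_pairing \<theta> t) *s ((T \<theta> - mat 1) *v axis i 1)" .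
    qed
    have Dm: "bdd_meas (\<lambda>\<theta>. (T \<theta> - mat 1) *v axis i 1)" for i
      by (intro bdd_meas_matrix_vector bdd_meas_diff T bdd_meas_const)
    have "transport_cost q t = (\<integral>z. (\<Sum>i\<in>UNIV. (z t $ Inl i - z t $ Inr i)\<^sup>2) \<partial>q)"
      unfolding transport_cost_def norm_vec_square_sum by (simp add: x_part_def y_part_def)
    also have "\<dots> = (\<Sum>i\<in>UNIV. quad_int Y (G (g i)))" using mom(3,4)[OF g] by simp
    also have "\<dots> = (\<Sum>i\<in>UNIV. \<integral>\<theta>. ((T \<theta> - mat 1) *v axis i 1) \<bullet> (Y \<theta> *v ((T \<theta> - mat 1) *v axis i 1)) \<partial>torus_measure)"
      by (simp only: Gg quad_int_phase) (simp only: quad_int_def)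
    also have "\<dots> = (\<integral>\<theta>. (\<Sum>i\<in>UNIV. ((T \<theta> - mat 1) *v axis i 1) \<bullet> (Y \<theta> *v ((T \<theta> - mat 1) *v axis i 1))) \<partial>torus_measure)"
      by (intro Bochner_Integration.integral_sum[symmetric] bdd_meas_integrable bdd_meas_inner bdd_meas_matrix_vector Dm py(3))
    also have "\<dots> = (\<integral>\<theta>. Re (trace (X \<theta> + Y \<theta> - 2 *\<^sub>R (T \<theta> ** Y \<theta>))) \<partial>torus_measure)"
    proof (rule Bochner_Integration.integral_cong[OF refl])
      fix \<theta>
      have "(\<Sum>i\<in>UNIV. ((T \<theta> - mat 1) *v axis i 1) \<bullet> (Y \<theta> *v ((T \<theta> - mat 1) *v axis i 1)))
          = Re (trace ((T \<theta> - mat 1) ** Y \<theta> ** (T \<theta> - mat 1)))"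
        using Re_trace_congruence[of "T \<theta> - mat 1" "Y \<theta>"] by (simp add: T(3))
      also have "(T \<theta> - mat 1) ** Y \<theta> ** (T \<theta> - mat 1) = X \<theta> + Y \<theta> - T \<theta> ** Y \<theta> - Y \<theta> ** T \<theta>"
        by (simp add: matrix_diff_ldistrib matrix_diff_rdistrib X algebra_simps)
      also have "Re (trace \<dots>) = Re (trace (X \<theta> + Y \<theta> - 2 *\<^sub>R (T \<theta> ** Y \<theta>)))"
        using trace_mul_sym[of "Y \<theta>" "T \<theta>"] by (simp add: trace_sub trace_add trace_scaleR)
      finally show "(\<Sum>i\<in>UNIV. ((T \<theta> - mat 1) *v axis i 1) \<bullet> (Y \<theta> *v ((T \<theta> - mat 1) *v axis i 1)))
          = Re (trace (X \<theta> + Y \<theta> - 2 *\<^sub>R (T \<theta> ** Y \<theta>)))" .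
    qed
    finally show ?thesis .
  qed
  ultimately show ?thesis using that by blast
qed

section \<open>The lower bound\<close>

lemma integrable_mult_of_squares:
  fixes u v :: "'a \<Rightarrow> real"
  assumes "u \<in> borel_measurable M" "v \<in> borel_measurable M"
    and "integrable M (\<lambda>x. (u x)\<^sup>2)" "integrable M (\<lambda>x. (v x)\<^sup>2)"
  shows "integrable M (\<lambda>x. u x * v x)"
proof (rule Bochner_Integration.integrable_bound)
  show "integrable M (\<lambda>x. (u x)\<^sup>2 + (v x)\<^sup>2)" using assms by simp
  show "AE x in M. norm (u x * v x) \<le> norm ((u x)\<^sup>2 + (v x)\<^sup>2)"
  proof (rule AE_I2)
    fix x
    have "2 * (\<bar>u x\<bar> * \<bar>v x\<bar>) \<le> (u x)\<^sup>2 + (v x)\<^sup>2" using sum_squares_bound[of "\<bar>u x\<bar>" "\<bar>v x\<bar>"] by simp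
    moreover have "0 \<le> \<bar>u x\<bar> * \<bar>v x\<bar>" by simp
    ultimately have "\<bar>u x\<bar> * \<bar>v x\<bar> \<le> (u x)\<^sup>2 + (v x)\<^sup>2" by linarith
    then show "norm (u x * v x) \<le> norm ((u x)\<^sup>2 + (v x)\<^sup>2)" by (simp add: abs_mult)
  qed
qed (use assms in simp)

lemma bounded_bilinear_vector_scale:
  "bounded_bilinear ((*s) :: complex \<Rightarrow> complex ^ 'm \<Rightarrow> complex ^ 'm)"
  by (intro bounded_bilinear.intro exI[of _ 1])
    (simp_all add: vector_sadd_rdistrib vector_add_ldistrib norm_vector_scale, simp_all add: vec_eq_iff)

lemmas bdd_meas_vector_scale = bdd_meas_bounded_bilinear[OF bounded_bilinear_vector_scale]

lemma bdd_meas_filter_mismatch: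
  fixes f g :: "'m::finite \<Rightarrow> real ^ 'd \<Rightarrow> complex ^ 'm"
  assumes "\<And>i. bdd_meas (g i)" "\<And>i. bdd_meas (f i)"
  shows "bdd_meas (\<lambda>\<theta>. axis k 1 - (\<Sum>i\<in>UNIV. cnj (g i \<theta> $ k) *s f i \<theta>))"
  by (intro bdd_meas_diff bdd_meas_const bdd_meas_sum bdd_meas_vector_scale
      bdd_meas_bounded_linear[OF bounded_linear_cnj] bdd_meas_vec_nth assms)

definition x_field :: "(int ^ 'd \<Rightarrow> real ^ ('m::finite + 'm)) \<Rightarrow> int ^ 'd \<Rightarrow> real ^ 'm" where
  "x_field z t = x_part (z t)"

definition y_field :: "(int ^ 'd \<Rightarrow> real ^ ('m::finite + 'm)) \<Rightarrow> int ^ 'd \<Rightarrow> real ^ 'm" where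
  "y_field z t = y_part (z t)"

lemma measurable_x_field: "x_field \<in> field_space \<rightarrow>\<^sub>M field_space"
  and measurable_y_field: "y_field \<in> field_space \<rightarrow>\<^sub>M field_space"
  by (auto intro!: measurable_field_spaceI simp: x_field_def y_field_def x_part_def y_part_def measurable_field_component)

context
  fixes q :: "(int ^ 'd \<Rightarrow> real ^ ('m::finite + 'm)) measure" and px py X Y
  assumes q: "zero_mean_stationary q"
    and qx: "distr q field_space x_field = px" and qy: "distr q field_space y_field = py"
    and px: "zero_mean_stationary px" "spectral_density px X" "bdd_meas X"
    and py: "zero_mean_stationary py" "spectral_density py Y" "bdd_meas Y"
begin

lemma coupling_measurable:
  shows "x_field \<in> q \<rightarrow>\<^sub>M field_space" "y_field \<in> q \<rightarrow>\<^sub>M field_space"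
    "linear_filter l f \<Longrightarrow> (\<lambda>z. l (x_field z)) \<in> borel_measurable q"
    "linear_filter l f \<Longrightarrow> (\<lambda>z. l (y_field z)) \<in> borel_measurable q"
proof -
  have sets: "sets q = sets field_space" using q by (simp add: zero_mean_stationary_def)
  show x: "x_field \<in> q \<rightarrow>\<^sub>M field_space" and y: "y_field \<in> q \<rightarrow>\<^sub>M field_space"
    using measurable_x_field measurable_y_field by (simp_all add: measurable_cong_sets[OF sets refl])
  show "(\<lambda>z. l (x_field z)) \<in> borel_measurable q" "(\<lambda>z. l (y_field z)) \<in> borel_measurable q" if "linear_filter l f"
    using measurable_compose[OF x linear_filter_measurable[OF that]]
      measurable_compose[OF y linear_filter_measurable[OF that]] .
qed

lemma coupling_variance:
  assumes l: "linear_filter l f"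
  shows "integrable q (\<lambda>z. (l (x_field z))\<^sup>2)" "(\<integral>z. (l (x_field z))\<^sup>2 \<partial>q) = quad_int X f"
    "integrable q (\<lambda>z. (l (y_field z))\<^sup>2)" "(\<integral>z. (l (y_field z))\<^sup>2 \<partial>q) = quad_int Y f"
proof -
  have m: "(\<lambda>z. (l z)\<^sup>2) \<in> borel_measurable field_space" using linear_filter_measurable[OF l] by simp
  note vx = linear_filter_variance[OF px l] and vy = linear_filter_variance[OF py l]
  show "integrable q (\<lambda>z. (l (x_field z))\<^sup>2)" "(\<integral>z. (l (x_field z))\<^sup>2 \<partial>q) = quad_int X f"
    using vx integrable_distr[OF coupling_measurable(1), of "\<lambda>z. (l z)\<^sup>2"]
      integral_distr[OF coupling_measurable(1) m] by (simp_all add: qx)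
  show "integrable q (\<lambda>z. (l (y_field z))\<^sup>2)" "(\<integral>z. (l (y_field z))\<^sup>2 \<partial>q) = quad_int Y f"
    using vy integrable_distr[OF coupling_measurable(2), of "\<lambda>z. (l z)\<^sup>2"]
      integral_distr[OF coupling_measurable(2) m] by (simp_all add: qy)
qed

lemma coupling_integrable:
  assumes "linear_filter l f" "linear_filter m g"
  shows "integrable q (\<lambda>z. l (x_field z) * m (y_field z))"
  by (rule integrable_mult_of_squares[OF coupling_measurable(3)[OF assms(1)] coupling_measurable(4)[OF assms(2)]
        coupling_variance(1)[OF assms(1)] coupling_variance(3)[OF assms(2)]])

text \<open>Stationarity moves a filter from \<open>y\<close> to \<open>x\<close>, its symbol being replaced by the adjoint.\<close>

lemma coupling_move_filter:
  assumes l: "linear_filter l f" and m: "linear_filter m g"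
  shows "\<exists>L. (\<forall>k. linear_filter (L k) (\<lambda>\<theta>. cnj (g \<theta> $ k) *s f \<theta>)) \<and>
    (\<integral>z. l (x_field z) * m (y_field z) \<partial>q) = (\<Sum>k\<in>UNIV. \<integral>z. L k (x_field z) * y_field z 0 $ k \<partial>q)"
  using m
proof (induction rule: linear_filter.induct)
  case (coordinate r s j)
  define L where "L k z = (if k = j then r * l (\<lambda>t. z (t + - s)) else 0)" for k z
  have L: "linear_filter (L k) (\<lambda>\<theta>. cnj (axis j (complex_of_real r * cis (- freq_pairing \<theta> s)) $ k) *s f \<theta>)" for k
  proof (cases "k = j")
    case True
    have "r *\<^sub>R (cis (- freq_pairing \<theta> (- s)) *s f \<theta>) = cnj (axis j (complex_of_real r * cis (- freq_pairing \<theta> s)) $ k) *s f \<theta>" for \<theta>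
      using True by (simp add: vec_eq_iff axis_def freq_pairing_minus cis_cnj) (simp add: scaleR_conv_of_real)
    then show ?thesis using linear_filter_scale[OF linear_filter_shift[OF l, of "- s"], of r] True by (simp add: L_def[abs_def])
  next
    case False
    have "L k = (\<lambda>_. 0)" using False by (simp add: L_def fun_eq_iff)
    moreover have "(\<lambda>\<theta>. cnj (axis j (complex_of_real r * cis (- freq_pairing \<theta> s)) $ k) *s f \<theta>) = (\<lambda>_. 0)"
      using False by (auto simp: axis_def fun_eq_iff vec_eq_iff)
    ultimately show ?thesis using linear_filter_zero by simp
  qed
  have mm: "(\<lambda>z. l (\<lambda>t. x_field z (t + - s)) * (r * y_field z 0 $ j)) \<in> borel_measurable field_space"
    using measurable_compose[OF measurable_x_field linear_filter_measurable[OF linear_filter_shift[OF l, of "- s"]]]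
      measurable_compose[OF measurable_y_field measurable_field_component[of 0 j]] by measurable
  have "(\<integral>z. l (x_field z) * (r * y_field z s $ j) \<partial>q) = (\<integral>z. l (\<lambda>t. x_field z (t + - s)) * (r * y_field z 0 $ j) \<partial>q)"
    using zero_mean_stationary_shift[OF q mm, of s] by (simp add: x_field_def[abs_def] y_field_def[abs_def])
  also have "\<dots> = (\<Sum>k\<in>UNIV. \<integral>z. L k (x_field z) * y_field z 0 $ k \<partial>q)"
  proof -
    have "(\<Sum>k\<in>UNIV. \<integral>z. L k (x_field z) * y_field z 0 $ k \<partial>q) =
        (\<Sum>k\<in>UNIV. if k = j then (\<integral>z. l (\<lambda>t. x_field z (t + - s)) * (r * y_field z 0 $ j) \<partial>q) else 0)"
      by (intro sum.cong refl) (auto simp: L_def mult_ac)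
    then show ?thesis by simp
  qed
  finally show ?case using L by (intro exI[of _ L]) blast
next
  case (add m g m' g')
  then obtain L L' where L: "\<And>k. linear_filter (L k) (\<lambda>\<theta>. cnj (g \<theta> $ k) *s f \<theta>)"
      "(\<integral>z. l (x_field z) * m (y_field z) \<partial>q) = (\<Sum>k\<in>UNIV. \<integral>z. L k (x_field z) * y_field z 0 $ k \<partial>q)"
    and L': "\<And>k. linear_filter (L' k) (\<lambda>\<theta>. cnj (g' \<theta> $ k) *s f \<theta>)"
      "(\<integral>z. l (x_field z) * m' (y_field z) \<partial>q) = (\<Sum>k\<in>UNIV. \<integral>z. L' k (x_field z) * y_field z 0 $ k \<partial>q)"
    by blast
  have "linear_filter (\<lambda>z. L k z + L' k z) (\<lambda>\<theta>. cnj ((g \<theta> + g' \<theta>) $ k) *s f \<theta>)" for k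
    using linear_filter.add[OF L(1)[of k] L'(1)[of k]] by (simp add: vector_sadd_rdistrib)
  moreover have "(\<integral>z. l (x_field z) * (m (y_field z) + m' (y_field z)) \<partial>q) =
      (\<Sum>k\<in>UNIV. \<integral>z. (L k (x_field z) + L' k (x_field z)) * y_field z 0 $ k \<partial>q)"
    using coupling_integrable[OF l add.hyps(1)] coupling_integrable[OF l add.hyps(2)]
      coupling_integrable[OF L(1) linear_filter_coordinate] coupling_integrable[OF L'(1) linear_filter_coordinate]
    by (simp add: distrib_left distrib_right L(2) L'(2) sum.distrib)
  ultimately show ?case by (intro exI[of _ "\<lambda>k z. L k z + L' k z"]) blast
qed

lemma coupling_cross_le:
  fixes l m :: "'m \<Rightarrow> _"
  assumes l: "\<And>i. linear_filter (l i) (f i)" and m: "\<And>i. linear_filter (m i) (g i)" and \<delta>: "0 < \<delta>"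
  defines "h \<equiv> \<lambda>k \<theta>. axis k 1 - (\<Sum>i\<in>UNIV. cnj (g i \<theta> $ k) *s f i \<theta>)"
  shows "2 * (\<Sum>k\<in>UNIV. \<integral>z. x_field z 0 $ k * y_field z 0 $ k \<partial>q)
    \<le> (\<Sum>i\<in>UNIV. quad_int X (f i) + quad_int Y (g i)) +
      (\<Sum>k\<in>UNIV. quad_int X (h k) / \<delta> + \<delta> * (\<integral>z. (y_field z 0 $ k)\<^sup>2 \<partial>q))"
proof -
  have "\<forall>i. \<exists>L. (\<forall>k. linear_filter (L k) (\<lambda>\<theta>. cnj (g i \<theta> $ k) *s f i \<theta>)) \<and>
    (\<integral>z. l i (x_field z) * m i (y_field z) \<partial>q) = (\<Sum>k\<in>UNIV. \<integral>z. L k (x_field z) * y_field z 0 $ k \<partial>q)"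
    using coupling_move_filter[OF l m] ..
  from choice[OF this] obtain L where L: "\<And>i k. linear_filter (L i k) (\<lambda>\<theta>. cnj (g i \<theta> $ k) *s f i \<theta>)"
    "\<And>i. (\<integral>z. l i (x_field z) * m i (y_field z) \<partial>q) = (\<Sum>k\<in>UNIV. \<integral>z. L i k (x_field z) * y_field z 0 $ k \<partial>q)" by blast
  define H where "H k z = z 0 $ k - (\<Sum>i\<in>UNIV. L i k z)" for k and z :: "int ^ 'd \<Rightarrow> real ^ 'm"
  have c0: "linear_filter (\<lambda>z. z 0 $ k) (\<lambda>\<theta>. axis k 1)" for k
    using linear_filter_coordinate[of 0 k] by simp
  have H: "linear_filter (H k) (h k)" for k
    unfolding H_def[abs_def] h_def by (intro linear_filter_diff linear_filter_sum L(1) c0)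
  have iL: "integrable q (\<lambda>z. L i k (x_field z) * y_field z 0 $ k)" for i k
    by (rule coupling_integrable[OF L(1) c0])
  have iH: "integrable q (\<lambda>z. H k (x_field z) * y_field z 0 $ k)" for k
    by (rule coupling_integrable[OF H c0])
  have "(\<Sum>k\<in>UNIV. \<integral>z. x_field z 0 $ k * y_field z 0 $ k \<partial>q)
      = (\<Sum>k\<in>UNIV. (\<integral>z. H k (x_field z) * y_field z 0 $ k \<partial>q) + (\<Sum>i\<in>UNIV. \<integral>z. L i k (x_field z) * y_field z 0 $ k \<partial>q))"
  proof (rule sum.cong[OF refl])
    fix k
    have "x_field z 0 $ k * y_field z 0 $ k = H k (x_field z) * y_field z 0 $ k + (\<Sum>i\<in>UNIV. L i k (x_field z) * y_field z 0 $ k)" for z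
      by (simp add: H_def left_diff_distrib sum_distrib_right)
    then show "(\<integral>z. x_field z 0 $ k * y_field z 0 $ k \<partial>q) =
        (\<integral>z. H k (x_field z) * y_field z 0 $ k \<partial>q) + (\<Sum>i\<in>UNIV. \<integral>z. L i k (x_field z) * y_field z 0 $ k \<partial>q)"
      using iH iL by simp
  qed
  also have "\<dots> = (\<Sum>k\<in>UNIV. \<integral>z. H k (x_field z) * y_field z 0 $ k \<partial>q) + (\<Sum>i\<in>UNIV. \<integral>z. l i (x_field z) * m i (y_field z) \<partial>q)"
    unfolding sum.distrib L(2) by (subst sum.swap) (rule refl)
  finally have eq: "(\<Sum>k\<in>UNIV. \<integral>z. x_field z 0 $ k * y_field z 0 $ k \<partial>q)
      = (\<Sum>k\<in>UNIV. \<integral>z. H k (x_field z) * y_field z 0 $ k \<partial>q) + (\<Sum>i\<in>UNIV. \<integral>z. l i (x_field z) * m i (y_field z) \<partial>q)" .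
  have "2 * (\<integral>z. l i (x_field z) * m i (y_field z) \<partial>q) \<le> quad_int X (f i) + quad_int Y (g i)" for i
  proof -
    have "(\<integral>z. 2 * (l i (x_field z) * m i (y_field z)) \<partial>q) \<le> (\<integral>z. (l i (x_field z))\<^sup>2 + (m i (y_field z))\<^sup>2 \<partial>q)"
    proof (rule integral_mono)
      show "2 * (l i (x_field z) * m i (y_field z)) \<le> (l i (x_field z))\<^sup>2 + (m i (y_field z))\<^sup>2" for z
        using sum_squares_bound[of "l i (x_field z)" "m i (y_field z)"] by (simp only: mult.assoc)
      show "integrable q (\<lambda>z. 2 * (l i (x_field z) * m i (y_field z)))"
        by (intro integrable_mult_right coupling_integrable[OF l m])
      show "integrable q (\<lambda>z. (l i (x_field z))\<^sup>2 + (m i (y_field z))\<^sup>2)"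
        by (intro Bochner_Integration.integrable_add coupling_variance(1)[OF l] coupling_variance(3)[OF m])
    qed
    then show ?thesis
      using coupling_variance(1,2)[OF l] coupling_variance(3,4)[OF m] by simp
  qed
  moreover have "2 * (\<integral>z. H k (x_field z) * y_field z 0 $ k \<partial>q) \<le> quad_int X (h k) / \<delta> + \<delta> * (\<integral>z. (y_field z 0 $ k)\<^sup>2 \<partial>q)" for k
  proof -
    have "(\<integral>z. 2 * (H k (x_field z) * y_field z 0 $ k) \<partial>q) \<le> (\<integral>z. (H k (x_field z))\<^sup>2 / \<delta> + \<delta> * (y_field z 0 $ k)\<^sup>2 \<partial>q)"
    proof (rule integral_mono)
      fix z
      have "2 * (H k (x_field z) / sqrt \<delta>) * (sqrt \<delta> * y_field z 0 $ k) \<le> (H k (x_field z) / sqrt \<delta>)\<^sup>2 + (sqrt \<delta> * y_field z 0 $ k)\<^sup>2"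
        by (rule sum_squares_bound)
      then show "2 * (H k (x_field z) * y_field z 0 $ k) \<le> (H k (x_field z))\<^sup>2 / \<delta> + \<delta> * (y_field z 0 $ k)\<^sup>2"
        using \<delta> by (simp add: power_divide power_mult_distrib)
    qed (use iH coupling_variance(1)[OF H] coupling_variance(3)[OF c0] in auto)
    then show ?thesis
      using coupling_variance(1,2)[OF H] coupling_variance(3)[OF c0] by simp
  qed
  ultimately have "(\<Sum>k\<in>UNIV. 2 * (\<integral>z. H k (x_field z) * y_field z 0 $ k \<partial>q)) + (\<Sum>i\<in>UNIV. 2 * (\<integral>z. l i (x_field z) * m i (y_field z) \<partial>q))
      \<le> (\<Sum>k\<in>UNIV. quad_int X (h k) / \<delta> + \<delta> * (\<integral>z. (y_field z 0 $ k)\<^sup>2 \<partial>q)) + (\<Sum>i\<in>UNIV. quad_int X (f i) + quad_int Y (g i))"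
    by (intro add_mono sum_mono)
  then show ?thesis unfolding eq by (simp add: sum_distrib_left distrib_left)
qed

end

lemma inverse_filters_approx:
  fixes S S' :: "real ^ 'd \<Rightarrow> complex ^ 'm ^ 'm"
  assumes S: "bdd_meas S" "\<And>\<theta>. S (refl_torus \<theta>) = cconj (S \<theta>)" "\<And>\<theta>. adj (S \<theta>) = S \<theta>"
    and S': "bdd_meas S'" "\<And>\<theta>. S' (refl_torus \<theta>) = cconj (S' \<theta>)" and inv: "\<And>\<theta>. S' \<theta> ** S \<theta> = mat 1"
  obtains l f m g where "\<And>i n. linear_filter (l i n) (f i n)" "\<And>i n. linear_filter (m i n) (g i n)"
    "\<And>i. (\<lambda>n. \<integral>\<theta>. (norm (f i n \<theta> - S' \<theta> *v axis i 1))\<^sup>2 \<partial>torus_measure) \<longlonglongrightarrow> 0"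
    "\<And>i. (\<lambda>n. \<integral>\<theta>. (norm (g i n \<theta> - S \<theta> *v axis i 1))\<^sup>2 \<partial>torus_measure) \<longlonglongrightarrow> 0"
    "\<And>k. (\<lambda>n. \<integral>\<theta>. (norm (axis k 1 - (\<Sum>i\<in>UNIV. cnj (g i n \<theta> $ k) *s f i n \<theta>)))\<^sup>2 \<partial>torus_measure) \<longlonglongrightarrow> 0"
proof -
  let ?N = "real CARD('m)"
  have Sc: "bdd_meas (\<lambda>\<theta>. S \<theta> *v axis i 1)" "bdd_meas (\<lambda>\<theta>. S' \<theta> *v axis i 1)" for i
    by (intro bdd_meas_matrix_vector S S' bdd_meas_const)+
  have dense: "\<exists>lf. linear_filter (fst lf) (snd lf) \<and> (\<integral>\<theta>. (norm (snd lf \<theta> - R \<theta> *v axis i 1))\<^sup>2 \<partial>torus_measure) < e"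
    if "0 < e" "bdd_meas (\<lambda>\<theta>. R \<theta> *v axis i 1)" "\<And>\<theta>. R (refl_torus \<theta>) = cconj (R \<theta>)"
    for e i and R :: "real ^ 'd \<Rightarrow> complex ^ 'm ^ 'm"
  proof -
    have "(R (refl_torus \<theta>) *v axis i 1) $ k = cnj ((R \<theta> *v axis i 1) $ k)" for \<theta> k
      by (rule symmetric_column) (rule that)
    from linear_filter_dense[OF that(2) this that(1)] obtain l f where
      "linear_filter l f" "(\<integral>\<theta>. (norm (f \<theta> - R \<theta> *v axis i 1))\<^sup>2 \<partial>torus_measure) < e" by blast
    then show ?thesis by (intro exI[of _ "(l, f)"]) simp
  qed
  define a where "a n = 1 / (real n + 1)" for n
  have a: "0 < a n" for n by (simp add: a_def)
  have alim: "a \<longlonglongrightarrow> 0" unfolding a_def using LIMSEQ_inverse_real_of_nat by (simp add: inverse_eq_divide add.commute)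
  have "\<forall>x. \<exists>lf. linear_filter (fst lf) (snd lf) \<and> (\<integral>\<theta>. (norm (snd lf \<theta> - S \<theta> *v axis (fst x) 1))\<^sup>2 \<partial>torus_measure) < a (snd x)"
    using dense[OF a Sc(1) S(2)] by blast
  from choice[OF this] obtain mg where mg: "\<And>i n. linear_filter (fst (mg (i, n))) (snd (mg (i, n)))"
    "\<And>i n. (\<integral>\<theta>. (norm (snd (mg (i, n)) \<theta> - S \<theta> *v axis i 1))\<^sup>2 \<partial>torus_measure) < a n" by fastforce
  define m g where "m i n = fst (mg (i, n))" and "g i n = snd (mg (i, n))" for i n
  have m: "linear_filter (m i n) (g i n)" and gS: "(\<integral>\<theta>. (norm (g i n \<theta> - S \<theta> *v axis i 1))\<^sup>2 \<partial>torus_measure) < a n" for i n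
    using mg by (auto simp: m_def g_def)
  have gm: "bdd_meas (g i n)" for i n by (rule linear_filter_bdd_meas[OF m])
  have "\<forall>n. \<exists>B. 0 < B \<and> (\<forall>i \<theta>. norm (g i n \<theta>) \<le> B)"
  proof
    fix n
    have "\<forall>i. \<exists>B. 0 < B \<and> (\<forall>\<theta>. norm (g i n \<theta>) \<le> B)" using gm by (meson bdd_measE)
    from choice[OF this] obtain B where B: "\<And>i. 0 < B i" "\<And>i \<theta>. norm (g i n \<theta>) \<le> B i" by blast
    have "B i \<le> (\<Sum>i\<in>UNIV. B i)" for i using B(1) by (intro member_le_sum) (auto intro: less_imp_le)
    then have "norm (g i n \<theta>) \<le> (\<Sum>i\<in>UNIV. B i)" for i \<theta> by (rule order_trans[OF B(2)])
    then show "\<exists>B. 0 < B \<and> (\<forall>i \<theta>. norm (g i n \<theta>) \<le> B)"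
      using B(1) by (intro exI[of _ "\<Sum>i\<in>UNIV. B i"]) (auto intro!: sum_pos)
  qed
  from choice[OF this] obtain B where B: "\<And>n. 0 < B n" "\<And>i n \<theta>. norm (g i n \<theta>) \<le> B n" by blast
  define b where "b n = min (a n) (a n / (B n)\<^sup>2)" for n
  have b: "0 < b n" "b n \<le> a n" "(B n)\<^sup>2 * b n \<le> a n" for n
  proof -
    have "0 < (B n)\<^sup>2" using B(1)[of n] by simp
    then show "0 < b n" using a[of n] by (simp add: b_def)
    show "b n \<le> a n" by (simp add: b_def)
    have "(B n)\<^sup>2 * b n \<le> (B n)\<^sup>2 * (a n / (B n)\<^sup>2)" by (intro mult_left_mono) (auto simp: b_def)
    then show "(B n)\<^sup>2 * b n \<le> a n" using B(1)[of n] by simp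
  qed
  have "\<forall>x. \<exists>lf. linear_filter (fst lf) (snd lf) \<and> (\<integral>\<theta>. (norm (snd lf \<theta> - S' \<theta> *v axis (fst x) 1))\<^sup>2 \<partial>torus_measure) < b (snd x)"
    using dense[OF b(1) Sc(2) S'(2)] by blast
  from choice[OF this] obtain lf where lf: "\<And>i n. linear_filter (fst (lf (i, n))) (snd (lf (i, n)))"
    "\<And>i n. (\<integral>\<theta>. (norm (snd (lf (i, n)) \<theta> - S' \<theta> *v axis i 1))\<^sup>2 \<partial>torus_measure) < b n" by fastforce
  define l f where "l i n = fst (lf (i, n))" and "f i n = snd (lf (i, n))" for i n
  have l: "linear_filter (l i n) (f i n)" and fS: "(\<integral>\<theta>. (norm (f i n \<theta> - S' \<theta> *v axis i 1))\<^sup>2 \<partial>torus_measure) < b n" for i n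
    using lf by (auto simp: l_def f_def)
  have fm: "bdd_meas (f i n)" for i n by (rule linear_filter_bdd_meas[OF l])
  from S'(1) obtain K where K: "0 < K" "\<And>\<theta>. norm (S' \<theta>) \<le> K" by (meson bdd_measE)
  have Kv: "norm (S' \<theta> *v axis i 1) \<le> K" for \<theta> i
    using op_boundD[OF op_bound_norm, of "S' \<theta>" "axis i 1"] K(2)[of \<theta>] by (simp add: norm_axis_eq)
  have squeeze: "u \<longlonglongrightarrow> 0" if "\<And>n. 0 \<le> u n" "\<And>n. u n \<le> c * a n" for u :: "nat \<Rightarrow> real" and c
  proof (rule tendsto_sandwich[OF _ _ tendsto_const])
    show "(\<lambda>n. c * a n) \<longlonglongrightarrow> 0" using tendsto_mult_left[OF alim, of c] by simp
  qed (use that in auto)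
  define h where "h k n \<theta> = axis k 1 - (\<Sum>i\<in>UNIV. cnj (g i n \<theta> $ k) *s f i n \<theta>)" for k n \<theta>
  have hm: "bdd_meas (h k n)" for k n
    unfolding h_def[abs_def] by (rule bdd_meas_filter_mismatch[OF gm fm])
  have hb: "(norm (h k n \<theta>))\<^sup>2 \<le> ?N * (\<Sum>i\<in>UNIV. 2 * K\<^sup>2 * (norm (g i n \<theta> - S \<theta> *v axis i 1))\<^sup>2
      + 2 * (B n)\<^sup>2 * (norm (f i n \<theta> - S' \<theta> *v axis i 1))\<^sup>2)" for k n \<theta>
  proof -
    have e: "axis k 1 = (\<Sum>i\<in>UNIV. cnj ((S \<theta> *v axis i 1) $ k) *s (S' \<theta> *v axis i 1))"
    proof -
      have "axis k 1 = S' \<theta> *v (S \<theta> *v axis k 1)" by (simp add: matrix_vector_mul_assoc inv)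
      also have "S \<theta> *v axis k 1 = (\<Sum>i\<in>UNIV. cnj ((S \<theta> *v axis i 1) $ k) *s axis i 1)"
      proof -
        have "S \<theta> $ i $ k = cnj (S \<theta> $ k $ i)" for i using S(3)[of \<theta>] by (metis adj_nth)
        then show ?thesis
          unfolding matrix_vector_axis vec_eq_iff by (simp add: axis_def if_distrib cong: if_cong)
      qed
      also have "S' \<theta> *v \<dots> = (\<Sum>i\<in>UNIV. S' \<theta> *v (cnj ((S \<theta> *v axis i 1) $ k) *s axis i 1))"
        by (rule linear_sum[OF bounded_linear.linear[OF bounded_bilinear.bounded_linear_right[OF bounded_bilinear_matrix_vector]]])
      finally show ?thesis by (simp add: matrix_vector_mult_vector_scale)
    qed
    let ?u = "\<lambda>i. g i n \<theta> - S \<theta> *v axis i 1" and ?v = "\<lambda>i. f i n \<theta> - S' \<theta> *v axis i 1"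
    have "h k n \<theta> = - (\<Sum>i\<in>UNIV. cnj (?u i $ k) *s (S' \<theta> *v axis i 1) + cnj (g i n \<theta> $ k) *s ?v i)"
      unfolding h_def by (subst e) (simp add: vec_eq_iff sum_subtractf[symmetric] sum_negf[symmetric] algebra_simps)
    then have "norm (h k n \<theta>) = norm (\<Sum>i\<in>UNIV. cnj (?u i $ k) *s (S' \<theta> *v axis i 1) + cnj (g i n \<theta> $ k) *s ?v i)"
      by (simp only: norm_minus_cancel)
    also have "\<dots> \<le> (\<Sum>i\<in>UNIV. K * norm (?u i) + B n * norm (?v i))"
    proof (rule sum_norm_le)
      fix i
      have "norm (cnj (?u i $ k) *s (S' \<theta> *v axis i 1)) \<le> norm (?u i) * K"
        unfolding norm_vector_scale complex_mod_cnj by (intro mult_mono Kv Finite_Cartesian_Product.norm_nth_le) auto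
      moreover have "norm (cnj (g i n \<theta> $ k) *s ?v i) \<le> B n * norm (?v i)"
        unfolding norm_vector_scale complex_mod_cnj
        by (intro mult_right_mono order_trans[OF Finite_Cartesian_Product.norm_nth_le B(2)]) auto
      ultimately show "norm (cnj (?u i $ k) *s (S' \<theta> *v axis i 1) + cnj (g i n \<theta> $ k) *s ?v i) \<le> K * norm (?u i) + B n * norm (?v i)"
        by (intro norm_triangle_mono) (simp_all only: mult.commute[of K])
    qed
    finally have "(norm (h k n \<theta>))\<^sup>2 \<le> (\<Sum>i\<in>UNIV. K * norm (?u i) + B n * norm (?v i))\<^sup>2"
      by (rule power_mono) simp
    also have "\<dots> \<le> (\<Sum>i\<in>UNIV. (K * norm (?u i) + B n * norm (?v i))\<^sup>2) * ?N"
      by (rule sum_squared_le_sum_of_squares)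
    also have "\<dots> \<le> (\<Sum>i\<in>UNIV. 2 * K\<^sup>2 * (norm (?u i))\<^sup>2 + 2 * (B n)\<^sup>2 * (norm (?v i))\<^sup>2) * ?N"
    proof (intro mult_right_mono sum_mono)
      fix i
      show "(K * norm (?u i) + B n * norm (?v i))\<^sup>2 \<le> 2 * K\<^sup>2 * (norm (?u i))\<^sup>2 + 2 * (B n)\<^sup>2 * (norm (?v i))\<^sup>2"
        using norm_add_square_le[of "K * norm (?u i)" "B n * norm (?v i)"] by (simp add: power_mult_distrib)
    qed simp
    finally show ?thesis by (simp add: mult.commute)
  qed
  have iu: "integrable torus_measure (\<lambda>\<theta>. (norm (g i n \<theta> - S \<theta> *v axis i 1))\<^sup>2)"
    and iv: "integrable torus_measure (\<lambda>\<theta>. (norm (f i n \<theta> - S' \<theta> *v axis i 1))\<^sup>2)" for i n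
    by (intro bdd_meas_integrable bdd_meas_norm_power bdd_meas_diff gm fm Sc)+
  have hI: "(\<integral>\<theta>. (norm (h k n \<theta>))\<^sup>2 \<partial>torus_measure) \<le> (?N * (?N * (2 * K\<^sup>2 + 2))) * a n" for k n
  proof -
    have "(\<integral>\<theta>. (norm (h k n \<theta>))\<^sup>2 \<partial>torus_measure)
      \<le> (\<integral>\<theta>. ?N * (\<Sum>i\<in>UNIV. 2 * K\<^sup>2 * (norm (g i n \<theta> - S \<theta> *v axis i 1))\<^sup>2
      + 2 * (B n)\<^sup>2 * (norm (f i n \<theta> - S' \<theta> *v axis i 1))\<^sup>2) \<partial>torus_measure)"
    proof (rule integral_mono)
      show "integrable torus_measure (\<lambda>\<theta>. (norm (h k n \<theta>))\<^sup>2)"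
        by (intro bdd_meas_integrable bdd_meas_norm_power hm)
    qed (use iu iv hb in auto)
    also have "\<dots> = ?N * (\<Sum>i\<in>UNIV. 2 * K\<^sup>2 * (\<integral>\<theta>. (norm (g i n \<theta> - S \<theta> *v axis i 1))\<^sup>2 \<partial>torus_measure)
      + 2 * (B n)\<^sup>2 * (\<integral>\<theta>. (norm (f i n \<theta> - S' \<theta> *v axis i 1))\<^sup>2 \<partial>torus_measure))"
      using iu iv by simp
    also have "\<dots> \<le> ?N * (\<Sum>i\<in>(UNIV :: 'm set). 2 * K\<^sup>2 * a n + 2 * (B n)\<^sup>2 * b n)"
      by (intro mult_left_mono sum_mono add_mono less_imp_le[OF gS] less_imp_le[OF fS]) auto
    also have "\<dots> \<le> ?N * (\<Sum>i\<in>(UNIV :: 'm set). 2 * K\<^sup>2 * a n + 2 * a n)"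
      using b(3)[of n] by (intro mult_left_mono sum_mono add_mono) auto
    also have "\<dots> = (?N * (?N * (2 * K\<^sup>2 + 2))) * a n" by (simp add: algebra_simps)
    finally show ?thesis .
  qed
  show ?thesis
  proof (rule that[OF l m])
    show "(\<lambda>n. \<integral>\<theta>. (norm (f i n \<theta> - S' \<theta> *v axis i 1))\<^sup>2 \<partial>torus_measure) \<longlonglongrightarrow> 0" for i
    proof (rule squeeze[where c = 1])
      show "(\<integral>\<theta>. (norm (f i n \<theta> - S' \<theta> *v axis i 1))\<^sup>2 \<partial>torus_measure) \<le> 1 * a n" for n
        using fS[of i n] b(2)[of n] by simp
    qed simp
    show "(\<lambda>n. \<integral>\<theta>. (norm (g i n \<theta> - S \<theta> *v axis i 1))\<^sup>2 \<partial>torus_measure) \<longlonglongrightarrow> 0" for i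
    proof (rule squeeze[where c = 1])
      show "(\<integral>\<theta>. (norm (g i n \<theta> - S \<theta> *v axis i 1))\<^sup>2 \<partial>torus_measure) \<le> 1 * a n" for n
        using gS[of i n] by simp
    qed simp
    show "(\<lambda>n. \<integral>\<theta>. (norm (axis k 1 - (\<Sum>i\<in>UNIV. cnj (g i n \<theta> $ k) *s f i n \<theta>)))\<^sup>2 \<partial>torus_measure) \<longlonglongrightarrow> 0" for k
      using squeeze[OF _ hI[of k]] by (simp add: h_def)
  qed
qed

lemma coupling_cost_ge:
  fixes q :: "(int ^ 'd \<Rightarrow> real ^ ('m::finite + 'm)) measure" and px py X Y
  assumes q: "q \<in> gaussian_couplings px py"
    and px: "zero_mean_stationary px" "spectral_density px X" "bdd_meas X"
    and py: "zero_mean_stationary py" "spectral_density py Y" "bdd_meas Y"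
    and S: "bdd_meas S" "\<And>\<theta>. S (refl_torus \<theta>) = cconj (S \<theta>)" "\<And>\<theta>. adj (S \<theta>) = S \<theta>"
    and S': "bdd_meas S'" "\<And>\<theta>. S' (refl_torus \<theta>) = cconj (S' \<theta>)" "\<And>\<theta>. adj (S' \<theta>) = S' \<theta>"
    and inv: "\<And>\<theta>. S' \<theta> ** S \<theta> = mat 1"
    and SYS: "\<And>\<theta>. S' \<theta> ** X \<theta> ** S' \<theta> = S \<theta> ** Y \<theta> ** S \<theta>"
  shows "(\<integral>\<theta>. Re (trace (X \<theta> + Y \<theta> - 2 *\<^sub>R (S \<theta> ** Y \<theta> ** S \<theta>))) \<partial>torus_measure) \<le> transport_cost q t"
proof -
  have qst: "zero_mean_stationary q" and qx: "distr q field_space x_field = px" and qy: "distr q field_space y_field = py"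
    using q by (auto simp: gaussian_couplings_def zero_mean_gaussian_stationary_def x_field_def[abs_def] y_field_def[abs_def])
  note ctx = qst qx qy px py
  have c0: "linear_filter (\<lambda>z. z 0 $ k) (\<lambda>\<theta>. axis k 1)" for k
    using linear_filter_coordinate[of 0 k] by simp
  obtain l f m g where lf: "\<And>i n. linear_filter (l i n) (f i n)" and mg: "\<And>i n. linear_filter (m i n) (g i n)"
    and limf: "\<And>i. (\<lambda>n. \<integral>\<theta>. (norm (f i n \<theta> - S' \<theta> *v axis i 1))\<^sup>2 \<partial>torus_measure) \<longlonglongrightarrow> 0"
    and limg: "\<And>i. (\<lambda>n. \<integral>\<theta>. (norm (g i n \<theta> - S \<theta> *v axis i 1))\<^sup>2 \<partial>torus_measure) \<longlonglongrightarrow> 0"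
    and limh: "\<And>k. (\<lambda>n. \<integral>\<theta>. (norm (axis k 1 - (\<Sum>i\<in>UNIV. cnj (g i n \<theta> $ k) *s f i n \<theta>)))\<^sup>2 \<partial>torus_measure) \<longlonglongrightarrow> 0"
    by (rule inverse_filters_approx[OF S S'(1,2) inv]) blast
  define h where "h n k \<theta> = axis k 1 - (\<Sum>i\<in>UNIV. cnj (g i n \<theta> $ k) *s f i n \<theta>)" for n k \<theta>
  define R where "R = (\<Sum>i\<in>UNIV. quad_int X (\<lambda>\<theta>. S' \<theta> *v axis i 1) + quad_int Y (\<lambda>\<theta>. S \<theta> *v axis i 1))"
  define cross where "cross = (\<Sum>k\<in>UNIV. \<integral>z. x_field z 0 $ k * y_field z 0 $ k \<partial>q)"
  define E where "E = (\<Sum>k\<in>UNIV. \<integral>z. (y_field z 0 $ k)\<^sup>2 \<partial>q)"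
  have Sc: "bdd_meas (\<lambda>\<theta>. S \<theta> *v axis i 1)" "bdd_meas (\<lambda>\<theta>. S' \<theta> *v axis i 1)" for i
    by (intro bdd_meas_matrix_vector S S' bdd_meas_const)+
  have hm: "bdd_meas (h n k)" for n k
    unfolding h_def[abs_def]
    by (rule bdd_meas_filter_mismatch[OF linear_filter_bdd_meas[OF mg] linear_filter_bdd_meas[OF lf]])
  have cross: "2 * cross \<le> R + \<delta> * E" if \<delta>: "0 < \<delta>" for \<delta>
  proof -
    have le: "2 * cross \<le> (\<Sum>i\<in>UNIV. quad_int X (f i n) + quad_int Y (g i n)) +
      (\<Sum>k\<in>UNIV. quad_int X (h n k) / \<delta> + \<delta> * (\<integral>z. (y_field z 0 $ k)\<^sup>2 \<partial>q))" for n
      unfolding cross_def h_def[abs_def]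
      by (rule coupling_cross_le[OF ctx, where l = "\<lambda>i. l i n" and m = "\<lambda>i. m i n"]) (rule lf mg \<delta>)+
    have hz: "(\<lambda>n. quad_int X (h n k)) \<longlonglongrightarrow> quad_int X (\<lambda>_. 0)" for k
      by (rule quad_int_tendsto[OF px(3) hm]) (use limh in \<open>simp_all add: h_def\<close>)
    have z: "quad_int X (\<lambda>_. 0) = 0" by (simp add: quad_int_def)
    have "(\<lambda>n. (\<Sum>i\<in>UNIV. quad_int X (f i n) + quad_int Y (g i n)) +
      (\<Sum>k\<in>UNIV. quad_int X (h n k) / \<delta> + \<delta> * (\<integral>z. (y_field z 0 $ k)\<^sup>2 \<partial>q))) \<longlonglongrightarrow>
      R + (\<Sum>k\<in>(UNIV :: 'm set). 0 / \<delta> + \<delta> * (\<integral>z. (y_field z 0 $ k)\<^sup>2 \<partial>q))"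
      unfolding R_def
      by (intro tendsto_intros quad_int_tendsto px(3) py(3) Sc limf limg hz[unfolded z]
          linear_filter_bdd_meas[OF lf] linear_filter_bdd_meas[OF mg]) (use \<delta> in auto)
    also have "R + (\<Sum>k\<in>(UNIV :: 'm set). 0 / \<delta> + \<delta> * (\<integral>z. (y_field z 0 $ k)\<^sup>2 \<partial>q)) = R + \<delta> * E"
      by (simp add: E_def sum_distrib_left)
    finally show ?thesis by (rule LIMSEQ_le_const) (use le in blast)
  qed
  have E0: "0 \<le> E" unfolding E_def by (intro sum_nonneg) simp
  have "2 * cross \<le> R"
  proof (rule field_le_epsilon)
    fix e :: real assume e: "0 < e"
    have "2 * cross \<le> R + e / (E + 1) * E" using cross[of "e / (E + 1)"] e E0 by simp
    also have "e / (E + 1) * E \<le> e" using e E0 by (simp add: field_simps)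
    finally show "2 * cross \<le> R + e" by simp
  qed
  have sum_quad: "(\<Sum>i\<in>UNIV. quad_int P (\<lambda>\<theta>. Q \<theta> *v axis i 1)) = (\<integral>\<theta>. Re (trace (Q \<theta> ** P \<theta> ** Q \<theta>)) \<partial>torus_measure)"
    if "bdd_meas P" "bdd_meas Q" "\<And>\<theta>. adj (Q \<theta>) = Q \<theta>" for P Q :: "real ^ 'd \<Rightarrow> complex ^ 'm ^ 'm"
  proof -
    have "(\<Sum>i\<in>UNIV. quad_int P (\<lambda>\<theta>. Q \<theta> *v axis i 1))
        = (\<integral>\<theta>. (\<Sum>i\<in>UNIV. (Q \<theta> *v axis i 1) \<bullet> (P \<theta> *v (Q \<theta> *v axis i 1))) \<partial>torus_measure)"
      unfolding quad_int_def
      by (intro Bochner_Integration.integral_sum[symmetric] bdd_meas_integrable bdd_meas_inner bdd_meas_matrix_vector that bdd_meas_const)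
    then show ?thesis using Re_trace_congruence[of "Q \<theta>" "P \<theta>" for \<theta>] that(3) by simp
  qed
  define C where "C \<theta> = S \<theta> ** Y \<theta> ** S \<theta>" for \<theta>
  have R: "R = 2 * (\<integral>\<theta>. Re (trace (C \<theta>)) \<partial>torus_measure)"
    unfolding R_def sum.distrib sum_quad[OF px(3) S'(1,3)] sum_quad[OF py(3) S(1,3)] SYS C_def by simp
  have mat1: "adj (mat 1 :: complex ^ 'm ^ 'm) = mat 1" by simp
  have XX: "(\<Sum>k\<in>UNIV. \<integral>z. (x_field z 0 $ k)\<^sup>2 \<partial>q) = (\<integral>\<theta>. Re (trace (X \<theta>)) \<partial>torus_measure)"
    using sum_quad[OF px(3) bdd_meas_const[of "mat 1"] mat1] coupling_variance(2)[OF ctx c0] by simp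
  have YY: "(\<Sum>k\<in>UNIV. \<integral>z. (y_field z 0 $ k)\<^sup>2 \<partial>q) = (\<integral>\<theta>. Re (trace (Y \<theta>)) \<partial>torus_measure)"
    using sum_quad[OF py(3) bdd_meas_const[of "mat 1"] mat1] coupling_variance(4)[OF ctx c0] by simp
  have tr: "bdd_meas (\<lambda>\<theta>. Re (trace (P \<theta>)))" if "bdd_meas P" for P :: "real ^ 'd \<Rightarrow> complex ^ 'm ^ 'm"
    unfolding trace_def by (intro bdd_meas_bounded_linear[OF bounded_linear_Re] bdd_meas_sum bdd_meas_vec_nth that)
  have Cm: "bdd_meas C" unfolding C_def[abs_def] by (intro bdd_meas_matrix_mult S py)
  have "transport_cost q t = transport_cost q 0"
  proof -
    have m: "(\<lambda>z :: int ^ 'd \<Rightarrow> real ^ ('m + 'm). (norm (x_part (z 0) - y_part (z 0)))\<^sup>2) \<in> borel_measurable field_space"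
      unfolding norm_vec_square_sum x_part_def y_part_def vector_minus_component vec_lambda_beta real_norm_def power2_abs
      by (intro borel_measurable_sum borel_measurable_power borel_measurable_diff measurable_field_component)
    show ?thesis unfolding transport_cost_def using zero_mean_stationary_shift[OF qst m, of t] by simp
  qed
  also have "transport_cost q 0 = (\<integral>z. (\<Sum>k\<in>UNIV. (x_field z 0 $ k)\<^sup>2 + (y_field z 0 $ k)\<^sup>2 - 2 * (x_field z 0 $ k * y_field z 0 $ k)) \<partial>q)"
    unfolding transport_cost_def norm_vec_square_sum x_field_def y_field_def
    by (simp add: power2_diff mult.assoc)
  also have "\<dots> = (\<Sum>k\<in>UNIV. \<integral>z. (x_field z 0 $ k)\<^sup>2 \<partial>q) + (\<Sum>k\<in>UNIV. \<integral>z. (y_field z 0 $ k)\<^sup>2 \<partial>q) - 2 * cross"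
    using coupling_variance(1,3)[OF ctx c0] coupling_integrable[OF ctx c0 c0]
    by (simp add: cross_def sum.distrib sum_subtractf sum_distrib_left)
  finally have cost: "transport_cost q t = (\<integral>\<theta>. Re (trace (X \<theta>)) \<partial>torus_measure) + (\<integral>\<theta>. Re (trace (Y \<theta>)) \<partial>torus_measure) - 2 * cross"
    unfolding XX YY .
  have "(\<integral>\<theta>. Re (trace (X \<theta> + Y \<theta> - 2 *\<^sub>R C \<theta>)) \<partial>torus_measure)
      = (\<integral>\<theta>. Re (trace (X \<theta>)) + Re (trace (Y \<theta>)) - 2 * Re (trace (C \<theta>)) \<partial>torus_measure)"
    by (simp add: trace_sub trace_add trace_scaleR)
  also have "\<dots> = (\<integral>\<theta>. Re (trace (X \<theta>)) \<partial>torus_measure) + (\<integral>\<theta>. Re (trace (Y \<theta>)) \<partial>torus_measure) - R"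
    unfolding R using bdd_meas_integrable[OF tr[OF px(3)]] bdd_meas_integrable[OF tr[OF py(3)]] bdd_meas_integrable[OF tr[OF Cm]]
    by simp
  finally show ?thesis using cost \<open>2 * cross \<le> R\<close> by (simp add: C_def)
qed

section \<open>The distance\<close>

lemma trig_poly_orthogonal:
  assumes u: "bdd_meas u" and coeff: "\<And>t. (\<integral>\<theta>. u \<theta> * cis (freq_pairing \<theta> t) \<partial>torus_measure) = 0"
    and p: "trig_poly p"
  shows "(\<integral>\<theta>. u \<theta> * cnj (p \<theta>) \<partial>torus_measure) = 0"
  using p
proof (induction rule: trig_poly.induct)
  case (monom c s)
  have "u \<theta> * cnj (c * cis (- freq_pairing \<theta> s)) = cnj c * (u \<theta> * cis (freq_pairing \<theta> s))" for \<theta>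
    by (simp add: cis_cnj)
  then show ?case using coeff[of s] by (simp only: integral_mult_right_zero) simp
next
  case (add f g)
  have "integrable torus_measure (\<lambda>\<theta>. u \<theta> * cnj (h \<theta>))" if "trig_poly h" for h
    by (intro bdd_meas_integrable bdd_meas_mult u bdd_meas_bounded_linear[OF bounded_linear_cnj] trig_poly_bdd_meas that)
  then show ?case using add by (simp add: distrib_left)
qed

lemma fourier_uniqueness:
  fixes u :: "real ^ 'd \<Rightarrow> complex"
  assumes u: "bdd_meas u" and coeff: "\<And>t. (\<integral>\<theta>. u \<theta> * cis (freq_pairing \<theta> t) \<partial>torus_measure) = 0"
  shows "AE \<theta> in torus_measure. u \<theta> = 0"
proof -
  from u obtain B where B: "0 < B" "\<And>\<theta>. norm (u \<theta>) \<le> B" by (meson bdd_measE)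
  define I where "I = (\<integral>\<theta>. (norm (u \<theta>))\<^sup>2 \<partial>torus_measure)"
  have iu: "integrable torus_measure (\<lambda>\<theta>. (norm (u \<theta>))\<^sup>2)" by (intro bdd_meas_integrable bdd_meas_norm_power u)
  have "I \<le> e" if e: "0 < e" for e
  proof -
    obtain p where p: "trig_poly p" "(\<integral>\<theta>. (norm (u \<theta> - p \<theta>))\<^sup>2 \<partial>torus_measure) < (e / B)\<^sup>2"
      using trig_poly_dense[OF u, of "(e / B)\<^sup>2"] e B by auto
    have pm: "bdd_meas p" by (rule trig_poly_bdd_meas[OF p(1)])
    have ip: "integrable torus_measure (\<lambda>\<theta>. u \<theta> * cnj (h \<theta>))" if "bdd_meas h" for h
      by (intro bdd_meas_integrable bdd_meas_mult u bdd_meas_bounded_linear[OF bounded_linear_cnj] that)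
    have "complex_of_real I = (\<integral>\<theta>. u \<theta> * cnj (u \<theta>) \<partial>torus_measure)"
      by (simp only: I_def complex_norm_square flip: integral_complex_of_real)
    also have "\<dots> = (\<integral>\<theta>. u \<theta> * cnj (u \<theta> - p \<theta>) \<partial>torus_measure)"
      using ip[OF u] ip[OF pm] trig_poly_orthogonal[OF u coeff p(1)] by (simp add: right_diff_distrib)
    finally have "norm (complex_of_real I) \<le> (\<integral>\<theta>. norm (u \<theta> * cnj (u \<theta> - p \<theta>)) \<partial>torus_measure)"
      using integral_norm_bound by metis
    also have "\<dots> \<le> (\<integral>\<theta>. B * norm (u \<theta> - p \<theta>) \<partial>torus_measure)"
    proof (rule integral_mono)
      show "integrable torus_measure (\<lambda>\<theta>. norm (u \<theta> * cnj (u \<theta> - p \<theta>)))"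
        by (intro integrable_norm ip bdd_meas_diff u pm)
      show "integrable torus_measure (\<lambda>\<theta>. B * norm (u \<theta> - p \<theta>))"
        by (intro integrable_mult_right integrable_norm bdd_meas_integrable bdd_meas_diff u pm)
      show "norm (u \<theta> * cnj (u \<theta> - p \<theta>)) \<le> B * norm (u \<theta> - p \<theta>)" for \<theta>
        unfolding norm_mult complex_mod_cnj by (intro mult_right_mono B) simp
    qed
    also have "\<dots> = B * (\<integral>\<theta>. norm (u \<theta> - p \<theta>) \<partial>torus_measure)" by simp
    also have "\<dots> \<le> B * sqrt (\<integral>\<theta>. (norm (u \<theta> - p \<theta>))\<^sup>2 \<partial>torus_measure)"
      using B by (intro mult_left_mono torus_integral_norm_le bdd_meas_diff u pm) simp
    also have "\<dots> \<le> B * sqrt ((e / B)\<^sup>2)"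
      using B p(2) by (intro mult_left_mono real_sqrt_le_mono) auto
    also have "\<dots> = e" using B e by simp
    finally show ?thesis by simp
  qed
  then have "I \<le> 0" by (rule field_le_epsilon) simp
  then have "I = 0" by (simp add: I_def order_antisym)
  then have "AE \<theta> in torus_measure. (norm (u \<theta>))\<^sup>2 = 0"
    using integral_nonneg_eq_0_iff_AE[OF iu] by (simp add: I_def)
  then show ?thesis by eventually_elim simp
qed

lemma cconj_mat_of_real: "cconj (mat (complex_of_real c)) = mat (complex_of_real c)"
  by (auto simp: vec_eq_iff mat_def)

lemma pd_between_mat: "c \<le> C \<Longrightarrow> pd_between c C (mat (complex_of_real c))"
  unfolding pd_between_iff by (simp add: mat_of_real_mult_vec power2_norm_eq_inner mult_right_mono)

lemma closed_pd_between: "closed {A :: complex ^ 'n ^ 'n. pd_between c C A}"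
proof -
  have "closed {A :: complex ^ 'n ^ 'n. adj A = A}"
    unfolding adj_def by (intro closed_Collect_eq continuous_intros)
  moreover have "closed {A :: complex ^ 'n ^ 'n. c * (norm v)\<^sup>2 \<le> v \<bullet> (A *v v)}"
      "closed {A :: complex ^ 'n ^ 'n. v \<bullet> (A *v v) \<le> C * (norm v)\<^sup>2}" for v :: "complex ^ 'n"
    unfolding matrix_vector_mult_def by (intro closed_Collect_le continuous_intros)+
  moreover have "{A :: complex ^ 'n ^ 'n. pd_between c C A} = {A. adj A = A} \<inter>
      ((\<Inter>v. {A. c * (norm v)\<^sup>2 \<le> v \<bullet> (A *v v)}) \<inter> (\<Inter>v. {A. v \<bullet> (A *v v) \<le> C * (norm v)\<^sup>2}))"
    by (auto simp: pd_between_iff)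
  ultimately show ?thesis by (simp only:) (intro closed_Int closed_INT ballI, auto)
qed

lemma pd_between_norm:
  fixes A :: "complex ^ 'n ^ 'n"
  assumes "pd_between c C A" "0 \<le> c" shows "norm A \<le> C * norm (mat 1 :: complex ^ 'n ^ 'n)"
  using op_bound_norm_mult[OF pd_between_op_bound[OF assms], of "mat 1"] pd_between_le[OF assms(1)] assms(2) by simp

lemma bdd_meas_continuous:
  fixes X :: "real ^ 'd \<Rightarrow> complex ^ 'm ^ 'm" and F :: "_ \<Rightarrow> complex ^ 'm ^ 'm"
  assumes X: "bdd_meas X" "\<And>\<theta>. X \<theta> \<in> K" and F: "continuous_on K F" "\<And>A. A \<in> K \<Longrightarrow> norm (F A) \<le> B"
  shows "bdd_meas (\<lambda>\<theta>. F (X \<theta>))"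
proof (rule bdd_measI)
  have "X \<in> torus_measure \<rightarrow>\<^sub>M restrict_space borel K"
    using X by (intro measurable_restrict_space2) (auto dest: bdd_meas_measurable)
  then show "(\<lambda>\<theta>. F (X \<theta>)) \<in> borel_measurable torus_measure"
    by (rule measurable_compose) (rule borel_measurable_continuous_on_restrict[OF F(1)])
  show "norm (F (X \<theta>)) \<le> B" for \<theta> by (intro F X)
qed

text \<open>The symmetry under the reflection of the torus expresses that the Fourier coefficients are
  real.\<close>

definition regular_density :: "real \<Rightarrow> real \<Rightarrow> (real ^ 'd \<Rightarrow> complex ^ 'm ^ 'm) \<Rightarrow> bool" where
  "regular_density c C X \<longleftrightarrow> bdd_meas X \<and> (\<forall>\<theta>. pd_between c C (X \<theta>)) \<and>
     (\<forall>\<theta>. X (refl_torus \<theta>) = cconj (X \<theta>))"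

lemma regular_density_psd_sqrt:
  assumes X: "regular_density c C X" and c: "0 < c"
  shows "regular_density (sqrt c) (2 * sqrt C) (\<lambda>\<theta>. psd_sqrt (X \<theta>))"
proof -
  have pd: "pd_between c C (X \<theta>)" for \<theta> using X by (simp add: regular_density_def)
  have "bdd_meas (\<lambda>\<theta>. psd_sqrt (X \<theta>))"
  proof (rule bdd_meas_continuous[OF _ _ continuous_on_psd_sqrt[OF c]])
    show "norm (psd_sqrt A) \<le> 2 * sqrt C * norm (mat 1 :: complex ^ 'b ^ 'b)"
      if "A \<in> {A. pd_between c C A}" for A :: "complex ^ 'b ^ 'b"
      using that c by (intro pd_between_norm[OF psd_sqrt_pd(1)]) auto
  qed (use X in \<open>auto simp: regular_density_def\<close>)
  then show ?thesis
    using X psd_sqrt_pd(1)[OF pd c] psd_sqrt_cconj[OF pd c] by (simp add: regular_density_def)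
qed

lemma regular_density_inv:
  assumes X: "regular_density c C X" and c: "0 < c"
  shows "regular_density (c / C\<^sup>2) (1 / c) (\<lambda>\<theta>. matrix_inv (X \<theta>))"
proof -
  have pd: "pd_between c C (X \<theta>)" for \<theta> using X by (simp add: regular_density_def)
  have "bdd_meas (\<lambda>\<theta>. matrix_inv (X \<theta>))"
  proof (rule bdd_meas_continuous[OF _ _ continuous_on_matrix_inv[OF c]])
    show "norm (matrix_inv A) \<le> 1 / c * norm (mat 1 :: complex ^ 'b ^ 'b)"
      if "A \<in> {A. pd_between c C A}" for A :: "complex ^ 'b ^ 'b"
      using that c by (intro pd_between_norm[OF pd_between_inv(3)]) auto
  qed (use X in \<open>auto simp: regular_density_def\<close>)
  then show ?thesis
    using X pd_between_inv(3)[OF pd c] matrix_inv_cconj[OF pd c] by (simp add: regular_density_def)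
qed

lemma regular_density_congruence:
  assumes X: "regular_density a A X" "0 \<le> a" and Q: "regular_density b B Q" "0 < b"
  shows "regular_density (a * b\<^sup>2) (A * B\<^sup>2) (\<lambda>\<theta>. Q \<theta> ** X \<theta> ** Q \<theta>)"
  using assms pd_between_congruence[of a A "X \<theta>" b B "Q \<theta>" for \<theta>]
  by (auto simp: regular_density_def cconj_mult intro!: bdd_meas_matrix_mult)

lemma spectral_density_AE_cong:
  assumes sd: "spectral_density p \<Phi>" and ae: "AE \<theta> in torus_measure. \<Phi> \<theta> = \<Psi> \<theta>"
    and m: "\<Psi> \<in> borel_measurable torus_measure"
  shows "spectral_density p \<Psi>"
proof -
  have i: "integrable torus_measure \<Phi>" and psd: "AE \<theta> in torus_measure. hermitian_psd (\<Phi> \<theta>)"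
    and coeff: "\<And>t i k. complex_of_real (covariance_field p t $ i $ k) =
                (\<integral>\<theta>. \<Phi> \<theta> $ i $ k * cis (freq_pairing \<theta> t) \<partial>torus_measure)"
    using sd by (auto simp: spectral_density_def)
  have cm: "(\<lambda>\<theta>. cis (freq_pairing \<theta> t)) \<in> borel_measurable torus_measure" for t
    by (intro continuous_imp_torus_measurable continuous_intros)
  have em: "(\<lambda>\<theta>. F \<theta> $ i $ k) \<in> borel_measurable torus_measure"
    if "F \<in> borel_measurable torus_measure" for F :: "_ \<Rightarrow> complex ^ 'b ^ 'b" and i k
    by (rule measurable_compose[OF that]) (intro borel_measurable_continuous_onI continuous_intros)
  have "integrable torus_measure \<Psi>"
    by (rule integrable_cong_AE_imp[OF i m]) (use ae in \<open>auto elim: AE_mp\<close>)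
  moreover have "AE \<theta> in torus_measure. hermitian_psd (\<Psi> \<theta>)"
    using psd ae by eventually_elim simp
  moreover have "complex_of_real (covariance_field p t $ i $ k) =
                (\<integral>\<theta>. \<Psi> \<theta> $ i $ k * cis (freq_pairing \<theta> t) \<partial>torus_measure)" for t i k
    unfolding coeff
  proof (rule integral_cong_AE)
    show "AE \<theta> in torus_measure. \<Phi> \<theta> $ i $ k * cis (freq_pairing \<theta> t) = \<Psi> \<theta> $ i $ k * cis (freq_pairing \<theta> t)"
      using ae by eventually_elim simp
  qed (intro borel_measurable_times cm em m borel_measurable_integrable[OF i])+
  ultimately show ?thesis by (simp add: spectral_density_def)
qed

lemma spectral_density_symmetric:
  fixes \<Psi> :: "real ^ 'd \<Rightarrow> complex ^ 'm ^ 'm"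
  assumes sd: "spectral_density p \<Psi>" and m: "bdd_meas \<Psi>"
  shows "AE \<theta> in torus_measure. \<Psi> (refl_torus \<theta>) = cconj (\<Psi> \<theta>)"
proof -
  have coeff: "complex_of_real (covariance_field p t $ i $ k) =
                (\<integral>\<theta>. \<Psi> \<theta> $ i $ k * cis (freq_pairing \<theta> t) \<partial>torus_measure)" for t i k
    using sd unfolding spectral_density_def by blast
  have cm: "bdd_meas (\<lambda>\<theta>. cis (freq_pairing \<theta> t))" for t
    using trig_poly_bdd_meas[OF trig_poly.monom[of 1 "- t"]] by (simp only: freq_pairing_minus minus_minus mult_1)
  have em: "bdd_meas (\<lambda>\<theta>. \<Psi> \<theta> $ i $ k)" for i k by (intro bdd_meas_vec_nth m)
  have rm: "bdd_meas (\<lambda>\<theta>. \<Psi> (refl_torus \<theta>) $ i $ k)" for i k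
    using measurable_compose[OF refl_torus_measurable bdd_meas_measurable[OF em]] em[of i k]
    by (elim bdd_measE) (rule bdd_measI)
  have cj: "bdd_meas (\<lambda>\<theta>. cnj (\<Psi> \<theta> $ i $ k))" for i k
    by (intro bdd_meas_bounded_linear[OF bounded_linear_cnj] em)
  have "AE \<theta> in torus_measure. \<Psi> (refl_torus \<theta>) $ i $ k - cnj (\<Psi> \<theta> $ i $ k) = 0" for i k
  proof (rule fourier_uniqueness)
    show "bdd_meas (\<lambda>\<theta>. \<Psi> (refl_torus \<theta>) $ i $ k - cnj (\<Psi> \<theta> $ i $ k))" by (intro bdd_meas_diff rm cj)
    fix t
    have "(\<integral>\<theta>. \<Psi> (refl_torus \<theta>) $ i $ k * cis (freq_pairing \<theta> t) \<partial>torus_measure)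
        = (\<integral>\<theta>. \<Psi> \<theta> $ i $ k * cis (freq_pairing \<theta> (- t)) \<partial>torus_measure)"
    proof -
      have "cis (freq_pairing (refl_torus \<theta>) (- t)) = cis (freq_pairing \<theta> t)" for \<theta>
        using cis_freq_refl[of \<theta> "- t"] by (simp only: freq_pairing_minus minus_minus)
      then show ?thesis
        using integral_refl_torus[OF bdd_meas_measurable[OF bdd_meas_mult[OF em cm]], of i k "- t"] by simp
    qed
    also have "\<dots> = cnj (\<integral>\<theta>. \<Psi> \<theta> $ i $ k * cis (freq_pairing \<theta> (- t)) \<partial>torus_measure)"
      unfolding coeff[symmetric] by simp
    also have "\<dots> = (\<integral>\<theta>. cnj (\<Psi> \<theta> $ i $ k) * cis (freq_pairing \<theta> t) \<partial>torus_measure)"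
      using integral_bounded_linear[OF bounded_linear_cnj bdd_meas_integrable[OF bdd_meas_mult[OF em cm]], of i k "- t"]
      by (simp only: complex_cnj_mult freq_pairing_minus cis_cnj minus_minus)
    finally show "(\<integral>\<theta>. (\<Psi> (refl_torus \<theta>) $ i $ k - cnj (\<Psi> \<theta> $ i $ k)) * cis (freq_pairing \<theta> t) \<partial>torus_measure) = 0"
      using bdd_meas_integrable[OF bdd_meas_mult[OF rm cm]] bdd_meas_integrable[OF bdd_meas_mult[OF cj cm]]
      by (simp add: left_diff_distrib)
  qed
  then have "AE \<theta> in torus_measure. \<forall>i k. \<Psi> (refl_torus \<theta>) $ i $ k - cnj (\<Psi> \<theta> $ i $ k) = 0"
    by (intro AE_finite_allI[of UNIV, simplified]) auto
  then show ?thesis by eventually_elim (simp add: vec_eq_iff)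
qed

lemma regular_density_version:
  fixes \<Phi> :: "real ^ 'd \<Rightarrow> complex ^ 'm ^ 'm"
  assumes sd: "spectral_density p \<Phi>" and c: "0 < c" "c \<le> C"
    and pd: "AE \<theta> in torus_measure. pd_between c C (\<Phi> \<theta>)"
  obtains X where "regular_density c C X" "spectral_density p X" "AE \<theta> in torus_measure. \<Phi> \<theta> = X \<theta>"
proof -
  have \<Phi>m: "\<Phi> \<in> borel_measurable torus_measure"
    using sd by (auto simp: spectral_density_def intro: borel_measurable_integrable)
  define \<Psi> where "\<Psi> \<theta> = (if pd_between c C (\<Phi> \<theta>) then \<Phi> \<theta> else mat (complex_of_real c))" for \<theta>
  have \<Psi>pd: "pd_between c C (\<Psi> \<theta>)" for \<theta> by (simp add: \<Psi>_def pd_between_mat[OF c(2)])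
  have "{\<theta> \<in> space torus_measure. pd_between c C (\<Phi> \<theta>)} \<in> sets torus_measure"
    using measurable_sets[OF \<Phi>m borel_closed[OF closed_pd_between[of c C]]] by (simp add: vimage_def Int_def conj_commute)
  then have \<Psi>m: "bdd_meas \<Psi>"
    using \<Phi>m pd_between_norm[OF \<Psi>pd] c unfolding \<Psi>_def[abs_def]
    by (intro bdd_measI measurable_If) (auto simp: \<Psi>_def[symmetric])
  have ae1: "AE \<theta> in torus_measure. \<Phi> \<theta> = \<Psi> \<theta>" using pd by eventually_elim (simp add: \<Psi>_def)
  note sd1 = spectral_density_AE_cong[OF sd ae1 bdd_meas_measurable[OF \<Psi>m]]
  define X where "X \<theta> = (if \<Psi> (refl_torus \<theta>) = cconj (\<Psi> \<theta>) then \<Psi> \<theta> else mat (complex_of_real c))" for \<theta>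
  have Xpd: "pd_between c C (X \<theta>)" for \<theta> by (simp add: X_def \<Psi>pd pd_between_mat[OF c(2)])
  have sym: "X (refl_torus \<theta>) = cconj (X \<theta>)" for \<theta>
    by (auto simp: X_def cconj_mat_of_real)
  have "{\<theta> \<in> space torus_measure. norm (\<Psi> (refl_torus \<theta>) - cconj (\<Psi> \<theta>)) = 0} \<in> sets torus_measure"
  proof -
    have "(\<lambda>\<theta>. \<Psi> (refl_torus \<theta>)) \<in> borel_measurable torus_measure"
      by (rule measurable_compose[OF refl_torus_measurable bdd_meas_measurable[OF \<Psi>m]])
    moreover have "(\<lambda>\<theta>. cconj (\<Psi> \<theta>)) \<in> borel_measurable torus_measure"
      unfolding cconj_def
      by (rule measurable_compose[OF bdd_meas_measurable[OF \<Psi>m]]) (intro borel_measurable_continuous_onI continuous_intros)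
    ultimately show ?thesis by measurable
  qed
  then have Xm: "bdd_meas X"
    using bdd_meas_measurable[OF \<Psi>m] pd_between_norm[OF Xpd] c unfolding X_def[abs_def]
    by (intro bdd_measI measurable_If) (auto simp: X_def[symmetric])
  have ae2: "AE \<theta> in torus_measure. \<Psi> \<theta> = X \<theta>"
    using spectral_density_symmetric[OF sd1 \<Psi>m] by eventually_elim (simp add: X_def)
  note sd2 = spectral_density_AE_cong[OF sd1 ae2 bdd_meas_measurable[OF Xm]]
  have "AE \<theta> in torus_measure. \<Phi> \<theta> = X \<theta>" using ae1 ae2 by eventually_elim simp
  then show ?thesis using that[OF _ sd2] Xm Xpd sym by (simp add: regular_density_def)
qed

lemma matrix_inv_cancel:
  assumes "R ** Q = mat 1" "Q ** R = mat (1 :: complex)"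
  shows "R ** (Q ** A) = A" "Q ** (R ** A) = A"
  using assms by (simp_all add: matrix_mul_assoc)

lemma transport_cost_INF:
  fixes px py :: "(int ^ 'd \<Rightarrow> real ^ 'm) measure" and t :: "int ^ 'd"
  assumes px: "zero_mean_gaussian_stationary px" "spectral_density px X" "regular_density c C X"
    and py: "zero_mean_gaussian_stationary py" "spectral_density py Y" "regular_density c C Y"
    and c: "0 < c"
  defines "M \<equiv> \<lambda>\<theta>. psd_sqrt (psd_sqrt (Y \<theta>) ** X \<theta> ** psd_sqrt (Y \<theta>))"
  shows "(INF q\<in>gaussian_couplings px py. transport_cost q t) =
      (\<integral>\<theta>. Re (trace (X \<theta> + Y \<theta> - 2 *\<^sub>R M \<theta>)) \<partial>torus_measure)"
    and "0 \<le> (INF q\<in>gaussian_couplings px py. transport_cost q t)"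
    and "bdd_meas M" and "adj (M \<theta>) = M \<theta>"
proof -
  have C: "0 < C" using pd_between_le[of c C "X 0"] px(3) c by (auto simp: regular_density_def)
  define R R' where "R \<theta> = psd_sqrt (Y \<theta>)" and "R' \<theta> = matrix_inv (R \<theta>)" for \<theta>
  define T where "T \<theta> = R' \<theta> ** M \<theta> ** R' \<theta>" for \<theta>
  define S S' where "S \<theta> = psd_sqrt (T \<theta>)" and "S' \<theta> = matrix_inv (S \<theta>)" for \<theta>
  have Apos: "0 < A" if "regular_density a A F" "0 < a" for a A and F :: "real ^ 'd \<Rightarrow> complex ^ 'm ^ 'm"
    using pd_between_le[of a A "F 0"] that by (auto simp: regular_density_def)
  obtain r r2 where R: "regular_density r r2 R" "0 < r"
    using regular_density_psd_sqrt[OF py(3) c] c unfolding R_def[abs_def] by (metis real_sqrt_gt_zero)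
  have RR: "R \<theta> ** R \<theta> = Y \<theta>" for \<theta>
    unfolding R_def by (rule psd_sqrt_pd(2)[OF _ c, of C]) (use py(3) in \<open>simp add: regular_density_def\<close>)
  have R': "regular_density (r / r2\<^sup>2) (1 / r) R'" unfolding R'_def[abs_def] by (rule regular_density_inv[OF R])
  have r'pos: "0 < r / r2\<^sup>2" using Apos[OF R] R(2) by simp
  have RR': "R \<theta> ** R' \<theta> = mat 1" "R' \<theta> ** R \<theta> = mat 1" for \<theta>
    unfolding R'_def using pd_between_inv(1,2)[of r r2 "R \<theta>"] R by (auto simp: regular_density_def)
  have P: "regular_density (c * r\<^sup>2) (C * r2\<^sup>2) (\<lambda>\<theta>. R \<theta> ** X \<theta> ** R \<theta>)"
    by (rule regular_density_congruence[OF px(3) _ R]) (use c in simp)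
  have Ppos: "0 < c * r\<^sup>2" using c R(2) by simp
  have M: "regular_density (sqrt (c * r\<^sup>2)) (2 * sqrt (C * r2\<^sup>2)) M"
    unfolding M_def using regular_density_psd_sqrt[OF P Ppos] by (simp add: R_def)
  have MM: "M \<theta> ** M \<theta> = R \<theta> ** X \<theta> ** R \<theta>" for \<theta>
    unfolding M_def R_def[symmetric]
    by (rule psd_sqrt_pd(2)[OF _ Ppos, of "C * r2\<^sup>2"]) (use P in \<open>simp add: regular_density_def\<close>)
  have Mpos: "0 < sqrt (c * r\<^sup>2)" using Ppos by simp
  have T: "regular_density (sqrt (c * r\<^sup>2) * (r / r2\<^sup>2)\<^sup>2) (2 * sqrt (C * r2\<^sup>2) * (1 / r)\<^sup>2) T"
    unfolding T_def[abs_def] by (rule regular_density_congruence[OF M _ R' r'pos]) (use Mpos in simp)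
  have Tpos: "0 < sqrt (c * r\<^sup>2) * (r / r2\<^sup>2)\<^sup>2" by (rule mult_pos_pos[OF Mpos zero_less_power[OF r'pos]])
  obtain s s2 where S: "regular_density s s2 S" "0 < s"
    using regular_density_psd_sqrt[OF T Tpos] Tpos unfolding S_def[abs_def] by (metis real_sqrt_gt_zero)
  have SS: "S \<theta> ** S \<theta> = T \<theta>" for \<theta>
    unfolding S_def by (rule psd_sqrt_pd(2)[OF _ Tpos, of "2 * sqrt (C * r2\<^sup>2) * (1 / r)\<^sup>2"]) (use T in \<open>simp add: regular_density_def\<close>)
  have S': "regular_density (s / s2\<^sup>2) (1 / s) S'" unfolding S'_def[abs_def] by (rule regular_density_inv[OF S])
  have SS': "S \<theta> ** S' \<theta> = mat 1" "S' \<theta> ** S \<theta> = mat 1" for \<theta>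
    unfolding S'_def using pd_between_inv(1,2)[of s s2 "S \<theta>"] S by (auto simp: regular_density_def)
  note cancel = matrix_inv_cancel[OF RR'] matrix_inv_cancel[OF SS']
  have TYT: "T \<theta> ** Y \<theta> ** T \<theta> = X \<theta>" for \<theta>
  proof -
    have "T \<theta> ** Y \<theta> ** T \<theta> = R' \<theta> ** (M \<theta> ** M \<theta>) ** R' \<theta>"
      unfolding T_def RR[symmetric] matrix_mul_assoc[symmetric] by (simp only: cancel)
    also have "\<dots> = X \<theta>"
      unfolding MM matrix_mul_assoc[symmetric] by (simp only: cancel RR' matrix_mul_rid)
    finally show ?thesis .
  qed
  have SYS: "S' \<theta> ** X \<theta> ** S' \<theta> = S \<theta> ** Y \<theta> ** S \<theta>" for \<theta>
    unfolding TYT[symmetric] SS[symmetric] matrix_mul_assoc[symmetric]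
    by (simp only: cancel SS' matrix_mul_rid)
  have TY: "T \<theta> ** Y \<theta> = R' \<theta> ** M \<theta> ** R \<theta>" for \<theta>
    unfolding T_def RR[symmetric] matrix_mul_assoc[symmetric] by (simp only: cancel)
  have trT: "trace (T \<theta> ** Y \<theta>) = trace (M \<theta>)" for \<theta>
    unfolding TY using trace_mul_sym[of "R' \<theta> ** M \<theta>" "R \<theta>"] by (simp add: matrix_mul_assoc RR')
  have trS: "trace (S \<theta> ** Y \<theta> ** S \<theta>) = trace (M \<theta>)" for \<theta>
    using trace_mul_sym[of "S \<theta> ** Y \<theta>" "S \<theta>"] trT[of \<theta>] by (simp add: matrix_mul_assoc SS)
  have zx: "zero_mean_stationary px" and zy: "zero_mean_stationary py"
    using px(1) py(1) by (auto simp: zero_mean_gaussian_stationary_def)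
  have reg: "bdd_meas F" "F (refl_torus \<theta>) = cconj (F \<theta>)" "adj (F \<theta>) = F \<theta>"
    if "regular_density a A F" for a A and F :: "real ^ 'd \<Rightarrow> complex ^ 'm ^ 'm" and \<theta>
    using that pd_between_adj[of a A "F \<theta>"] by (auto simp: regular_density_def)
  define V where "V = (\<integral>\<theta>. Re (trace (X \<theta> + Y \<theta> - 2 *\<^sub>R M \<theta>)) \<partial>torus_measure)"
  have V1: "V = (\<integral>\<theta>. Re (trace (X \<theta> + Y \<theta> - 2 *\<^sub>R (T \<theta> ** Y \<theta>))) \<partial>torus_measure)"
    by (simp add: V_def trace_sub trace_scaleR trT)
  have V2: "V = (\<integral>\<theta>. Re (trace (X \<theta> + Y \<theta> - 2 *\<^sub>R (S \<theta> ** Y \<theta> ** S \<theta>))) \<partial>torus_measure)"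
    by (simp add: V_def trace_sub trace_scaleR trS)
  from optimal_coupling_exists[OF px(1,2) reg(1)[OF px(3)] py(1,2) reg(1)[OF py(3)] reg(1)[OF T] reg(2)[OF T] reg(3)[OF T] TYT, of t]
  obtain q where q: "q \<in> gaussian_couplings px py" "transport_cost q t = V"
    unfolding V1 .
  have lower: "V \<le> transport_cost q' t" if "q' \<in> gaussian_couplings px py" for q'
    unfolding V2
    by (rule coupling_cost_ge[OF that zx px(2) reg(1)[OF px(3)] zy py(2) reg(1)[OF py(3)] reg(1)[OF S(1)] reg(2)[OF S(1)] reg(3)[OF S(1)]
          reg(1)[OF S'] reg(2)[OF S'] reg(3)[OF S'] SS'(2) SYS])
  have inf: "(INF q\<in>gaussian_couplings px py. transport_cost q t) = V"
    by (rule cInf_eq_minimum) (use q lower in auto)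
  then show "(INF q\<in>gaussian_couplings px py. transport_cost q t) =
      (\<integral>\<theta>. Re (trace (X \<theta> + Y \<theta> - 2 *\<^sub>R M \<theta>)) \<partial>torus_measure)" by (simp only: V_def)
  have "0 \<le> transport_cost q t" unfolding transport_cost_def by simp
  then show "0 \<le> (INF q\<in>gaussian_couplings px py. transport_cost q t)" using inf q by simp
  show "bdd_meas M" by (rule reg(1)[OF M])
  show "adj (M \<theta>) = M \<theta>" by (rule reg(3)[OF M])
qed

theorem proposition1:
  fixes px py :: "(int ^ 'd \<Rightarrow> real ^ 'm) measure"
    and \<Phi>x \<Phi>y :: "real ^ 'd \<Rightarrow> complex ^ 'm ^ 'm"
    and t :: "int ^ 'd"
  assumes "zero_mean_gaussian_stationary px" and "zero_mean_gaussian_stationary py"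
    and "spectral_density px \<Phi>x" and "spectral_density py \<Phi>y"
    and "\<Phi>x \<in> bounded_coercive_densities" and "\<Phi>y \<in> bounded_coercive_densities"
  shows "complex_of_real ((transport_distance t px py)\<^sup>2) =
           trace (\<integral>\<theta>. \<Phi>x \<theta> + \<Phi>y \<theta>
             - 2 *\<^sub>R psd_sqrt (psd_sqrt (\<Phi>y \<theta>) ** \<Phi>x \<theta> ** psd_sqrt (\<Phi>y \<theta>)) \<partial>torus_measure)
         \<and> transport_distance t px py = hellinger_distance \<Phi>x \<Phi>y"
proof -
  obtain c1 C1 where c1: "0 < c1" "c1 \<le> C1" "AE \<theta> in torus_measure. pd_between c1 C1 (\<Phi>x \<theta>)"
    using assms(5) unfolding bounded_coercive_densities_def pd_between_def by blast
  obtain c2 C2 where c2: "0 < c2" "c2 \<le> C2" "AE \<theta> in torus_measure. pd_between c2 C2 (\<Phi>y \<theta>)"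
    using assms(6) unfolding bounded_coercive_densities_def pd_between_def by blast
  define c C where "c = min c1 c2" and "C = max C1 C2"
  have c: "0 < c" "c \<le> C" using c1 c2 by (auto simp: c_def C_def)
  have "AE \<theta> in torus_measure. pd_between c C (\<Phi>x \<theta>)"
    using c1(3) by eventually_elim (erule pd_between_mono, auto simp: c_def C_def)
  from regular_density_version[OF assms(3) c this] obtain X where
    X: "regular_density c C X" "spectral_density px X" "AE \<theta> in torus_measure. \<Phi>x \<theta> = X \<theta>" by blast
  have "AE \<theta> in torus_measure. pd_between c C (\<Phi>y \<theta>)"
    using c2(3) by eventually_elim (erule pd_between_mono, auto simp: c_def C_def)
  from regular_density_version[OF assms(4) c this] obtain Y where
    Y: "regular_density c C Y" "spectral_density py Y" "AE \<theta> in torus_measure. \<Phi>y \<theta> = Y \<theta>" by blast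
  define M where "M \<theta> = psd_sqrt (psd_sqrt (Y \<theta>) ** X \<theta> ** psd_sqrt (Y \<theta>))" for \<theta>
  define F where "F \<theta> = X \<theta> + Y \<theta> - 2 *\<^sub>R M \<theta>" for \<theta>
  define D where "D \<theta> = \<Phi>x \<theta> + \<Phi>y \<theta> - 2 *\<^sub>R psd_sqrt (psd_sqrt (\<Phi>y \<theta>) ** \<Phi>x \<theta> ** psd_sqrt (\<Phi>y \<theta>))" for \<theta>
  define V where "V = (\<integral>\<theta>. Re (trace (F \<theta>)) \<partial>torus_measure)"
  note INF = transport_cost_INF[OF assms(1) X(2,1) assms(2) Y(2,1) c(1), folded M_def]
  have inf: "(INF q\<in>gaussian_couplings px py. transport_cost q t) = V"
    using INF(1)[of t] by (simp add: V_def F_def)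
  have V: "0 \<le> V" using INF(2)[of t] inf by simp
  have Fm: "bdd_meas F"
    unfolding F_def[abs_def] using X(1) Y(1) INF(3)
    by (intro bdd_meas_diff bdd_meas_add bdd_meas_scaleR) (auto simp: regular_density_def)
  have ae: "AE \<theta> in torus_measure. F \<theta> = D \<theta>"
    using X(3) Y(3) by eventually_elim (simp add: F_def D_def M_def)
  have Dm: "D \<in> borel_measurable torus_measure"
    by (rule complete_measure.borel_measurable_AE_cong[OF complete_measure_torus bdd_meas_measurable[OF Fm] ae])
  have "(\<integral>\<theta>. D \<theta> \<partial>torus_measure) = (\<integral>\<theta>. F \<theta> \<partial>torus_measure)"
    by (rule integral_cong_AE[OF Dm bdd_meas_measurable[OF Fm]]) (use ae in \<open>auto elim: AE_mp\<close>)
  moreover have "trace (\<integral>\<theta>. F \<theta> \<partial>torus_measure) = complex_of_real V"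
  proof -
    have "bounded_linear (trace :: complex ^ 'm ^ 'm \<Rightarrow> complex)"
      unfolding linear_conv_bounded_linear[symmetric] by (intro linearI trace_add trace_scaleR)
    then have "trace (\<integral>\<theta>. F \<theta> \<partial>torus_measure) = (\<integral>\<theta>. trace (F \<theta>) \<partial>torus_measure)"
      using integral_bounded_linear[OF _ bdd_meas_integrable[OF Fm]] by metis
    also have "\<dots> = (\<integral>\<theta>. complex_of_real (Re (trace (F \<theta>))) \<partial>torus_measure)"
    proof (rule Bochner_Integration.integral_cong[OF refl])
      fix \<theta>
      have "adj (F \<theta>) = F \<theta>"
        using X(1) Y(1) INF(4)[of \<theta>] pd_between_adj[of c C "X \<theta>"] pd_between_adj[of c C "Y \<theta>"]
        by (simp add: F_def regular_density_def)
      then have "F \<theta> $ i $ i = cnj (F \<theta> $ i $ i)" for i by (metis adj_nth)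
      then have "Im (F \<theta> $ i $ i) = 0" for i by (metis complex_cnj_cancel_iff cnj.simps(2) add.inverse_neutral neg_equal_zero)
      then show "trace (F \<theta>) = complex_of_real (Re (trace (F \<theta>)))"
        by (simp add: trace_def complex_eq_iff)
    qed
    finally show ?thesis by (simp add: V_def)
  qed
  ultimately have tr: "trace (\<integral>\<theta>. D \<theta> \<partial>torus_measure) = complex_of_real V" by simp
  have "complex_of_real ((transport_distance t px py)\<^sup>2) = trace (\<integral>\<theta>. D \<theta> \<partial>torus_measure)"
    using V by (simp add: transport_distance_def inf tr)
  moreover have "transport_distance t px py = hellinger_distance \<Phi>x \<Phi>y"
    unfolding transport_distance_def inf hellinger_distance_def D_def[symmetric] tr by simp
  ultimately show ?thesis by (simp only: D_def)
qed

end
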